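(* Let $\Psi\in\mathcal L$ and let $\lambda$ be a Borel function with period $\kappa>0$ and $0\le\lambda(t)\le\lambda_h\in(0,\infty)$ for all $t$. Assume $\rho_h=\lambda_h\int_0^\infty y\,dG(y)<1$. Let $\eta$ be the number of customers served during a busy period (started by a single customer arriving to an empty system) of a FCFS $M/G/1$ queue (no balking) with arrival rate $\lambda_h$ and service cdf $G$. If $G$ is subexponential and $$\lim_{u\to\infty}\frac{P(\eta>u)}{1-G\big(u(1-\rho_h)/\lambda_h\big)}=(1-\rho_h)^{-1},$$ then $$\limsup_{u\to\infty}\frac{P(\eta^*_\lambda>u)}{1-G\Big(\frac{[u-\max\{\kappa,1\}](1-\rho_h)}{\lambda_h}\Big)}\le\frac{1-e^{-\kappa\lambda_h}}{(1-\rho_h)e^{-\kappa\lambda_h}}.$$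
   Context: $\mathcal L$ is the set of all bivariate cdfs with support in $(0,\infty)\times(0,\infty]$. For $\Psi\in\mathcal L$, $G(s)=\Psi(s,\infty)$. The $M_t/G(\Psi)/1+H(\Psi)$ queue is defined as follows. - It is a single-server FCFS queue with infinite waiting room, started empty at time $0$. - Arrivals form an inhomogeneous Poisson process of rate $\lambda(\cdot)$. - $(S_i,Y_i)$ are iid with cdf $\Psi$ and independent of the arrivals. - The $i$-th arrival at time $T_i$ joins if and only if $Y_i\ge W_\lambda(T_i-)$, where $W_\lambda$ is the workload (decreasing at unit rate while positive), and if he joins the workload jumps by $S_i$. $N^*_\lambda(t)$ is the number of customers who joined in $[0,t]$. Define $$\xi_\lambda=\inf\{\kappa n:n\in\mathbb N,\ W_\lambda(\kappa n)=0\},\qquad \eta^*_\lambda=N^*_\lambda(\xi_\lambda),$$ the number of customers who join during $[0,\xi_\lambda]$. *)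

theory Defs
  imports "HOL-Probability.Probability"
begin

definition in_L :: "(real \<Rightarrow> ereal \<Rightarrow> real) \<Rightarrow> bool" where
  "in_L Psi \<longleftrightarrow> (\<exists>mu :: (real \<times> ereal) measure.
      prob_space mu \<and> sets mu = sets borel \<and>
      measure mu ({0<..} \<times> {0<..}) = 1 \<and>
      (\<forall>s y. Psi s y = measure mu ({..s} \<times> {..y})))"

text \<open>Number of arrivals in [0,t] of an arrival-time sequence (oo = no such arrival).\<close>
definition arr_count :: "(nat \<Rightarrow> ereal) \<Rightarrow> real \<Rightarrow> nat" where
  "arr_count T t = card {i. T i \<le> ereal t}"

text \<open>Pathwise queue dynamics.  Customers are indexed 0,1,2,...; customer i arrives
  at T i with mark (S i, Y i).  wl_before T S Y i is the workload W(T_i -) seen by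
  customer i just before his arrival (the system starts empty).\<close>
fun wl_before :: "(nat \<Rightarrow> ereal) \<Rightarrow> (nat \<Rightarrow> real) \<Rightarrow> (nat \<Rightarrow> ereal) \<Rightarrow> nat \<Rightarrow> real" where
  "wl_before T S Y 0 = 0"
| "wl_before T S Y (Suc i) =
     max 0 (wl_before T S Y i + (if ereal (wl_before T S Y i) \<le> Y i then S i else 0)
            - (real_of_ereal (T (Suc i)) - real_of_ereal (T i)))"

definition joins :: "(nat \<Rightarrow> ereal) \<Rightarrow> (nat \<Rightarrow> real) \<Rightarrow> (nat \<Rightarrow> ereal) \<Rightarrow> nat \<Rightarrow> bool" where
  "joins T S Y i \<longleftrightarrow> ereal (wl_before T S Y i) \<le> Y i"

definition workload :: "(nat \<Rightarrow> ereal) \<Rightarrow> (nat \<Rightarrow> real) \<Rightarrow> (nat \<Rightarrow> ereal) \<Rightarrow> real \<Rightarrow> real" where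
  "workload T S Y t =
     (if \<exists>i. T i \<le> ereal t then
        (let i = (GREATEST i. T i \<le> ereal t) in
          max 0 (wl_before T S Y i + (if joins T S Y i then S i else 0) - (t - real_of_ereal (T i))))
      else 0)"

definition xi :: "real \<Rightarrow> (nat \<Rightarrow> ereal) \<Rightarrow> (nat \<Rightarrow> real) \<Rightarrow> (nat \<Rightarrow> ereal) \<Rightarrow> ereal" where
  "xi kappa T S Y =
     (if \<exists>n::nat. 1 \<le> n \<and> workload T S Y (kappa * real n) = 0
      then ereal (kappa * real (LEAST n::nat. 1 \<le> n \<and> workload T S Y (kappa * real n) = 0))
      else \<infinity>)"

definition eta_star :: "real \<Rightarrow> (nat \<Rightarrow> ereal) \<Rightarrow> (nat \<Rightarrow> real) \<Rightarrow> (nat \<Rightarrow> ereal) \<Rightarrow> ereal" where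
  "eta_star kappa T S Y =
     (let A = {i. T i \<noteq> \<infinity> \<and> T i \<le> xi kappa T S Y \<and> joins T S Y i}
      in if finite A then ereal (real (card A)) else \<infinity>)"

text \<open>Number of customers served in the busy period started by the first customer
  (who arrives to an empty system): the busy period contains customers 0..n-1 where
  n is the first later customer finding the system empty (oo if none).\<close>
definition busy_count :: "(nat \<Rightarrow> ereal) \<Rightarrow> (nat \<Rightarrow> real) \<Rightarrow> (nat \<Rightarrow> ereal) \<Rightarrow> ereal" where
  "busy_count T S Y =
     (if \<exists>n::nat. 1 \<le> n \<and> T n \<noteq> \<infinity> \<and> wl_before T S Y n = 0
      then ereal (real (LEAST n::nat. 1 \<le> n \<and> T n \<noteq> \<infinity> \<and> wl_before T S Y n = 0))
      else \<infinity>)"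

text \<open>Inhomogeneous Poisson arrival process of rate lam on (0,oo), given by its
  ordered arrival times (oo once there are no further arrivals): simple, locally
  finite paths, independent increments, Poisson distributed increments with mean
  the integral of lam.\<close>
definition poisson_arrivals :: "'a measure \<Rightarrow> (real \<Rightarrow> real) \<Rightarrow> (nat \<Rightarrow> 'a \<Rightarrow> ereal) \<Rightarrow> bool" where
  "poisson_arrivals M lam T \<longleftrightarrow>
     (\<forall>i. T i \<in> borel_measurable M) \<and>
     (\<forall>\<omega>\<in>space M. (\<forall>i. 0 < T i \<omega>) \<and>
                   (\<forall>i. T i \<omega> \<noteq> \<infinity> \<longrightarrow> T i \<omega> < T (Suc i) \<omega>) \<and>
                   (\<forall>i. T i \<omega> = \<infinity> \<longrightarrow> T (Suc i) \<omega> = \<infinity>) \<and>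
                   (\<forall>t::real. finite {i. T i \<omega> \<le> ereal t})) \<and>
     (\<forall>(n::nat) (t::nat \<Rightarrow> real). 0 \<le> t 0 \<and> (\<forall>k<n. t k < t (Suc k)) \<longrightarrow>
        prob_space.indep_vars M (\<lambda>_. count_space UNIV)
          (\<lambda>k \<omega>. arr_count (\<lambda>i. T i \<omega>) (t (Suc k)) - arr_count (\<lambda>i. T i \<omega>) (t k)) {..<n} \<and>
        (\<forall>k<n. \<forall>m::nat.
           measure M {\<omega>\<in>space M. arr_count (\<lambda>i. T i \<omega>) (t (Suc k)) - arr_count (\<lambda>i. T i \<omega>) (t k) = m}
           = (LBINT s=t k..t (Suc k). lam s) ^ m / fact m * exp (- (LBINT s=t k..t (Suc k). lam s))))"

definition queue_input :: "'a measure \<Rightarrow> (real \<Rightarrow> real) \<Rightarrow> (real \<Rightarrow> ereal \<Rightarrow> real) \<Rightarrow>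
    (nat \<Rightarrow> 'a \<Rightarrow> ereal) \<Rightarrow> (nat \<Rightarrow> 'a \<Rightarrow> real) \<Rightarrow> (nat \<Rightarrow> 'a \<Rightarrow> ereal) \<Rightarrow> bool" where
  "queue_input M lam Psi T S Y \<longleftrightarrow>
     prob_space M \<and>
     poisson_arrivals M lam T \<and>
     prob_space.indep_vars M (\<lambda>_. borel) (\<lambda>i \<omega>. (S i \<omega>, Y i \<omega>)) UNIV \<and>
     (\<forall>i s y. measure M {\<omega>\<in>space M. S i \<omega> \<le> s \<and> Y i \<omega> \<le> y} = Psi s y) \<and>
     prob_space.indep_set M
       (sigma_sets (space M) {T i -` A \<inter> space M | i A. A \<in> sets borel})
       (sigma_sets (space M) {(\<lambda>\<omega>. (S i \<omega>, Y i \<omega>)) -` A \<inter> space M | i A. A \<in> sets borel})"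

definition subexponential :: "(real \<Rightarrow> real) \<Rightarrow> bool" where
  "subexponential G \<longleftrightarrow> (\<forall>x. G x < 1) \<and>
     ((\<lambda>x. (1 - (\<integral>y. G (x - y) \<partial>interval_measure G)) / (1 - G x)) \<longlongrightarrow> 2) at_top"

end

theory Submission
  imports Defs
begin

text \<open>Run the clock \<open>A t = (\<integral>\<^sub>0\<^sup>t lam) / lam_h\<close>.  At the times \<open>A (T i)\<close> the arrivals form a Poisson process of
  constant rate \<open>lam_h\<close>, and as \<open>A\<close> is 1-Lipschitz, the M/G/1 queue without balking that is fed by them with
  the same services has shorter gaps than the given queue and dominates it customer by customer.  When
  the dominating queue idles for at least \<open>kappa\<close>, the given queue is empty at a multiple of \<open>kappa\<close>.
  So \<open>\<eta>\<^sup>*\<close> is at most the number of customers that the dominating queue receives before such an idle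
  period: a geometric sum of independent copies of \<open>\<eta>\<close> with parameter \<open>q = 1 - exp (- kappa * lam_h)\<close>.
  Its tail \<open>R\<close> solves a defective renewal equation.  The tail of \<open>\<eta>\<close> is equivalent to
  \<open>h k = 1 - G (k (1 - rho_h) / lam_h)\<close> up to the factor \<open>c = 1 / (1 - rho_h)\<close>, so subexponentiality shows
  that \<open>R \<le> \<alpha> h\<close> for some \<open>\<alpha>\<close>, and that \<open>L = limsup R / h\<close> satisfies \<open>L \<le> q (c + L)\<close>, hence
  \<open>L \<le> q c / (1 - q)\<close>.  The shift by \<open>max kappa 1 \<ge> 1\<close> absorbs the rounding of \<open>u\<close> to an integer.\<close>

section \<open>Defective renewal equations\<close>

text \<open>The arrival hypotheses speak of counts in intervals, whereas the queues depend on gaps,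
  and the two queues live on unrelated probability spaces. Both are therefore transported to the
  product of two stream spaces: iid exponential gaps and iid services with cdf \<open>G\<close>.
  There \<open>busy_count > u\<close> becomes a \<open>surv 0\<close> event exactly, so the
  hypothesis on \<open>\<eta>\<close> is one on \<open>busy_tail\<close>, while
  \<open>eta_star > u\<close> is only contained in a \<open>surv kappa\<close> event. The rate may
  vanish on intervals, so the clock can stand still: its inverse has to select the last time at each
  level, and a rate with integral 0 over a period is a case of its own. The renewal structure comes
  from lack of memory: whenever the work runs out, the next idle time is exponential and stays below
  \<open>kappa\<close> with the same probability \<open>q\<close>, whatever happened before. In
  \<open>L = q (c + L)\<close> the two terms are the two places of a single big jump, the first busy
  period (\<open>c\<close>) and the remainder (\<open>L\<close>).\<close>

lemma defective_renewal_ratio_bounded: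
  fixes h Fb R :: "nat \<Rightarrow> real" and q c :: real
  assumes h: "\<And>k. 0 < h k"
    and q: "0 \<le> q" "q < 1"
    and R: "\<And>k. R k = q * (Fb k + (\<Sum>n<k. (Fb n - Fb (Suc n)) * R (k - Suc n)))"
    and R1: "\<And>k. R k \<le> 1"
    and Fb_dec: "\<And>k. Fb (Suc k) \<le> Fb k"
    and lim: "(\<lambda>k. Fb k / h k) \<longlonglongrightarrow> c"
    and conv: "\<And>e. 0 < e \<Longrightarrow> \<forall>\<^sub>F k in sequentially.
                 (\<Sum>n<k. (Fb n - Fb (Suc n)) * h (k - Suc n)) \<le> (1 + e) * h k"
  shows "\<exists>\<alpha>\<ge>0. \<forall>k. R k \<le> \<alpha> * h k"
proof -
  \<comment> \<open>Defectivity \<open>q < 1\<close> leaves room for the convolution error; for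
    \<open>q \<noteq> 0\<close> the witness makes \<open>q * (1 + e)\<close> the midpoint of
    \<open>q\<close> and 1.\<close>
  obtain e where e: "0 < e" "q * (1 + e) < 1"
  proof (cases "q = 0")
    case True then show ?thesis using that[of 1] by simp
  next
    case False
    then have "q * (1 + (1 - q) / (2 * q)) = q + (1 - q) / 2" by (simp add: field_simps)
    then show ?thesis using that[of "(1 - q) / (2 * q)"] False q by (simp add: field_simps)
  qed
  have "\<forall>\<^sub>F k in sequentially. Fb k / h k < \<bar>c\<bar> + 1"
    using lim by (rule order_tendstoD) simp
  then have "\<forall>\<^sub>F k in sequentially. Fb k \<le> (\<bar>c\<bar> + 1) * h k"
    using h by (auto elim!: eventually_mono simp: field_simps less_imp_le)
  then have "\<forall>\<^sub>F k in sequentially. (\<Sum>n<k. (Fb n - Fb (Suc n)) * h (k - Suc n)) \<le> (1 + e) * h k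
      \<and> Fb k \<le> (\<bar>c\<bar> + 1) * h k"
    using conv[OF e(1)] by eventually_elim simp
  then obtain k0 where k0:
    "\<And>k. k \<ge> k0 \<Longrightarrow> Fb k \<le> (\<bar>c\<bar> + 1) * h k"
    "\<And>k. k \<ge> k0 \<Longrightarrow> (\<Sum>n<k. (Fb n - Fb (Suc n)) * h (k - Suc n)) \<le> (1 + e) * h k"
    unfolding eventually_sequentially by blast
  \<comment> \<open>From \<open>k0\<close> on, the induction closes if \<open>\<alpha>\<close> is at
    least the solution of \<open>\<alpha> = q * (\<bar>c\<bar> + 1 + \<alpha> * (1 + e))\<close>,
    the first summand. Below \<open>k0\<close> only \<open>R k \<le> 1\<close> is available, and the
    summand \<open>1 / h k\<close> makes \<open>\<alpha> * h k\<close> at least 1.\<close>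
  define \<alpha> where "\<alpha> = q * (\<bar>c\<bar> + 1) / (1 - q * (1 + e)) + (\<Sum>k<k0. 1 / h k)"
  have pos: "0 \<le> (\<Sum>k<k0. 1 / h k)" using h by (auto intro!: sum_nonneg simp: less_imp_le)
  have \<alpha>0: "0 \<le> \<alpha>" using pos e q unfolding \<alpha>_def by (intro add_nonneg_nonneg) auto
  have "q * (\<bar>c\<bar> + 1) / (1 - q * (1 + e)) \<le> \<alpha>" using pos by (simp add: \<alpha>_def)
  then have \<alpha>1: "q * ((\<bar>c\<bar> + 1) + \<alpha> * (1 + e)) \<le> \<alpha>"
    using e by (simp add: pos_divide_le_eq algebra_simps)
  have "R k \<le> \<alpha> * h k" for k
  proof (induction k rule: less_induct)
    case (less k)
    show ?case
    proof (cases "k < k0")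
      case True
      then have "1 / h k \<le> (\<Sum>k<k0. 1 / h k)"
        using h by (intro member_le_sum) (auto simp: less_imp_le)
      also have "\<dots> \<le> \<alpha>" using e q by (auto simp: \<alpha>_def)
      finally have "1 \<le> \<alpha> * h k" using h[of k] by (simp add: field_simps)
      then show ?thesis using R1[of k] by linarith
    next
      case False
      then have k: "k \<ge> k0" by simp
      have "(\<Sum>n<k. (Fb n - Fb (Suc n)) * R (k - Suc n))
          \<le> (\<Sum>n<k. (Fb n - Fb (Suc n)) * (\<alpha> * h (k - Suc n)))"
        using less.IH Fb_dec by (intro sum_mono mult_left_mono) auto
      also have "\<dots> = \<alpha> * (\<Sum>n<k. (Fb n - Fb (Suc n)) * h (k - Suc n))"
        by (simp add: sum_distrib_left algebra_simps)
      also have "\<dots> \<le> \<alpha> * ((1 + e) * h k)" using k0(2)[OF k] \<alpha>0 by (rule mult_left_mono)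
      finally have "R k \<le> q * ((\<bar>c\<bar> + 1) * h k + \<alpha> * ((1 + e) * h k))"
        unfolding R[of k] using k0(1)[OF k] q(1) by (intro mult_left_mono add_mono)
      also have "\<dots> = q * ((\<bar>c\<bar> + 1) + \<alpha> * (1 + e)) * h k" by (simp add: algebra_simps)
      also have "\<dots> \<le> \<alpha> * h k" using \<alpha>1 h[of k] by (intro mult_right_mono) auto
      finally show ?thesis .
    qed
  qed
  then show ?thesis using \<alpha>0 by blast
qed

text \<open>In the convolution, \<open>R\<close> is replaced by \<open>r * h\<close> where its
  argument is large and by 1 in the last \<open>k1\<close> terms. The latter telescope to
  \<open>Fb (k - k1) - Fb k\<close>, which is negligible against \<open>h\<close> because
  \<open>h\<close> is long-tailed and \<open>Fb / h\<close> converges. Hence an eventual bound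
  \<open>r\<close> improves to \<open>q * (c + r) + d\<close>, and the least bound obeys the
  limiting inequality.\<close>

lemma defective_renewal_tail:
  fixes h Fb R :: "nat \<Rightarrow> real" and q c :: real
  assumes h: "\<And>k. 0 < h k"
    and q: "0 \<le> q" "q < 1"
    and R: "\<And>k. R k = q * (Fb k + (\<Sum>n<k. (Fb n - Fb (Suc n)) * R (k - Suc n)))"
    and R0: "\<And>k. 0 \<le> R k" and R1: "\<And>k. R k \<le> 1"
    and Fb_dec: "\<And>k. Fb (Suc k) \<le> Fb k"
    and lim: "(\<lambda>k. Fb k / h k) \<longlonglongrightarrow> c"
    and long: "\<And>j. (\<lambda>k. h (k - j) / h k) \<longlonglongrightarrow> 1"
    and conv: "\<And>e. 0 < e \<Longrightarrow> \<forall>\<^sub>F k in sequentially.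
                 (\<Sum>n<k. (Fb n - Fb (Suc n)) * h (k - Suc n)) \<le> (1 + e) * h k"
    and e: "0 < e"
  shows "\<forall>\<^sub>F k in sequentially. R k \<le> (q * c / (1 - q) + e) * h k"
proof -
  \<comment> \<open>\<open>Inf X\<close> is the limsup of \<open>R / h\<close>; the ratio bound
    makes \<open>X\<close> nonempty, so this limsup is finite and \<open>L \<le> q * (c + L)\<close>
    can be solved for it.\<close>
  define X where "X = {r. 0 \<le> r \<and> (\<forall>\<^sub>F k in sequentially. R k \<le> r * h k)}"
  obtain \<alpha> where "0 \<le> \<alpha>" "\<And>k. R k \<le> \<alpha> * h k"
    using defective_renewal_ratio_bounded[OF h q R R1 Fb_dec lim conv] by blast
  then have "\<alpha> \<in> X" by (auto simp: X_def)
  have bdd: "bdd_below X" by (auto simp: X_def bdd_below_def)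
  define L where "L = Inf X"
  have L0: "0 \<le> L" unfolding L_def using \<open>\<alpha> \<in> X\<close> by (intro cInf_greatest) (auto simp: X_def)
  have imp: "q * (c + r) + d \<in> X" if r: "r \<in> X" and d: "0 < d" for r d
  proof -
    have r0: "0 \<le> r" using r by (simp add: X_def)
    have rX: "\<forall>\<^sub>F k in sequentially. R k \<le> r * h k" using r by (simp add: X_def)
    obtain k1 where k1: "\<And>k. k \<ge> k1 \<Longrightarrow> R k \<le> r * h k"
      using rX unfolding eventually_sequentially by blast
    define g where "g k = Fb k / h k + r * (\<Sum>n<k. (Fb n - Fb (Suc n)) * h (k - Suc n)) / h k
        + (Fb (k - k1) / h k - Fb k / h k)" for k
    have bound: "R k \<le> q * g k * h k" if "k \<ge> k1" for k
    proof -
      have "(\<Sum>n<k. (Fb n - Fb (Suc n)) * R (k - Suc n)) \<le>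
          (\<Sum>n<k. (Fb n - Fb (Suc n)) * (r * h (k - Suc n)) + (if k - k1 \<le> n then Fb n - Fb (Suc n) else 0))"
      proof (rule sum_mono)
        fix n assume "n \<in> {..<k}"
        then have n: "n < k" by simp
        show "(Fb n - Fb (Suc n)) * R (k - Suc n) \<le>
          (Fb n - Fb (Suc n)) * (r * h (k - Suc n)) + (if k - k1 \<le> n then Fb n - Fb (Suc n) else 0)"
        proof (cases "k - k1 \<le> n")
          case True
          have "(Fb n - Fb (Suc n)) * R (k - Suc n) \<le> (Fb n - Fb (Suc n)) * 1"
            using R1 Fb_dec by (intro mult_left_mono) auto
          moreover have "0 \<le> (Fb n - Fb (Suc n)) * (r * h (k - Suc n))"
            using Fb_dec r0 h by (intro mult_nonneg_nonneg) (auto simp: less_imp_le)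
          ultimately show ?thesis using True by simp
        next
          case False
          then have "R (k - Suc n) \<le> r * h (k - Suc n)" using n by (intro k1) auto
          then show ?thesis using False Fb_dec by (auto intro!: mult_left_mono)
        qed
      qed
      also have "\<dots> = r * (\<Sum>n<k. (Fb n - Fb (Suc n)) * h (k - Suc n))
          + (\<Sum>n<k. if k - k1 \<le> n then Fb n - Fb (Suc n) else 0)"
        unfolding sum.distrib by (simp add: sum_distrib_left mult.left_commute)
      also have "(\<Sum>n<k. if k - k1 \<le> n then Fb n - Fb (Suc n) else 0)
          = (\<Sum>n\<in>{k-k1..<k}. Fb n - Fb (Suc n))"
        by (rule sum.mono_neutral_cong_right) auto
      also have "\<dots> = Fb (k - k1) - Fb k"
        using sum_Suc_diff'[of "k - k1" k "\<lambda>n. - Fb n"] by simp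
      finally have "R k \<le> q * (Fb k + (r * (\<Sum>n<k. (Fb n - Fb (Suc n)) * h (k - Suc n)) + (Fb (k - k1) - Fb k)))"
        unfolding R[of k] using q(1) by (intro mult_left_mono add_left_mono)
      also have "\<dots> = q * g k * h k" using h[of k] by (simp add: g_def field_simps)
      finally show ?thesis .
    qed
    have l1: "(\<lambda>k. Fb (k - k1) / h k - Fb k / h k) \<longlonglongrightarrow> 0"
    proof -
      have "(\<lambda>k. Fb (k - k1) / h (k - k1)) \<longlonglongrightarrow> c"
        by (rule filterlim_compose[OF lim]) (rule filterlim_minus_const_nat_at_top)
      from tendsto_mult[OF this long[of k1]]
      have "(\<lambda>k. Fb (k - k1) / h (k - k1) * (h (k - k1) / h k)) \<longlonglongrightarrow> c" by simp
      moreover have "Fb (k - k1) / h (k - k1) * (h (k - k1) / h k) = Fb (k - k1) / h k" for k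
        using h[of "k - k1"] by simp
      ultimately have "(\<lambda>k. Fb (k - k1) / h k) \<longlonglongrightarrow> c" by (simp only:)
      from tendsto_diff[OF this lim] show ?thesis by simp
    qed
    define d' where "d' = d / (2 * (r + 1))"
    have d': "0 < d'" using d r0 by (simp add: d'_def)
    have rd': "r * d' \<le> d / 2" using d r0 by (simp add: d'_def field_simps)
    have "\<forall>\<^sub>F k in sequentially. Fb k / h k + (Fb (k - k1) / h k - Fb k / h k) < c + d / 2"
      using tendsto_add[OF lim l1] d by (intro order_tendstoD(2)) auto
    with conv[OF d'] have "\<forall>\<^sub>F k in sequentially. g k \<le> c + r + d"
    proof eventually_elim
      case (elim k)
      have "(\<Sum>n<k. (Fb n - Fb (Suc n)) * h (k - Suc n)) / h k \<le> 1 + d'"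
        using elim(1) h[of k] by (simp add: pos_divide_le_eq)
      then have "r * ((\<Sum>n<k. (Fb n - Fb (Suc n)) * h (k - Suc n)) / h k) \<le> r * (1 + d')"
        using r0 by (rule mult_left_mono)
      then show ?case using elim(2) rd' by (simp add: g_def algebra_simps)
    qed
    then have ev: "\<forall>\<^sub>F k in sequentially. R k \<le> (q * (c + r) + d) * h k"
      using eventually_ge_at_top[of k1]
    proof eventually_elim
      case (elim k)
      have "q * g k \<le> q * (c + r + d)" using elim q by (intro mult_left_mono) auto
      also have "\<dots> \<le> q * (c + r) + 1 * d" using q d by (simp add: algebra_simps)
      finally have "q * g k * h k \<le> (q * (c + r) + d) * h k"
        using h[of k] by (intro mult_right_mono) auto
      then show ?case using bound[of k] elim by simp
    qed
    \<comment> \<open>Nonnegativity, demanded by \<open>X\<close>, is inherited from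
      \<open>R\<close> at any \<open>k\<close> where the new bound holds.\<close>
    moreover have "0 \<le> q * (c + r) + d"
    proof -
      obtain k where "R k \<le> (q * (c + r) + d) * h k"
        using eventually_happens[OF ev] by auto
      then have "0 \<le> (q * (c + r) + d) * h k" using R0[of k] by simp
      then show ?thesis using h[of k] by (simp add: zero_le_mult_iff)
    qed
    ultimately show ?thesis by (simp add: X_def)
  qed
  have "L \<le> q * (c + L) + d" if d: "0 < d" for d
  proof -
    obtain r where r: "r \<in> X" "r < L + d / 2"
      using cInf_lessD[of X "L + d/2"] \<open>\<alpha> \<in> X\<close> d unfolding L_def by auto
    have "L \<le> q * (c + r) + d / 2"
      unfolding L_def using bdd imp[OF r(1)] d by (intro cInf_lower) auto
    also have "\<dots> \<le> q * (c + L) + q * (d / 2) + d / 2"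
      using mult_left_mono[OF less_imp_le[OF r(2)] q(1)] by (simp add: algebra_simps)
    also have "q * (d / 2) \<le> 1 * (d / 2)" using q d by (intro mult_right_mono) auto
    finally show ?thesis by simp
  qed
  then have "L \<le> q * (c + L)" by (rule field_le_epsilon)
  then have "L \<le> q * c / (1 - q)" using q by (simp add: field_simps)
  then have "Inf X < q * c / (1 - q) + e" using e by (simp add: L_def)
  then obtain r where r: "r \<in> X" "r < q * c / (1 - q) + e"
    using cInf_lessD[of X] \<open>\<alpha> \<in> X\<close> by blast
  then have rX: "\<forall>\<^sub>F k in sequentially. R k \<le> r * h k" by (simp add: X_def)
  then show ?thesis
  proof eventually_elim
    case (elim k)
    have "r * h k \<le> (q * c / (1 - q) + e) * h k" using r(2) h[of k] by (intro mult_right_mono) auto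
    with elim show ?case by simp
  qed
qed

section \<open>Subexponential tails\<close>

text \<open>Subexponentiality is defined by an integral against the Stieltjes measure of
  \<open>G\<close>; uniqueness of the law with a given cdf turns it into an integral against the
  service law itself.\<close>

lemma (in real_distribution) interval_measure_cdf: "interval_measure (cdf M) = M"
proof (rule cdf_unique)
  show "real_distribution (interval_measure (cdf M))"
    using cdf_nondecreasing cdf_is_right_cont cdf_lim_at_bot cdf_lim_at_top_prob
    by (rule real_distribution_interval_measure)
  show "cdf (interval_measure (cdf M)) = cdf M"
    using cdf_nondecreasing cdf_is_right_cont cdf_lim_at_bot by (rule cdf_interval_measure)
qed (rule real_distribution_axioms)

lemma (in real_distribution) borel_measurable_cdf [measurable]: "cdf M \<in> borel_measurable borel"
  using cdf_nondecreasing by (intro borel_measurable_mono monoI)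

lemma (in real_distribution) tail_eq_measure: "1 - cdf M x = measure M {x<..}"
proof -
  have "measure M (UNIV - {..x}) = measure M (space M) - measure M {..x}"
    using finite_measure_compl[of "{..x}"] by simp
  moreover have "UNIV - {..x} = {x<..}" by auto
  ultimately show ?thesis using prob_space by (simp add: cdf_def)
qed

lemma (in real_distribution) AE_pos:
  assumes "cdf M 0 = 0"
  shows "AE y in M. 0 < y"
proof (rule AE_I')
  show "{..0} \<in> null_sets M" using assms by (auto simp: cdf_def null_sets_def emeasure_eq_measure)
qed auto

lemma (in real_distribution) integrable_bounded_tail:
  "integrable M (\<lambda>y. 1 - cdf M (x - y))"
  by (rule integrable_const_bound[where B = 1]) (auto simp: cdf_nonneg cdf_bounded_prob)

lemma (in real_distribution) subexponential_convolution_tail: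
  assumes "subexponential (cdf M)"
  shows "((\<lambda>x. (\<integral>y. 1 - cdf M (x - y) \<partial>M) / (1 - cdf M x)) \<longlongrightarrow> 2) at_top"
proof -
  have "integrable M (\<lambda>y. cdf M (x - y))" for x
    by (rule integrable_const_bound[where B = 1]) (auto simp: cdf_nonneg cdf_bounded_prob)
  then have "(\<integral>y. 1 - cdf M (x - y) \<partial>M) = 1 - (\<integral>y. cdf M (x - y) \<partial>M)" for x
    using prob_space by simp
  then show ?thesis
    using assms unfolding subexponential_def interval_measure_cdf by simp
qed

text \<open>Splitting the convolution tail at \<open>t\<close> and \<open>x\<close> squeezes the ratio from above.\<close>

lemma (in real_distribution) subexponential_long_tailed:
  assumes sub: "subexponential (cdf M)" and pos: "cdf M 0 = 0" and t: "0 \<le> t"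
  shows "((\<lambda>x. (1 - cdf M (x - t)) / (1 - cdf M x)) \<longlongrightarrow> 1) at_top"
proof -
  let ?G = "cdf M" and ?J = "\<lambda>x. \<integral>y. 1 - cdf M (x - y) \<partial>M"
  have G1: "?G x < 1" for x using sub by (simp add: subexponential_def)
  \<comment> \<open>\<open>1 - G (x - y)\<close> is at least \<open>1 - G x\<close> for
    \<open>0 < y \<le> t\<close>, at least \<open>1 - G (x - t)\<close> for
    \<open>t < y \<le> x\<close>, and equal to 1 for \<open>y > x\<close> because \<open>G\<close>
    vanishes on the negative axis.\<close>
  have lower: "?G t * (1 - ?G x) + (?G x - ?G t) * (1 - ?G (x - t)) + (1 - ?G x) \<le> ?J x"
    if x: "t \<le> x" for x
  proof -
    have eq: "(\<integral>y. indicator {0<..t} y * (1 - ?G x) + indicator {t<..x} y * (1 - ?G (x - t))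
        + indicator {x<..} y \<partial>M) =
       ?G t * (1 - ?G x) + (?G x - ?G t) * (1 - ?G (x - t)) + (1 - ?G x)"
    proof -
      have "measure M {0<..t} = ?G t"
        using t pos cdf_diff_eq[of 0 t] by (cases "t = 0") auto
      moreover have "measure M {t<..x} = ?G x - ?G t"
        using x cdf_diff_eq[of t x] by (cases "t = x") auto
      ultimately show ?thesis
        using tail_eq_measure[of x] by (simp add: finite_measure.emeasure_finite less_top[symmetric])
    qed
    have "AE y in M. 0 < y" using pos by (rule AE_pos)
    then have "(\<integral>y. indicator {0<..t} y * (1 - ?G x) + indicator {t<..x} y * (1 - ?G (x - t))
        + indicator {x<..} y \<partial>M) \<le> ?J x"
    proof (intro integral_mono_AE integrable_bounded_tail, goal_cases)
      case 1
      then show ?case by (simp add: finite_measure.emeasure_finite less_top[symmetric])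
    next
      case 2
      then show ?case
      proof eventually_elim
        case (elim y)
        have "?G (x - y) \<le> ?G x" "?G (x - y) \<le> ?G (x - t)" if "t < y" "y \<le> x"
          using that elim by (auto intro!: cdf_nondecreasing)
        moreover have "?G (x - y) \<le> ?G x" using elim by (auto intro!: cdf_nondecreasing)
        moreover have "?G (x - y) = 0" if "x < y"
          using that pos cdf_nondecreasing[of "x - y" 0] cdf_nonneg[of "x - y"] by simp
        ultimately show ?case using x G1[of "x - y"] by (auto simp: indicator_def)
      qed
    qed
    then show ?thesis by (simp only: eq)
  qed
  have tG: "(?G \<longlongrightarrow> 1) at_top" by (rule cdf_lim_at_top_prob)
  \<comment> \<open>Solving \<open>lower\<close> for the ratio gives this upper bound; the 2 of
    subexponentiality is exactly what makes its limit 1.\<close>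
  have "((\<lambda>x. (?J x / (1 - ?G x) - 1 - ?G t) / (?G x - ?G t)) \<longlongrightarrow> (2 - 1 - ?G t) / (1 - ?G t)) at_top"
    using G1[of t] by (intro tendsto_intros subexponential_convolution_tail sub tG) auto
  then have lim: "((\<lambda>x. (?J x / (1 - ?G x) - 1 - ?G t) / (?G x - ?G t)) \<longlongrightarrow> 1) at_top"
    using G1[of t] by simp
  show ?thesis
  proof (rule tendsto_sandwich[OF _ _ tendsto_const lim])
    show "\<forall>\<^sub>F x in at_top. 1 \<le> (1 - ?G (x - t)) / (1 - ?G x)"
      using t G1 by (intro always_eventually allI) (simp add: le_divide_eq cdf_nondecreasing)
    have "\<forall>\<^sub>F x in at_top. ?G t < ?G x" using tG G1[of t] by (rule order_tendstoD(1))
    with eventually_ge_at_top[of t]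
    show "\<forall>\<^sub>F x in at_top. (1 - ?G (x - t)) / (1 - ?G x) \<le> (?J x / (1 - ?G x) - 1 - ?G t) / (?G x - ?G t)"
    proof eventually_elim
      case (elim x)
      have "(1 - ?G (x - t)) * (?G x - ?G t) \<le> ?J x - (1 - ?G x) - ?G t * (1 - ?G x)"
        using lower[OF elim(1)] by (simp add: algebra_simps)
      then have "(1 - ?G (x - t)) * (?G x - ?G t) / (1 - ?G x)
          \<le> (?J x - (1 - ?G x) - ?G t * (1 - ?G x)) / (1 - ?G x)"
        using G1[of x] by (intro divide_right_mono) auto
      also have "\<dots> = ?J x / (1 - ?G x) - 1 - ?G t" using G1[of x] by (simp add: diff_divide_distrib)
      finally show ?case using elim by (simp add: pos_le_divide_eq)
    qed
  qed
qed

text \<open>If \<open>Fb\<close> is the tail of an integer variable \<open>\<eta> \<ge> 1\<close>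
  and \<open>s\<close> is independent with law \<open>M\<close>, both sides are the probability of
  \<open>\<eta> + s / a > k\<close>: the left side conditions on \<open>\<eta>\<close>, the right
  side on \<open>s\<close>. For fixed \<open>s\<close> the indicators select the indices from
  \<open>\<lfloor>k - s / a\<rfloor>\<close> on and the sum telescopes; for \<open>s > a * k\<close>
  the cast \<open>nat\<close> returns \<open>Fb 0\<close>.\<close>

lemma (in real_distribution) lattice_convolution_eq_integral:
  fixes Fb :: "nat \<Rightarrow> real"
  assumes a: "0 < a" and Fb0: "\<And>k. 0 \<le> Fb k" and Fb1: "\<And>k. Fb k \<le> 1" and pos: "cdf M 0 = 0"
  shows "(\<Sum>n<k. (Fb n - Fb (Suc n)) * (1 - cdf M (a * real (k - Suc n)))) + Fb k
       = (\<integral>s. Fb (nat \<lfloor>real k - s / a\<rfloor>) \<partial>M)"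
proof -
  have int: "integrable M (\<lambda>s. indicator {c<..} s * d)" for c d :: real
    by (simp add: finite_measure.emeasure_finite less_top[symmetric])
  have "(\<Sum>n<k. (Fb n - Fb (Suc n)) * (1 - cdf M (a * real (k - Suc n)))) + Fb k
      = (\<Sum>n<k. \<integral>s. indicator {a * real (k - Suc n)<..} s * (Fb n - Fb (Suc n)) \<partial>M) + (\<integral>s. Fb k \<partial>M)"
    using prob_space by (simp add: tail_eq_measure mult.commute)
  also have "\<dots> = (\<integral>s. (\<Sum>n<k. indicator {a * real (k - Suc n)<..} s * (Fb n - Fb (Suc n))) + Fb k \<partial>M)"
  proof -
    have "(\<integral>s. (\<Sum>n<k. indicator {a * real (k - Suc n)<..} s * (Fb n - Fb (Suc n))) + Fb k \<partial>M)
      = (\<integral>s. (\<Sum>n<k. indicator {a * real (k - Suc n)<..} s * (Fb n - Fb (Suc n))) \<partial>M) + (\<integral>s. Fb k \<partial>M)"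
      by (rule Bochner_Integration.integral_add)
         (rule Bochner_Integration.integrable_sum int integrable_const)+
    then show ?thesis by (simp only: Bochner_Integration.integral_sum[OF int])
  qed
  also have "\<dots> = (\<integral>s. Fb (nat \<lfloor>real k - s / a\<rfloor>) \<partial>M)"
  proof (rule integral_cong_AE)
    have "AE y in M. 0 < y" using pos by (rule AE_pos)
    then show "AE s in M. (\<Sum>n<k. indicator {a * real (k - Suc n)<..} s * (Fb n - Fb (Suc n))) + Fb k
        = Fb (nat \<lfloor>real k - s / a\<rfloor>)"
    proof eventually_elim
      case (elim s)
      define v where "v = real k - s / a"
      have le: "nat \<lfloor>v\<rfloor> \<le> k" using elim a unfolding v_def by (simp add: floor_le_iff nat_le_iff)
        (smt (verit, best) divide_pos_pos of_nat_0_le_iff)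
      have "(\<Sum>n<k. indicator {a * real (k - Suc n)<..} s * (Fb n - Fb (Suc n)))
          = (\<Sum>n\<in>{nat \<lfloor>v\<rfloor>..<k}. Fb n - Fb (Suc n))"
      proof (rule sum.mono_neutral_cong_right)
        have *: "a * real (k - Suc n) < s \<longleftrightarrow> nat \<lfloor>v\<rfloor> \<le> n" if "n < k" for n
        proof -
          have "a * real (k - Suc n) < s \<longleftrightarrow> v < real (Suc n)"
            using that a by (simp add: v_def of_nat_diff field_simps)
          also have "\<dots> \<longleftrightarrow> \<lfloor>v\<rfloor> < int (Suc n)" by (simp add: floor_less_iff)
          finally show ?thesis by linarith
        qed
        then show "\<forall>n\<in>{..<k} - {nat \<lfloor>v\<rfloor>..<k}. indicator {a * real (k - Suc n)<..} s * (Fb n - Fb (Suc n)) = 0"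
          and "\<And>n. n \<in> {nat \<lfloor>v\<rfloor>..<k} \<Longrightarrow>
             indicator {a * real (k - Suc n)<..} s * (Fb n - Fb (Suc n)) = Fb n - Fb (Suc n)"
          by (auto simp: indicator_def)
      qed auto
      also have "\<dots> = Fb (nat \<lfloor>v\<rfloor>) - Fb k"
        using sum_Suc_diff'[OF le, of "\<lambda>n. - Fb n"] by simp
      finally show ?case by (simp add: v_def)
    qed
    show "(\<lambda>s. (\<Sum>n<k. indicator {a * real (k - Suc n)<..} s * (Fb n - Fb (Suc n))) + Fb k)
        \<in> borel_measurable M"
      by (rule borel_measurable_add borel_measurable_sum borel_measurable_times
          borel_measurable_indicator borel_measurable_const | simp del: of_nat_Suc)+
  qed auto
  finally show ?thesis .
qed

text \<open>Beyond \<open>v0\<close> the tail \<open>Fb\<close> is at most \<open>c + d\<close>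
  times the tail of \<open>G\<close>, so the integral form is compared with the self-convolution of
  \<open>G\<close>. Relative to the tail of \<open>G\<close> the bound tends to
  \<open>(c + d) * (2 - 1) + 1 - c = 1 + d\<close>: the subtracted \<open>c\<close> is the summand
  \<open>Fb k\<close>, the subtracted 1 the range where the service alone exceeds
  \<open>a * k\<close>.\<close>

lemma (in real_distribution) lattice_convolution_tail:
  fixes Fb :: "nat \<Rightarrow> real"
  assumes sub: "subexponential (cdf M)" and pos: "cdf M 0 = 0" and a: "0 < a"
    and Fb0: "\<And>k. 0 \<le> Fb k" and Fb1: "\<And>k. Fb k \<le> 1"
    and lim: "((\<lambda>u. Fb (nat \<lfloor>u\<rfloor>) / (1 - cdf M (u * a))) \<longlongrightarrow> c) at_top"
    and e: "0 < e"
  shows "\<forall>\<^sub>F k in sequentially.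
     (\<Sum>n<k. (Fb n - Fb (Suc n)) * (1 - cdf M (a * real (k - Suc n)))) \<le> (1 + e) * (1 - cdf M (a * real k))"
proof -
  let ?G = "cdf M" and ?J = "\<lambda>x. \<integral>y. 1 - cdf M (x - y) \<partial>M"
  have G1: "?G x < 1" for x using sub by (simp add: subexponential_def)
  define d where "d = e / 2"
  have d: "0 < d" using e by (simp add: d_def)
  have "\<forall>\<^sub>F u in at_top. Fb (nat \<lfloor>u\<rfloor>) / (1 - ?G (u * a)) < c + d"
    using lim d by (intro order_tendstoD) auto
  then obtain v1 where v1: "\<And>u. v1 \<le> u \<Longrightarrow> Fb (nat \<lfloor>u\<rfloor>) / (1 - ?G (u * a)) < c + d"
    unfolding eventually_at_top_linorder by blast
  define v0 where "v0 = max v1 0"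
  have v0: "Fb (nat \<lfloor>u\<rfloor>) \<le> (c + d) * (1 - ?G (u * a))" if "v0 \<le> u" for u
    using v1[of u] that G1[of "u * a"] by (simp add: v0_def pos_divide_less_eq)
  \<comment> \<open>Wide enough for the window of \<open>s\<close> just below \<open>a * k\<close>
    in which only \<open>Fb \<le> 1\<close> is used; the added 1 leaves slack at its end.\<close>
  define t where "t = a * v0 + 1"
  have t: "0 \<le> t" using a by (simp add: t_def v0_def)
  have bound: "(\<integral>s. Fb (nat \<lfloor>real k - s / a\<rfloor>) \<partial>M)
      \<le> (c + d) * (?J (a * real k) - (1 - ?G (a * real k))) + (1 - ?G (a * real k - t))" for k
  proof -
    let ?x = "a * real k"
    have int: "integrable M (\<lambda>s. indicator A s :: real)" if "A \<in> sets borel" for A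
      using that by (simp add: finite_measure.emeasure_finite less_top[symmetric])
    have "(\<integral>s. Fb (nat \<lfloor>real k - s / a\<rfloor>) \<partial>M)
        \<le> (\<integral>s. (c + d) * ((1 - ?G (?x - s)) - indicator {?x<..} s) + indicator {?x - t<..} s \<partial>M)"
    proof (rule integral_mono_AE)
      show "integrable M (\<lambda>s. Fb (nat \<lfloor>real k - s / a\<rfloor>))"
        using Fb0 Fb1 by (intro integrable_const_bound[where B = 1]) auto
      show "integrable M (\<lambda>s. (c + d) * ((1 - ?G (?x - s)) - indicator {?x<..} s) + indicator {?x - t<..} s)"
        by (intro Bochner_Integration.integrable_add Bochner_Integration.integrable_diff
            integrable_mult_right int integrable_bounded_tail) auto
      show "AE s in M. Fb (nat \<lfloor>real k - s / a\<rfloor>)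
          \<le> (c + d) * ((1 - ?G (?x - s)) - indicator {?x<..} s) + indicator {?x - t<..} s"
      proof (rule AE_I2)
        fix s
        define v where "v = real k - s / a"
        have va: "v * a = ?x - s" using a by (simp add: v_def field_simps)
        \<comment> \<open>For \<open>v < 0\<close> the service alone exceeds \<open>a * k\<close>;
          there \<open>G (a * k - s)\<close> vanishes, so the subtracted indicator cancels the first
          summand and the second one supplies the bound 1.\<close>
        consider "v0 \<le> v" | "0 \<le> v" "v < v0" | "v < 0" by linarith
        then show "Fb (nat \<lfloor>real k - s / a\<rfloor>)
          \<le> (c + d) * ((1 - ?G (?x - s)) - indicator {?x<..} s) + indicator {?x - t<..} s"
        proof cases
          case 1
          then have "0 \<le> v" by (simp add: v0_def)
          then have "0 \<le> v * a" using a by simp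
          then have "s \<le> ?x" by (simp add: va)
          then show ?thesis using v0[OF 1] unfolding va unfolding v_def
            by (auto simp: indicator_def)
        next
          case 2
          then have "0 \<le> v * a" "v * a \<le> v0 * a" using a by simp_all
          then have s: "s \<le> ?x" "?x - t < s" unfolding va by (auto simp: t_def algebra_simps)
          have "(c + d) * (1 - ?G (?x - s)) \<ge> 0"
          proof -
            have "0 \<le> (c + d) * (1 - ?G (v0 * a))" using v0[of v0] Fb0[of "nat \<lfloor>v0\<rfloor>"] by simp
            then have "0 \<le> c + d" using G1[of "v0 * a"] by (simp add: zero_le_mult_iff)
            then show ?thesis using G1[of "?x - s"] by simp
          qed
          then show ?thesis using s Fb1[of "nat \<lfloor>real k - s / a\<rfloor>"] by (simp add: indicator_def)
        next
          case 3
          then have "v * a < 0" using a by (simp add: mult_neg_pos)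
          then have s: "?x < s" unfolding va by simp
          then have "?G (?x - s) = 0"
            using pos cdf_nondecreasing[of "?x - s" 0] cdf_nonneg[of "?x - s"] by simp
          then show ?thesis using s t Fb1[of "nat \<lfloor>real k - s / a\<rfloor>"] by (simp add: indicator_def)
        qed
      qed
    qed
    also have "\<dots> = (c + d) * (?J ?x - (1 - ?G ?x)) + (1 - ?G (?x - t))"
    proof -
      have i: "integrable M (\<lambda>s. (1 - ?G (?x - s)) - indicator {?x<..} s)"
        by (intro Bochner_Integration.integrable_diff int integrable_bounded_tail) auto
      have ind: "(\<integral>s. indicator {y<..} s \<partial>M) = 1 - ?G y" for y
        using tail_eq_measure[of y] by simp
      have grt: "{y<..} \<in> sets borel" for y :: real by simp
      show ?thesis
        unfolding Bochner_Integration.integral_add[OF integrable_mult_right[OF i] int[OF grt]]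
          integral_mult_right_zero
          Bochner_Integration.integral_diff[OF integrable_bounded_tail int[OF grt]] ind ..
    qed
    finally show ?thesis .
  qed
  have scale: "filterlim (\<lambda>k. a * real k) at_top sequentially"
    using a by (intro filterlim_tendsto_pos_mult_at_top[OF tendsto_const] filterlim_real_sequentially)
  have l1: "(\<lambda>k. Fb k / (1 - ?G (a * real k))) \<longlonglongrightarrow> c"
    using filterlim_compose[OF lim filterlim_real_sequentially] by (simp add: mult.commute)
  have l2: "(\<lambda>k. ?J (a * real k) / (1 - ?G (a * real k))) \<longlonglongrightarrow> 2"
    by (rule filterlim_compose[OF subexponential_convolution_tail[OF sub] scale])
  have l3: "(\<lambda>k. (1 - ?G (a * real k - t)) / (1 - ?G (a * real k))) \<longlonglongrightarrow> 1"
    by (rule filterlim_compose[OF subexponential_long_tailed[OF sub pos t] scale])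
  have "(\<lambda>k. (c + d) * (?J (a * real k) / (1 - ?G (a * real k)) - 1)
      + (1 - ?G (a * real k - t)) / (1 - ?G (a * real k)) - Fb k / (1 - ?G (a * real k)))
      \<longlonglongrightarrow> (c + d) * (2 - 1) + 1 - c"
    by (intro tendsto_intros l1 l2 l3)
  then have "\<forall>\<^sub>F k in sequentially. (c + d) * (?J (a * real k) / (1 - ?G (a * real k)) - 1)
      + (1 - ?G (a * real k - t)) / (1 - ?G (a * real k)) - Fb k / (1 - ?G (a * real k)) < 1 + e"
    using d by (intro order_tendstoD(2)) (auto simp: d_def)
  then show ?thesis
  proof eventually_elim
    case (elim k)
    let ?h = "1 - ?G (a * real k)"
    have h: "0 < ?h" using G1 by simp
    have "((c + d) * (J / h - 1) + A / h - F / h) * h = (c + d) * (J - h) + A - F"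
      if "0 < h" for h J A F :: real using that by (simp add: field_simps)
    from this[OF h] have "((c + d) * (?J (a * real k) / ?h - 1) + (1 - ?G (a * real k - t)) / ?h - Fb k / ?h) * ?h
        = (c + d) * (?J (a * real k) - ?h) + (1 - ?G (a * real k - t)) - Fb k" .
    moreover have "((c + d) * (?J (a * real k) / ?h - 1) + (1 - ?G (a * real k - t)) / ?h - Fb k / ?h) * ?h
        \<le> (1 + e) * ?h"
      using elim h by (intro mult_right_mono) auto
    ultimately have "(c + d) * (?J (a * real k) - ?h) + (1 - ?G (a * real k - t)) - Fb k \<le> (1 + e) * ?h"
      by linarith
    then show ?case
      using bound[of k] lattice_convolution_eq_integral[where Fb = Fb and k = k, OF a Fb0 Fb1 pos] by linarith
  qed
qed

section \<open>The M/G/1 queue fed by independent gaps\<close>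

text \<open>A queue holds work \<open>c\<close>; customers then arrive with gaps \<open>xs\<close> and bring service times \<open>ss\<close>.
  None of the first \<open>k\<close> arrivals ends an idle period of length at least \<open>\<kappa>\<close>.  For \<open>\<kappa> = 0\<close> this
  says that these customers all belong to the initial busy period.\<close>

fun surv :: "real \<Rightarrow> nat \<Rightarrow> real \<Rightarrow> real stream \<Rightarrow> real stream \<Rightarrow> bool" where
  "surv \<kappa> 0 c xs ss \<longleftrightarrow> True"
| "surv \<kappa> (Suc k) c xs ss \<longleftrightarrow>
     shd xs < c + \<kappa> \<and> surv \<kappa> k (max 0 (c - shd xs) + shd ss) (stl xs) (stl ss)"

lemma measurable_surv [measurable (raw)]:
  assumes [measurable]: "f \<in> borel_measurable N" "g \<in> measurable N (stream_space borel)"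
    "h \<in> measurable N (stream_space borel)"
  shows "Measurable.pred N (\<lambda>w. surv \<kappa> k (f w) (g w) (h w))"
  using assms
proof (induction k arbitrary: f g h)
  case (Suc k)
  note Suc.prems [measurable]
  have [measurable]: "Measurable.pred N (\<lambda>w. surv \<kappa> k (max 0 (f w - shd (g w)) + shd (h w)) (stl (g w)) (stl (h w)))"
    by (rule Suc.IH) measurable
  show ?case by simp
qed simp

section \<open>The exponential law of the gaps\<close>

abbreviation expo :: "real \<Rightarrow> real measure" where
  "expo l \<equiv> density lborel (\<lambda>x. ennreal (exponential_density l x))"

lemma expo_greaterThan:
  assumes "0 < l" "0 \<le> a"
  shows "emeasure (expo l) {a<..} = ennreal (exp (- l * a))"
proof -
  interpret prob_space "expo l" using assms by (intro prob_space_exponential_density)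
  have "distributed (expo l) lborel (\<lambda>x. x) (exponential_density l)"
    by (auto simp: distributed_def distr_id2)
  then have "prob {x \<in> space (expo l). a < x} = exp (- a * l)"
    by (rule exponential_distributedD_gt) (use assms in auto)
  moreover have "{x \<in> space (expo l). a < x} = {a<..}" by auto
  ultimately show ?thesis by (simp add: emeasure_eq_measure mult.commute)
qed

lemma expo_atLeast:
  assumes "0 < l" "0 \<le> a"
  shows "emeasure (expo l) {a..} = ennreal (exp (- l * a))"
proof -
  have "emeasure (expo l) {a..} = emeasure (expo l) {a<..}"
  proof (rule emeasure_eq_AE)
    have "AE x in lborel. 0 < ennreal (exponential_density l x) \<longrightarrow> x \<in> {a..} \<longleftrightarrow> x \<in> {a<..}"
      using AE_lborel_singleton[of a] by eventually_elim auto
    then show "AE x in expo l. x \<in> {a..} \<longleftrightarrow> x \<in> {a<..}"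
      by (subst AE_density) auto
  qed auto
  then show ?thesis using expo_greaterThan[OF assms] by simp
qed

text \<open>Lack of memory: given that the gap outlasts the work \<open>c\<close>, the excess is
  below \<open>\<kappa>\<close> with a probability free of \<open>c\<close>. This is the source of
  the factor \<open>q\<close>.\<close>

lemma expo_atLeastLessThan:
  assumes "0 < l" "0 \<le> c" "0 \<le> \<kappa>"
  shows "emeasure (expo l) {c..<c + \<kappa>} = emeasure (expo l) {c..} * ennreal (1 - exp (- l * \<kappa>))"
proof -
  interpret prob_space "expo l" using assms by (intro prob_space_exponential_density)
  have "{c..<c + \<kappa>} = {c..} - {c + \<kappa>..}" using assms by auto
  then have "emeasure (expo l) {c..<c + \<kappa>} = emeasure (expo l) {c..} - emeasure (expo l) {c + \<kappa>..}"
    using assms by (simp add: emeasure_Diff)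
  also have "\<dots> = ennreal (exp (- l * c) - exp (- l * (c + \<kappa>)))"
    using assms by (simp only: expo_atLeast add_nonneg_nonneg) (simp add: ennreal_minus)
  also have "exp (- l * c) - exp (- l * (c + \<kappa>)) = exp (- l * c) * (1 - exp (- l * \<kappa>))"
    by (simp add: distrib_left exp_add[symmetric] right_diff_distrib)
  finally show ?thesis using assms by (simp add: expo_atLeast ennreal_mult')
qed

lemma AE_expo_nonneg: "AE x in expo l. 0 \<le> x"
  by (simp add: AE_density exponential_density_def)

section \<open>Survival probabilities and the renewal equation\<close>

locale mg_walk =
  fixes l :: real and D :: "real measure"
  assumes l_pos: "0 < l"
    and prob_D: "prob_space D"
    and sets_D [measurable_cong, simp]: "sets D = sets borel"
    and D_pos: "AE s in D. 0 < s"
begin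

sublocale X: prob_space "expo l" by (rule prob_space_exponential_density) (rule l_pos)
sublocale D: prob_space D by (rule prob_D)
sublocale SX: prob_space "stream_space (expo l)" by (rule X.prob_space_stream_space)
sublocale SD: prob_space "stream_space D" by (rule D.prob_space_stream_space)
sublocale XD: pair_sigma_finite "stream_space (expo l)" D ..
sublocale SXD: pair_prob_space "stream_space (expo l)" "stream_space D" ..

lemma space_D [simp]: "space D = UNIV"
  using sets_eq_imp_space_eq[OF sets_D] by simp

text \<open>The one-step recursion for the probability of \<open>surv\<close>, as a function of the
  initial work because the renewal decomposition is an induction over \<open>k\<close> for all
  \<open>c\<close> at once.\<close>

primrec psurv :: "real \<Rightarrow> nat \<Rightarrow> real \<Rightarrow> ennreal" where
  "psurv \<kappa> 0 = (\<lambda>c. 1)"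
| "psurv \<kappa> (Suc k) = (\<lambda>c. \<integral>\<^sup>+x. \<integral>\<^sup>+s. of_bool (x < c + \<kappa>) * psurv \<kappa> k (max 0 (c - x) + s) \<partial>D \<partial>expo l)"

text \<open>\<open>pend n c\<close> is the probability that the initial work \<open>c\<close> and the services of exactly \<open>n\<close> arriving
  customers make up the first busy period.\<close>

primrec pend :: "nat \<Rightarrow> real \<Rightarrow> ennreal" where
  "pend 0 = (\<lambda>c. emeasure (expo l) {c..})"
| "pend (Suc n) = (\<lambda>c. \<integral>\<^sup>+x. \<integral>\<^sup>+s. of_bool (x < c) * pend n (c - x + s) \<partial>D \<partial>expo l)"

lemma psurv_measurable [measurable]: "psurv \<kappa> k \<in> borel_measurable borel"
proof (induction k)
  case (Suc k)
  note [measurable] = Suc.IH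
  show ?case unfolding psurv.simps by measurable
qed simp

lemma pend_measurable [measurable]: "pend n \<in> borel_measurable borel"
proof (induction n)
  case 0
  have "emeasure (expo l) {c..} = (\<integral>\<^sup>+x. of_bool (c \<le> x) \<partial>expo l)" for c
    using nn_integral_indicator[of "{c..}" "expo l"] by (simp add: indicator_def)
  then show ?case by simp
qed simp

lemma stream_space_expo [measurable_cong]: "sets (stream_space (expo l)) = sets (stream_space borel)"
  and stream_space_D [measurable_cong]: "sets (stream_space D) = sets (stream_space borel)"
  by (auto intro!: sets_stream_space_cong)

text \<open>Peeling the heads off both streams performs one step of the queue; Fubini moves the
  first service outside the remaining gaps, so that the induction hypothesis applies to the updated
  work.\<close>

lemma nn_integral_surv:
  "(\<integral>\<^sup>+xs. \<integral>\<^sup>+ss. (if surv \<kappa> k c xs ss then 1 else 0) \<partial>stream_space D \<partial>stream_space (expo l)) = psurv \<kappa> k c"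
proof (induction k arbitrary: c)
  case 0
  then show ?case using SX.emeasure_space_1 SD.emeasure_space_1 by simp
next
  case (Suc k)
  let ?I = "\<lambda>x. of_bool (x < c + \<kappa>) :: ennreal"
  let ?F = "\<lambda>x s xs ss. if surv \<kappa> k (max 0 (c - x) + s) xs ss then 1 else 0 :: ennreal"
  have "(\<integral>\<^sup>+xs. \<integral>\<^sup>+ss. (if surv \<kappa> (Suc k) c xs ss then 1 else 0) \<partial>stream_space D \<partial>stream_space (expo l))
    = (\<integral>\<^sup>+x. \<integral>\<^sup>+xs. \<integral>\<^sup>+ss. (if surv \<kappa> (Suc k) c (x ## xs) ss then 1 else 0)
         \<partial>stream_space D \<partial>stream_space (expo l) \<partial>expo l)"
    by (rule X.nn_integral_stream_space) measurable
  also have "\<dots> = (\<integral>\<^sup>+x. \<integral>\<^sup>+xs. \<integral>\<^sup>+s. \<integral>\<^sup>+ss. ?I x * ?F x s xs ss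
         \<partial>stream_space D \<partial>D \<partial>stream_space (expo l) \<partial>expo l)"
  proof (intro nn_integral_cong)
    fix x xs
    have [measurable]: "Measurable.pred (stream_space D) (\<lambda>ss. surv \<kappa> (Suc k) c (x ## xs) ss)"
      by (rule measurable_surv) (simp_all add: measurable_const space_stream_space)
    have "(\<integral>\<^sup>+ss. (if surv \<kappa> (Suc k) c (x ## xs) ss then 1 else 0) \<partial>stream_space D)
      = (\<integral>\<^sup>+s. \<integral>\<^sup>+ss. (if surv \<kappa> (Suc k) c (x ## xs) (s ## ss) then 1 else 0) \<partial>stream_space D \<partial>D)"
      by (rule D.nn_integral_stream_space) (simp del: surv.simps)
    also have "\<dots> = (\<integral>\<^sup>+s. \<integral>\<^sup>+ss. ?I x * ?F x s xs ss \<partial>stream_space D \<partial>D)"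
      by (intro nn_integral_cong) (simp add: of_bool_def)
    finally show "(\<integral>\<^sup>+ss. (if surv \<kappa> (Suc k) c (x ## xs) ss then 1 else 0) \<partial>stream_space D)
      = (\<integral>\<^sup>+s. \<integral>\<^sup>+ss. ?I x * ?F x s xs ss \<partial>stream_space D \<partial>D)" .
  qed
  also have "\<dots> = (\<integral>\<^sup>+x. \<integral>\<^sup>+s. \<integral>\<^sup>+xs. \<integral>\<^sup>+ss. ?I x * ?F x s xs ss
         \<partial>stream_space D \<partial>stream_space (expo l) \<partial>D \<partial>expo l)"
  proof (rule nn_integral_cong)
    fix x
    have [measurable]: "Measurable.pred ((stream_space (expo l) \<Otimes>\<^sub>M D) \<Otimes>\<^sub>M stream_space D)
        (\<lambda>((xs, s), ss). surv \<kappa> k (max 0 (c - x) + s) xs ss)"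
      unfolding split_beta' by (rule measurable_surv) measurable
    show "(\<integral>\<^sup>+xs. \<integral>\<^sup>+s. \<integral>\<^sup>+ss. ?I x * ?F x s xs ss \<partial>stream_space D \<partial>D \<partial>stream_space (expo l))
      = (\<integral>\<^sup>+s. \<integral>\<^sup>+xs. \<integral>\<^sup>+ss. ?I x * ?F x s xs ss \<partial>stream_space D \<partial>stream_space (expo l) \<partial>D)"
      by (rule XD.Fubini'[symmetric]) measurable
  qed
  also have "\<dots> = (\<integral>\<^sup>+x. \<integral>\<^sup>+s. ?I x * (\<integral>\<^sup>+xs. \<integral>\<^sup>+ss. ?F x s xs ss
         \<partial>stream_space D \<partial>stream_space (expo l)) \<partial>D \<partial>expo l)"
    by (intro nn_integral_cong) (simp add: of_bool_def)
  also have "\<dots> = psurv \<kappa> (Suc k) c" by (simp add: Suc.IH)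
  finally show ?case .
qed

lemma emeasure_surv:
  "emeasure (stream_space (expo l) \<Otimes>\<^sub>M stream_space D)
     {w \<in> space (stream_space (expo l) \<Otimes>\<^sub>M stream_space D). surv \<kappa> k c (fst w) (snd w)} = psurv \<kappa> k c"
proof -
  have "emeasure (stream_space (expo l) \<Otimes>\<^sub>M stream_space D)
     {w \<in> space (stream_space (expo l) \<Otimes>\<^sub>M stream_space D). surv \<kappa> k c (fst w) (snd w)}
    = (\<integral>\<^sup>+w. (if surv \<kappa> k c (fst w) (snd w) then 1 else 0) \<partial>(stream_space (expo l) \<Otimes>\<^sub>M stream_space D))"
    (is "emeasure ?P ?S = _")
  proof -
    have "(\<integral>\<^sup>+w. (if surv \<kappa> k c (fst w) (snd w) then 1 else 0) \<partial>?P) = (\<integral>\<^sup>+w. indicator ?S w \<partial>?P)"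
      by (auto intro!: nn_integral_cong simp: indicator_def)
    also have "\<dots> = emeasure ?P ?S" by (rule nn_integral_indicator) measurable
    finally show ?thesis by (rule sym)
  qed
  also have "\<dots> = (\<integral>\<^sup>+xs. \<integral>\<^sup>+ss. (if surv \<kappa> k c xs ss then 1 else 0) \<partial>stream_space D \<partial>stream_space (expo l))"
    by (subst SD.nn_integral_fst[symmetric]) simp_all
  finally show ?thesis by (simp only: nn_integral_surv)
qed

text \<open>The form for the busy period of an actual queue: customer 0 supplies the initial work by
  his own service, and the first gap, the time until he arrives, is integrated out.\<close>

lemma emeasure_surv_shd:
  "emeasure (stream_space (expo l) \<Otimes>\<^sub>M stream_space D)
     {w \<in> space (stream_space (expo l) \<Otimes>\<^sub>M stream_space D). surv \<kappa> k (shd (snd w)) (stl (fst w)) (stl (snd w))}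
   = (\<integral>\<^sup>+s. psurv \<kappa> k s \<partial>D)"
   (is "emeasure ?P ?S = _")
proof -
  have "(\<integral>\<^sup>+w. (if surv \<kappa> k (shd (snd w)) (stl (fst w)) (stl (snd w)) then 1 else 0) \<partial>?P) = (\<integral>\<^sup>+w. indicator ?S w \<partial>?P)"
    by (auto intro!: nn_integral_cong simp: indicator_def)
  also have "\<dots> = emeasure ?P ?S" by (rule nn_integral_indicator) measurable
  finally have "emeasure ?P ?S = (\<integral>\<^sup>+w. (if surv \<kappa> k (shd (snd w)) (stl (fst w)) (stl (snd w)) then 1 else 0) \<partial>?P)"
    by (rule sym)
  also have "\<dots> = (\<integral>\<^sup>+xs. \<integral>\<^sup>+ss. (if surv \<kappa> k (shd ss) (stl xs) (stl ss) then 1 else 0) \<partial>stream_space D \<partial>stream_space (expo l))"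
    by (subst SD.nn_integral_fst[symmetric]) simp_all
  also have "\<dots> = (\<integral>\<^sup>+x. \<integral>\<^sup>+xs. \<integral>\<^sup>+ss. (if surv \<kappa> k (shd ss) (stl (x ## xs)) (stl ss) then 1 else 0) \<partial>stream_space D \<partial>stream_space (expo l) \<partial>expo l)"
    by (rule X.nn_integral_stream_space) measurable
  also have "\<dots> = (\<integral>\<^sup>+xs. \<integral>\<^sup>+ss. (if surv \<kappa> k (shd ss) xs (stl ss) then 1 else 0) \<partial>stream_space D \<partial>stream_space (expo l))"
    using X.emeasure_space_1 by simp
  also have "\<dots> = (\<integral>\<^sup>+xs. \<integral>\<^sup>+s. \<integral>\<^sup>+ss. (if surv \<kappa> k s xs ss then 1 else 0) \<partial>stream_space D \<partial>D \<partial>stream_space (expo l))"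
  proof (rule nn_integral_cong)
    fix xs
    have [measurable]: "Measurable.pred (stream_space D) (\<lambda>ss. surv \<kappa> k (shd ss) xs (stl ss))"
      by (rule measurable_surv) (simp_all add: measurable_const space_stream_space)
    have "(\<integral>\<^sup>+ss. (if surv \<kappa> k (shd ss) xs (stl ss) then 1 else 0) \<partial>stream_space D)
      = (\<integral>\<^sup>+s. \<integral>\<^sup>+ss. (if surv \<kappa> k (shd (s ## ss)) xs (stl (s ## ss)) then 1 else 0) \<partial>stream_space D \<partial>D)"
      by (rule D.nn_integral_stream_space) simp
    then show "(\<integral>\<^sup>+ss. (if surv \<kappa> k (shd ss) xs (stl ss) then 1 else 0) \<partial>stream_space D)
      = (\<integral>\<^sup>+s. \<integral>\<^sup>+ss. (if surv \<kappa> k s xs ss then 1 else 0) \<partial>stream_space D \<partial>D)" by simp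
  qed
  also have "\<dots> = (\<integral>\<^sup>+s. \<integral>\<^sup>+xs. \<integral>\<^sup>+ss. (if surv \<kappa> k s xs ss then 1 else 0) \<partial>stream_space D \<partial>stream_space (expo l) \<partial>D)"
  proof -
    have [measurable]: "Measurable.pred ((stream_space (expo l) \<Otimes>\<^sub>M D) \<Otimes>\<^sub>M stream_space D)
        (\<lambda>((xs, s), ss). surv \<kappa> k s xs ss)"
      unfolding split_beta' by (rule measurable_surv) measurable
    show ?thesis by (rule XD.Fubini'[symmetric]) measurable
  qed
  finally show ?thesis by (simp only: nn_integral_surv)
qed

lemma psurv_le_1: "psurv \<kappa> k c \<le> 1"
  unfolding emeasure_surv[symmetric] by (rule SXD.emeasure_le_1)

text \<open>If the first \<open>n\<close> arrivals find the server busy, the next one either comes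
  too late, which ends the busy period, or does not. So \<open>pend n\<close> is a decrement of
  \<open>psurv 0\<close>, and integrating over the first service gives the point masses of
  \<open>\<eta>\<close>.\<close>

lemma pend_psurv: "pend n c + psurv 0 (Suc n) c = psurv 0 n c"
proof (induction n arbitrary: c)
  case 0
  have "emeasure (expo l) {c..} + emeasure (expo l) {..<c} = emeasure (expo l) ({c..} \<union> {..<c})"
    by (rule plus_emeasure) auto
  also have "{c..} \<union> {..<c} = space (expo l)" by auto
  moreover have "(\<integral>\<^sup>+x. of_bool (x < c) \<partial>expo l) = emeasure (expo l) {..<c}"
    using nn_integral_indicator[of "{..<c}" "expo l"] by (simp add: indicator_def)
  ultimately show ?case using X.emeasure_space_1 D.emeasure_space_1 by simp
next
  case (Suc n)
  have "pend (Suc n) c + psurv 0 (Suc (Suc n)) c =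
     (\<integral>\<^sup>+x. \<integral>\<^sup>+s. of_bool (x < c) * pend n (c - x + s) \<partial>D \<partial>expo l)
     + (\<integral>\<^sup>+x. \<integral>\<^sup>+s. of_bool (x < c) * psurv 0 (Suc n) (c - x + s) \<partial>D \<partial>expo l)"
    unfolding pend.simps(2) psurv.simps(2)[of 0 "Suc n"]
    by (intro arg_cong2[where f = "(+)"] nn_integral_cong refl) (auto simp: indicator_def of_bool_def max_def)
  also have "\<dots> = (\<integral>\<^sup>+x. \<integral>\<^sup>+s. of_bool (x < c) * (pend n (c - x + s) + psurv 0 (Suc n) (c - x + s)) \<partial>D \<partial>expo l)"
    by (simp add: nn_integral_add distrib_left del: psurv.simps(2))
  also have "\<dots> = psurv 0 (Suc n) c"
    unfolding Suc.IH by (auto intro!: nn_integral_cong simp: indicator_def of_bool_def max_def)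
  finally show ?case .
qed

text \<open>From an empty system the first gap is pure idle time, which gives the factor
  \<open>q\<close>; the customer who ends it starts a busy period with his own service.\<close>

lemma psurv_Suc_0:
  assumes "0 \<le> \<kappa>"
  shows "psurv \<kappa> (Suc k) 0 = ennreal (1 - exp (- l * \<kappa>)) * (\<integral>\<^sup>+s. psurv \<kappa> k s \<partial>D)"
proof -
  have "psurv \<kappa> (Suc k) 0 = (\<integral>\<^sup>+x. indicator {0..<\<kappa>} x * (\<integral>\<^sup>+s. psurv \<kappa> k s \<partial>D) \<partial>expo l)"
    unfolding psurv.simps
    by (rule nn_integral_cong_AE, rule AE_mp[OF AE_expo_nonneg], rule AE_I2)
       (auto simp: indicator_def of_bool_def)
  also have "\<dots> = emeasure (expo l) {0..<0 + \<kappa>} * (\<integral>\<^sup>+s. psurv \<kappa> k s \<partial>D)"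
    by (simp add: nn_integral_multc)
  finally show ?thesis
    using assms l_pos by (simp only: expo_atLeastLessThan order_refl expo_atLeast) simp
qed

text \<open>By lack of memory, the idle time after the first busy period is again exponential, so the
  process restarts there as from an empty system.\<close>

lemma psurv_decompose:
  assumes \<kappa>: "0 \<le> \<kappa>" and c: "0 \<le> c"
  shows "psurv \<kappa> k c = psurv 0 k c + (\<Sum>n<k. pend n c * psurv \<kappa> (k - n) 0)"
  using c
proof (induction k arbitrary: c)
  case (Suc k)
  let ?Z = "\<integral>\<^sup>+s. psurv \<kappa> k s \<partial>D"
  \<comment> \<open>The first gap ends either before the work \<open>c\<close> is done or in the
    idle time after it; the second part will become the term \<open>n = 0\<close>.\<close>
  have "psurv \<kappa> (Suc k) c = (\<integral>\<^sup>+x. \<integral>\<^sup>+s. of_bool (x < c) * psurv \<kappa> k (c - x + s)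
        + indicator {c..<c + \<kappa>} x * psurv \<kappa> k s \<partial>D \<partial>expo l)"
    unfolding psurv.simps using \<kappa> by (auto intro!: nn_integral_cong simp: indicator_def of_bool_def max_def)
  also have "\<dots> = (\<integral>\<^sup>+x. \<integral>\<^sup>+s. of_bool (x < c) * psurv \<kappa> k (c - x + s) \<partial>D \<partial>expo l)
       + emeasure (expo l) {c..<c + \<kappa>} * ?Z"
    by (simp add: nn_integral_add nn_integral_cmult nn_integral_multc)
  also have "emeasure (expo l) {c..<c + \<kappa>} * ?Z = pend 0 c * psurv \<kappa> (Suc k) 0"
    using Suc.prems \<kappa> l_pos by (simp only: expo_atLeastLessThan psurv_Suc_0 pend.simps mult.assoc)
  also have "(\<integral>\<^sup>+x. \<integral>\<^sup>+s. of_bool (x < c) * psurv \<kappa> k (c - x + s) \<partial>D \<partial>expo l)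
     = (\<integral>\<^sup>+x. \<integral>\<^sup>+s. of_bool (x < c) * psurv 0 k (c - x + s) +
         (\<Sum>n<k. of_bool (x < c) * pend n (c - x + s) * psurv \<kappa> (k - n) 0) \<partial>D \<partial>expo l)"
  \<comment> \<open>The induction hypothesis needs nonnegative work, which \<open>D_pos\<close>
    provides almost surely.\<close>
  proof (rule nn_integral_cong, rule nn_integral_cong_AE)
    fix x
    show "AE s in D. of_bool (x < c) * psurv \<kappa> k (c - x + s) = of_bool (x < c) * psurv 0 k (c - x + s) +
         (\<Sum>n<k. of_bool (x < c) * pend n (c - x + s) * psurv \<kappa> (k - n) 0)"
      using D_pos
    proof eventually_elim
      case (elim s)
      show ?case
        using Suc.IH[of "c - x + s"] elim by (cases "x < c") simp_all
    qed
  qed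
  also have "\<dots> = (\<integral>\<^sup>+x. \<integral>\<^sup>+s. of_bool (x < c) * psurv 0 k (c - x + s) \<partial>D \<partial>expo l)
     + (\<Sum>n<k. pend (Suc n) c * psurv \<kappa> (k - n) 0)"
    by (simp add: nn_integral_add nn_integral_sum nn_integral_multc)
  also have "(\<integral>\<^sup>+x. \<integral>\<^sup>+s. of_bool (x < c) * psurv 0 k (c - x + s) \<partial>D \<partial>expo l) = psurv 0 (Suc k) c"
    by (auto intro!: nn_integral_cong simp: indicator_def of_bool_def max_def)
  finally show ?case
    unfolding sum.lessThan_Suc_shift diff_Suc_Suc minus_nat.diff_0 by (simp only: ac_simps)
qed simp

text \<open>The probability of \<open>\<eta> > k\<close>: the customer whose service is the initial
  work belongs to the busy period but is not among the \<open>k\<close> arrivals.\<close>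

definition busy_tail :: "nat \<Rightarrow> real" where
  "busy_tail k = enn2real (\<integral>\<^sup>+s. psurv 0 k s \<partial>D)"

text \<open>An empty start has no such first customer, hence \<open>Suc k\<close> arrivals for a
  total that exceeds \<open>k\<close>.\<close>

definition total_tail :: "real \<Rightarrow> nat \<Rightarrow> real" where
  "total_tail \<kappa> k = enn2real (psurv \<kappa> (Suc k) 0)"

lemma integral_psurv_le_1: "(\<integral>\<^sup>+s. psurv \<kappa> k s \<partial>D) \<le> 1"
  using nn_integral_mono[of D "psurv \<kappa> k" "\<lambda>_. 1"] psurv_le_1 D.emeasure_space_1 by simp

lemma ennreal_busy_tail: "ennreal (busy_tail k) = (\<integral>\<^sup>+s. psurv 0 k s \<partial>D)"
  using integral_psurv_le_1[of 0 k] unfolding busy_tail_def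
  by (intro ennreal_enn2real) (auto simp: less_top[symmetric] top_unique)

lemma ennreal_total_tail: "ennreal (total_tail \<kappa> k) = psurv \<kappa> (Suc k) 0"
  using psurv_le_1[of \<kappa> "Suc k" 0] unfolding total_tail_def
  by (intro ennreal_enn2real) (auto simp: less_top[symmetric] top_unique simp del: psurv.simps)

lemma busy_tail_nonneg: "0 \<le> busy_tail k" by (simp add: busy_tail_def)

lemma total_tail_nonneg: "0 \<le> total_tail \<kappa> k" by (simp add: total_tail_def)

lemma busy_tail_le_1: "busy_tail k \<le> 1"
  using integral_psurv_le_1[of 0 k] unfolding ennreal_busy_tail[symmetric] by simp

lemma total_tail_le_1: "total_tail \<kappa> k \<le> 1"
  using psurv_le_1[of \<kappa> "Suc k" 0] unfolding ennreal_total_tail[symmetric] by simp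

lemma pend_busy_tail: "(\<integral>\<^sup>+s. pend n s \<partial>D) + ennreal (busy_tail (Suc n)) = ennreal (busy_tail n)"
  unfolding ennreal_busy_tail
  by (subst nn_integral_add[symmetric]) (simp_all add: pend_psurv del: psurv.simps)

lemma busy_tail_Suc_le: "busy_tail (Suc n) \<le> busy_tail n"
proof -
  have "ennreal (busy_tail (Suc n)) \<le> ennreal (busy_tail n)"
    by (subst pend_busy_tail[of n, symmetric]) simp
  then show ?thesis using busy_tail_nonneg by simp
qed

lemma integral_pend: "(\<integral>\<^sup>+s. pend n s \<partial>D) = ennreal (busy_tail n - busy_tail (Suc n))"
proof -
  have "(\<integral>\<^sup>+s. pend n s \<partial>D) = ennreal (busy_tail n) - ennreal (busy_tail (Suc n))"
    by (subst pend_busy_tail[of n, symmetric]) simp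
  then show ?thesis using busy_tail_nonneg by (simp add: ennreal_minus)
qed

text \<open>Integrates \<open>psurv_decompose\<close> over the first service. A first busy period
  with \<open>n\<close> arrivals has \<open>\<eta> = Suc n\<close>, which is why
  \<open>psurv \<kappa> (k - n) 0\<close> reappears as \<open>total_tail\<close> at
  \<open>k - Suc n\<close>.\<close>

lemma total_tail_renewal:
  assumes \<kappa>: "0 \<le> \<kappa>"
  shows "total_tail \<kappa> k = (1 - exp (- l * \<kappa>)) *
     (busy_tail k + (\<Sum>n<k. (busy_tail n - busy_tail (Suc n)) * total_tail \<kappa> (k - Suc n)))"
proof -
  have q: "0 \<le> 1 - exp (- l * \<kappa>)" using \<kappa> l_pos by simp
  have nn: "0 \<le> (busy_tail n - busy_tail (Suc n)) * total_tail \<kappa> m" for n m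
    using busy_tail_Suc_le total_tail_nonneg by simp
  have "ennreal (total_tail \<kappa> k) = ennreal (1 - exp (- l * \<kappa>)) * (\<integral>\<^sup>+s. psurv \<kappa> k s \<partial>D)"
    by (simp only: ennreal_total_tail psurv_Suc_0[OF \<kappa>])
  also have "(\<integral>\<^sup>+s. psurv \<kappa> k s \<partial>D) = (\<integral>\<^sup>+s. psurv 0 k s + (\<Sum>n<k. pend n s * psurv \<kappa> (k - n) 0) \<partial>D)"
  proof (rule nn_integral_cong_AE)
    show "AE s in D. psurv \<kappa> k s = psurv 0 k s + (\<Sum>n<k. pend n s * psurv \<kappa> (k - n) 0)"
      using D_pos by eventually_elim (rule psurv_decompose[OF \<kappa> less_imp_le])
  qed
  also have "\<dots> = ennreal (busy_tail k) + (\<Sum>n<k. ennreal (busy_tail n - busy_tail (Suc n)) * psurv \<kappa> (k - n) 0)"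
    by (simp add: nn_integral_add nn_integral_sum nn_integral_multc integral_pend ennreal_busy_tail)
  also have "(\<Sum>n<k. ennreal (busy_tail n - busy_tail (Suc n)) * psurv \<kappa> (k - n) 0)
     = (\<Sum>n<k. ennreal ((busy_tail n - busy_tail (Suc n)) * total_tail \<kappa> (k - Suc n)))"
  proof (rule sum.cong)
    fix n assume "n \<in> {..<k}"
    then have "k - n = Suc (k - Suc n)" by auto
    then have "psurv \<kappa> (k - n) 0 = ennreal (total_tail \<kappa> (k - Suc n))"
      by (simp only: ennreal_total_tail)
    then show "ennreal (busy_tail n - busy_tail (Suc n)) * psurv \<kappa> (k - n) 0
        = ennreal ((busy_tail n - busy_tail (Suc n)) * total_tail \<kappa> (k - Suc n))"
      using busy_tail_Suc_le total_tail_nonneg by (simp only: ennreal_mult diff_ge_0_iff_ge)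
  qed simp
  also have "\<dots> = ennreal (\<Sum>n<k. (busy_tail n - busy_tail (Suc n)) * total_tail \<kappa> (k - Suc n))"
    using nn by (simp add: sum_ennreal)
  also have "ennreal (busy_tail k) + \<dots> = ennreal (busy_tail k + (\<Sum>n<k. (busy_tail n - busy_tail (Suc n)) * total_tail \<kappa> (k - Suc n)))"
    using nn busy_tail_nonneg by (intro ennreal_plus[symmetric] sum_nonneg) auto
  also have "ennreal (1 - exp (- l * \<kappa>)) * \<dots> = ennreal ((1 - exp (- l * \<kappa>)) *
     (busy_tail k + (\<Sum>n<k. (busy_tail n - busy_tail (Suc n)) * total_tail \<kappa> (k - Suc n))))"
    using nn busy_tail_nonneg q by (intro ennreal_mult[symmetric] add_nonneg_nonneg sum_nonneg) auto
  finally show ?thesis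
    using nn busy_tail_nonneg busy_tail_Suc_le total_tail_nonneg q
    by (subst (asm) ennreal_inj) (auto intro!: mult_nonneg_nonneg add_nonneg_nonneg sum_nonneg)
qed

end

section \<open>Gaps of a Poisson process\<close>

definition pois :: "real \<Rightarrow> nat \<Rightarrow> real" where
  "pois r k = r ^ k / fact k * exp (- r)"

lemma pois_nonneg: "0 \<le> r \<Longrightarrow> 0 \<le> pois r k"
  by (simp add: pois_def)

section \<open>Cell counts of a process with exponential gaps\<close>

lemma expo_memoryless:
  assumes l: "0 < l" and d: "0 \<le> d" and f [measurable]: "f \<in> borel_measurable borel"
  shows "(\<integral>\<^sup>+x. of_bool (d < x) * f (x - d) \<partial>expo l) = ennreal (exp (- l * d)) * (\<integral>\<^sup>+x. f x \<partial>expo l)"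
proof -
  have "(\<integral>\<^sup>+x. of_bool (d < x) * f (x - d) \<partial>expo l)
      = (\<integral>\<^sup>+x. ennreal (exponential_density l x) * (of_bool (d < x) * f (x - d)) \<partial>lborel)"
    by (rule nn_integral_density) measurable
  also have "\<dots> = (\<integral>\<^sup>+x. ennreal (exponential_density l (d + x)) * (of_bool (0 < x) * f x) \<partial>lborel)"
    by (subst nn_integral_real_affine[where c = 1 and t = d]) simp_all
  also have "\<dots> = (\<integral>\<^sup>+x. ennreal (exp (- l * d)) * (ennreal (exponential_density l x) * f x) \<partial>lborel)"
  proof (rule nn_integral_cong_AE)
    \<comment> \<open>The shifted indicator excludes 0, where the density is positive; this single
      point is null.\<close>
    show "AE x in lborel. ennreal (exponential_density l (d + x)) * (of_bool (0 < x) * f x)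
        = ennreal (exp (- l * d)) * (ennreal (exponential_density l x) * f x)"
      using AE_lborel_singleton[of 0]
    proof eventually_elim
      case (elim x)
      have "ennreal (exponential_density l (d + x)) = ennreal (exp (- l * d)) * ennreal (exponential_density l x)"
        if "0 < x"
      proof -
        have "exponential_density l (d + x) = exp (- l * d) * exponential_density l x"
          using that d by (simp add: exponential_density_def algebra_simps exp_add[symmetric])
        then show ?thesis using l by (simp add: ennreal_mult exponential_density_nonneg)
      qed
      then show ?case using elim by (auto simp: exponential_density_def mult.assoc)
    qed
  qed
  also have "\<dots> = ennreal (exp (- l * d)) * (\<integral>\<^sup>+x. f x \<partial>expo l)"
    by (simp add: nn_integral_cmult nn_integral_density)
  finally show ?thesis .
qed

text \<open>Given the first point at \<open>x\<close>, the rest of the cell has length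
  \<open>d - x\<close>. The exponential factors merge to \<open>exp (- l * d)\<close>, leaving a
  power of \<open>d - x\<close> with an explicit primitive.\<close>

lemma expo_pois_convolution:
  assumes l: "0 < l" and d: "0 \<le> d"
  shows "(\<integral>\<^sup>+x. of_bool (x \<le> d) * ennreal (pois (l * (d - x)) k) \<partial>expo l) = ennreal (pois (l * d) (Suc k))"
proof -
  let ?F = "\<lambda>x. - (exp (- l * d) * (l * (d - x)) ^ Suc k / fact (Suc k))"
  let ?f = "\<lambda>x. l * exp (- l * d) * (l * (d - x)) ^ k / fact k"
  have "(\<integral>\<^sup>+x. of_bool (x \<le> d) * ennreal (pois (l * (d - x)) k) \<partial>expo l)
      = (\<integral>\<^sup>+x. ennreal (exponential_density l x) * (of_bool (x \<le> d) * ennreal (pois (l * (d - x)) k)) \<partial>lborel)"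
    unfolding pois_def by (rule nn_integral_density) measurable
  also have "\<dots> = (\<integral>\<^sup>+x. ennreal (?f x) * indicator {0..d} x \<partial>lborel)"
  proof (rule nn_integral_cong)
    fix x
    show "ennreal (exponential_density l x) * (of_bool (x \<le> d) * ennreal (pois (l * (d - x)) k))
       = ennreal (?f x) * indicator {0..d} x"
    proof (cases "0 \<le> x \<and> x \<le> d")
      case True
      have "exponential_density l x * pois (l * (d - x)) k = ?f x"
        using True by (simp add: exponential_density_def pois_def algebra_simps exp_add[symmetric])
      then have "ennreal (exponential_density l x) * ennreal (pois (l * (d - x)) k) = ennreal (?f x)"
        using l True by (simp add: ennreal_mult'[symmetric] exponential_density_nonneg)
      then show ?thesis using True by simp
    qed (auto simp: exponential_density_def indicator_def)
  qed
  also have "\<dots> = ennreal (?F d - ?F 0)"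
  proof (rule nn_integral_FTC_Icc)
    fix x assume x: "x \<in> {0..d}"
    have der: "(?F has_real_derivative - (exp (- l * d) * (real (Suc k) * (l * (d - x)) ^ k * (- l)) / fact (Suc k))) (at x)"
      by (auto intro!: derivative_eq_intros simp del: fact_Suc power_Suc)
    have eq: "- (exp (- l * d) * (real (Suc k) * (l * (d - x)) ^ k * (- l)) / fact (Suc k)) = ?f x"
      by (simp add: field_simps del: of_nat_Suc)
    show "DERIV ?F x :> ?f x" by (rule DERIV_cong[OF der eq])
    show "0 \<le> ?f x" using l x by simp
  qed (use d in auto)
  also have "?F d - ?F 0 = pois (l * d) (Suc k)"
    by (simp add: pois_def)
  finally show ?thesis .
qed

text \<open>Of the points with gaps \<open>\<omega>\<close>, exactly \<open>hd ks\<close> lie in an initial cell of length \<open>d\<close>,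
  and the entries of \<open>tl ks\<close> count those in consecutive cells of length \<open>\<delta>\<close>.\<close>

function cells :: "real \<Rightarrow> real \<Rightarrow> nat list \<Rightarrow> real stream \<Rightarrow> bool" where
  "cells \<delta> d [] \<omega> \<longleftrightarrow> True"
| "cells \<delta> d (0 # ks) \<omega> \<longleftrightarrow> d < shd \<omega> \<and> cells \<delta> \<delta> ks ((shd \<omega> - d) ## stl \<omega>)"
| "cells \<delta> d (Suc k # ks) \<omega> \<longleftrightarrow> shd \<omega> \<le> d \<and> cells \<delta> (d - shd \<omega>) (k # ks) (stl \<omega>)"
  by pat_completeness auto
termination by (relation "Wellfounded.measure (\<lambda>(\<delta>, d, ks, \<omega>). length ks + sum_list ks)") auto

lemma measurable_cells [measurable (raw)]:
  assumes [measurable]: "f \<in> borel_measurable N" "g \<in> measurable N (stream_space borel)"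
  shows "Measurable.pred N (\<lambda>w. cells \<delta> (f w) ks (g w))"
  using assms
proof (induction ks arbitrary: f g)
  case (Cons k ks)
  note IH [measurable] = Cons.IH
  show ?case using Cons.prems
  proof (induction k arbitrary: f g)
    case 0
    note 0 [measurable]
    have [measurable]: "Measurable.pred N (\<lambda>w. cells \<delta> \<delta> ks ((shd (g w) - f w) ## stl (g w)))"
      by (rule IH) measurable
    show ?case by simp
  next
    case (Suc k)
    note Suc.prems [measurable]
    have [measurable]: "Measurable.pred N (\<lambda>w. cells \<delta> (f w - shd (g w)) (k # ks) (stl (g w)))"
      by (rule Suc.IH) measurable
    show ?case by simp
  qed
qed simp

text \<open>Makes the events of distinct count vectors disjoint, so that their probabilities add
  up.\<close>

lemma cells_inject:
  "cells \<delta> d ks \<omega> \<Longrightarrow> cells \<delta> d ks' \<omega> \<Longrightarrow> length ks = length ks' \<Longrightarrow> ks = ks'"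
proof (induction \<delta> d ks \<omega> arbitrary: ks' rule: cells.induct)
  case (2 \<delta> d ks \<omega>)
  then obtain k' ks'' where ks': "ks' = k' # ks''" by (cases ks') auto
  with 2 show ?case by (cases k') auto
next
  case (3 \<delta> d k ks \<omega>)
  then obtain k' ks'' where ks': "ks' = k' # ks''" by (cases ks') auto
  with 3 show ?case by (cases k') fastforce+
qed simp

primrec psum :: "nat \<Rightarrow> real stream \<Rightarrow> real" where
  "psum 0 \<omega> = shd \<omega>"
| "psum (Suc i) \<omega> = shd \<omega> + psum i (stl \<omega>)"

lemma psum_Suc: "psum (Suc i) \<omega> = psum i \<omega> + \<omega> !! Suc i"
  by (induction i arbitrary: \<omega>) auto

lemma measurable_psum [measurable]: "psum i \<in> borel_measurable (stream_space borel)"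
proof (induction i)
  case (Suc i)
  note Suc [measurable]
  show ?case by simp
qed simp

lemma psum_ge_shd: "(\<And>n. 0 \<le> \<omega> !! n) \<Longrightarrow> shd \<omega> \<le> psum i \<omega>"
proof (induction i)
  case (Suc i)
  have "shd \<omega> \<le> psum i \<omega>" by (rule Suc.IH[OF Suc.prems])
  then show ?case using psum_Suc[of i \<omega>] Suc.prems[of "Suc i"] by linarith
qed simp

text \<open>Cumulated counts locate every point relative to the grid, which turns events about
  partial sums at grid times into unions of \<open>cells\<close> events. Nonnegative gaps ensure
  that all points after one beyond a boundary are beyond it as well.\<close>

lemma cells_psum:
  assumes "cells \<delta> d ks \<omega>" "0 \<le> \<delta>" "\<And>n. 0 \<le> \<omega> !! n" "j < length ks"
  shows "psum i \<omega> \<le> d + real j * \<delta> \<longleftrightarrow> i < sum_list (take (Suc j) ks)"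
  using assms
proof (induction \<delta> d ks \<omega> arbitrary: i j rule: cells.induct)
  case (2 \<delta> d ks \<omega>)
  let ?\<omega> = "(shd \<omega> - d) ## stl \<omega>"
  have d: "d < shd \<omega>" using 2 by simp
  have eq: "psum i \<omega> = d + psum i ?\<omega>" by (cases i) auto
  show ?case
  proof (cases j)
    case 0
    then show ?thesis using d psum_ge_shd[of \<omega> i] "2.prems"(3) by fastforce
  next
    case (Suc j')
    have "0 \<le> ?\<omega> !! n" for n using d "2.prems"(3)[of n] by (cases n) auto
    then have "psum i ?\<omega> \<le> \<delta> + real j' * \<delta> \<longleftrightarrow> i < sum_list (take (Suc j') ks)"
      using 2 Suc by (intro "2.IH") auto
    then show ?thesis unfolding eq using Suc by (simp add: algebra_simps)
  qed
next
  case (3 \<delta> d k ks \<omega>)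
  have nn: "0 \<le> stl \<omega> !! n" for n using "3.prems"(3)[of "Suc n"] by simp
  have d: "shd \<omega> \<le> d" using 3 by simp
  show ?case
  proof (cases i)
    case 0
    then show ?thesis using d "3.prems"(2) by (simp add: add_increasing2)
  next
    case (Suc i')
    have "psum i' (stl \<omega>) \<le> d - shd \<omega> + real j * \<delta> \<longleftrightarrow> i' < sum_list (take (Suc j) (k # ks))"
      using 3 nn by (intro "3.IH") auto
    then show ?thesis using Suc by (simp add: algebra_simps)
  qed
qed simp

fun cells_prob :: "real \<Rightarrow> real \<Rightarrow> real \<Rightarrow> nat list \<Rightarrow> real" where
  "cells_prob l \<delta> d [] = 1"
| "cells_prob l \<delta> d (k # ks) = pois (l * d) k * (\<Prod>j\<leftarrow>ks. pois (l * \<delta>) j)"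

text \<open>An empty cell is crossed by lack of memory, which makes the overshoot a fresh first gap;
  a nonempty one loses its first point by \<open>expo_pois_convolution\<close>, which raises the
  Poisson index by one. The product form is the independence of the counts.\<close>

lemma emeasure_cells:
  assumes l: "0 < l" and \<delta>: "0 \<le> \<delta>" and d: "0 \<le> d"
  shows "emeasure (stream_space (expo l)) {\<omega> \<in> space (stream_space (expo l)). cells \<delta> d ks \<omega>}
    = ennreal (cells_prob l \<delta> d ks)"
proof -
  interpret X: prob_space "expo l" by (rule prob_space_exponential_density) (rule l)
  interpret SX: prob_space "stream_space (expo l)" by (rule X.prob_space_stream_space)
  have m [measurable_cong]: "sets (stream_space (expo l)) = sets (stream_space borel)"
    by (auto intro!: sets_stream_space_cong)
  have *: "(\<integral>\<^sup>+\<omega>. of_bool (cells \<delta> d ks \<omega>) \<partial>stream_space (expo l)) = ennreal (cells_prob l \<delta> d ks)"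
    using d
  proof (induction ks arbitrary: d)
    case Nil
    then show ?case using SX.emeasure_space_1 by simp
  next
    case (Cons k ks)
    have pos: "0 \<le> (\<Prod>j\<leftarrow>ks. pois (l * \<delta>) j)"
      using l \<delta> by (intro prod_list_nonneg) (auto simp: pois_nonneg)
    have prod: "cells_prob l \<delta> \<delta> ks = (\<Prod>j\<leftarrow>ks. pois (l * \<delta>) j)" by (cases ks) auto
    show ?case using Cons.prems
    proof (induction k arbitrary: d)
      case 0
      have "(\<integral>\<^sup>+\<omega>. of_bool (cells \<delta> d (0 # ks) \<omega>) \<partial>stream_space (expo l))
         = (\<integral>\<^sup>+x. \<integral>\<^sup>+\<omega>. of_bool (cells \<delta> d (0 # ks) (x ## \<omega>)) \<partial>stream_space (expo l) \<partial>expo l)"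
        by (rule X.nn_integral_stream_space) measurable
      also have "\<dots> = (\<integral>\<^sup>+x. of_bool (d < x) * (\<integral>\<^sup>+\<omega>. of_bool (cells \<delta> \<delta> ks ((x - d) ## \<omega>)) \<partial>stream_space (expo l)) \<partial>expo l)"
        by (intro nn_integral_cong) (simp add: of_bool_conj)
      also have "\<dots> = ennreal (exp (- l * d)) * (\<integral>\<^sup>+x. \<integral>\<^sup>+\<omega>. of_bool (cells \<delta> \<delta> ks (x ## \<omega>)) \<partial>stream_space (expo l) \<partial>expo l)"
        by (rule expo_memoryless[OF l 0]) measurable
      also have "(\<integral>\<^sup>+x. \<integral>\<^sup>+\<omega>. of_bool (cells \<delta> \<delta> ks (x ## \<omega>)) \<partial>stream_space (expo l) \<partial>expo l)
         = (\<integral>\<^sup>+\<omega>. of_bool (cells \<delta> \<delta> ks \<omega>) \<partial>stream_space (expo l))"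
        by (rule X.nn_integral_stream_space[symmetric]) measurable
      also have "\<dots> = ennreal (cells_prob l \<delta> \<delta> ks)" by (rule Cons.IH[OF \<delta>])
      also have "ennreal (exp (- l * d)) * \<dots> = ennreal (cells_prob l \<delta> d (0 # ks))"
        unfolding prod by (simp add: pois_def ennreal_mult')
      finally show ?case .
    next
      case (Suc k)
      have "(\<integral>\<^sup>+\<omega>. of_bool (cells \<delta> d (Suc k # ks) \<omega>) \<partial>stream_space (expo l))
         = (\<integral>\<^sup>+x. \<integral>\<^sup>+\<omega>. of_bool (cells \<delta> d (Suc k # ks) (x ## \<omega>)) \<partial>stream_space (expo l) \<partial>expo l)"
        by (rule X.nn_integral_stream_space) measurable
      also have "\<dots> = (\<integral>\<^sup>+x. of_bool (x \<le> d) * (\<integral>\<^sup>+\<omega>. of_bool (cells \<delta> (d - x) (k # ks) \<omega>) \<partial>stream_space (expo l)) \<partial>expo l)"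
        by (intro nn_integral_cong) (simp add: of_bool_conj)
      also have "\<dots> = (\<integral>\<^sup>+x. of_bool (x \<le> d) * ennreal (pois (l * (d - x)) k) * ennreal (\<Prod>j\<leftarrow>ks. pois (l * \<delta>) j) \<partial>expo l)"
      proof (rule nn_integral_cong)
        fix x
        show "of_bool (x \<le> d) * (\<integral>\<^sup>+\<omega>. of_bool (cells \<delta> (d - x) (k # ks) \<omega>) \<partial>stream_space (expo l))
          = of_bool (x \<le> d) * ennreal (pois (l * (d - x)) k) * ennreal (\<Prod>j\<leftarrow>ks. pois (l * \<delta>) j)"
          using Suc.IH[of "d - x"] pos by (cases "x \<le> d") (simp_all add: ennreal_mult'')
      qed
      also have "\<dots> = ennreal (pois (l * d) (Suc k)) * ennreal (\<Prod>j\<leftarrow>ks. pois (l * \<delta>) j)"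
        unfolding expo_pois_convolution[OF l Suc.prems, symmetric]
        by (rule nn_integral_multc) (simp add: pois_def)
      also have "\<dots> = ennreal (cells_prob l \<delta> d (Suc k # ks))"
        using pos by (simp add: ennreal_mult'')
      finally show ?case .
    qed
  qed
  have "(\<integral>\<^sup>+\<omega>. of_bool (cells \<delta> d ks \<omega>) \<partial>stream_space (expo l))
     = (\<integral>\<^sup>+\<omega>. indicator {\<omega> \<in> space (stream_space (expo l)). cells \<delta> d ks \<omega>} \<omega> \<partial>stream_space (expo l))"
    by (intro nn_integral_cong) (auto simp: indicator_def)
  also have "\<dots> = emeasure (stream_space (expo l)) {\<omega> \<in> space (stream_space (expo l)). cells \<delta> d ks \<omega>}"
    by (rule nn_integral_indicator) measurable
  finally show ?thesis using * by simp
qed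

section \<open>Equality of laws on a grid\<close>

lemma AE_expo_pos: "AE x in expo l. 0 < x"
proof -
  have "AE x in lborel. 0 < ennreal (exponential_density l x) \<longrightarrow> 0 < x"
    using AE_lborel_singleton[of 0] by eventually_elim (auto simp: exponential_density_def split: if_splits)
  then show ?thesis by (subst AE_density) auto
qed

text \<open>Describes the points \<open>E\<close> only through their counts in the cells of one
  grid. The clause that ties points to cumulated counts is almost sure because paths with an
  infinite arrival time, or with an arrival while the clock still shows 0, have to be
  discarded.\<close>

definition poisson_increments :: "'a measure \<Rightarrow> real \<Rightarrow> (nat \<Rightarrow> 'a \<Rightarrow> real) \<Rightarrow> real \<Rightarrow> (nat \<Rightarrow> 'a \<Rightarrow> nat) \<Rightarrow> bool" where
  "poisson_increments M l E \<delta> C \<longleftrightarrow>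
     (\<forall>J. prob_space.indep_vars M (\<lambda>_. count_space UNIV) C {..<J}) \<and>
     (\<forall>k m. measure M {\<omega> \<in> space M. C k \<omega> = m} = pois (l * \<delta>) m) \<and>
     (AE \<omega> in M. \<forall>i j. E i \<omega> \<le> real j * \<delta> \<longleftrightarrow> i < (\<Sum>k<j. C k \<omega>))"

text \<open>Both laws assign the same mass to each vector of cell counts; as these masses bound the probability
  of the event and of its complement from below on the stream space, equality follows without showing there
  that the counts are almost surely finite.\<close>

lemma grid_event_eq:
  fixes E :: "nat \<Rightarrow> 'a \<Rightarrow> real" and a :: "nat \<Rightarrow> nat"
  assumes M: "prob_space M" and E [measurable]: "\<And>i. E i \<in> borel_measurable M"
    and l: "0 < l" and \<delta>: "0 < \<delta>" and C: "poisson_increments M l E \<delta> C"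
  shows "emeasure M {\<omega> \<in> space M. \<forall>i<n. real (a i) * \<delta> < E i \<omega>}
    = emeasure (stream_space (expo l)) {\<omega> \<in> space (stream_space (expo l)). \<forall>i<n. real (a i) * \<delta> < psum i \<omega>}"
proof -
  interpret M: prob_space M by fact
  interpret X: prob_space "expo l" by (rule prob_space_exponential_density) (rule l)
  interpret SX: prob_space "stream_space (expo l)" by (rule X.prob_space_stream_space)
  let ?S = "stream_space (expo l)"
  have m [measurable_cong]: "sets ?S = sets (stream_space borel)"
    by (auto intro!: sets_stream_space_cong)
  \<comment> \<open>Enough cells to reach every grid time \<open>a i * \<delta>\<close>;
    \<open>Suc\<close> keeps the index set nonempty, as the finite intersections below
    require.\<close>
  define J where "J = Suc (\<Sum>i<n. a i)"
  have aJ: "a i \<le> J" if "i < n" for i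
    unfolding J_def using that member_le_sum[of i "{..<n}" a] by (intro le_SucI) auto
  have ind: "M.indep_vars (\<lambda>_. count_space UNIV) C {..<J}"
    and law: "\<And>k m. M.prob {\<omega> \<in> space M. C k \<omega> = m} = pois (l * \<delta>) m"
    and cnt: "AE \<omega> in M. \<forall>i j. E i \<omega> \<le> real j * \<delta> \<longleftrightarrow> i < (\<Sum>k<j. C k \<omega>)"
    using C by (auto simp: poisson_increments_def)
  have C_meas: "C k \<in> measurable M (count_space UNIV)" if "k < J" for k
    using ind that by (auto simp: M.indep_vars_def)
  define A where "A ks = {\<omega> \<in> space M. \<forall>k<J. C k \<omega> = ks ! k}" for ks
  define B where "B ks = {\<omega> \<in> space ?S. cells \<delta> \<delta> ks \<omega>}" for ks
  have A_sets [measurable]: "A ks \<in> sets M" for ks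
  proof -
    have "A ks = (\<Inter>k\<in>{..<J}. C k -` {ks ! k} \<inter> space M)" by (auto simp: A_def J_def)
    also have "\<dots> \<in> sets M"
      by (intro sets.finite_INT) (auto simp: J_def intro!: measurable_sets[OF C_meas])
    finally show ?thesis .
  qed
  have B_sets [measurable]: "B ks \<in> sets ?S" for ks
    unfolding B_def by measurable
  have AB: "emeasure M (A ks) = emeasure ?S (B ks)" if ks: "length ks = J" for ks
  proof -
    have "A ks = (\<Inter>k\<in>{..<J}. C k -` {ks ! k} \<inter> space M)" by (auto simp: A_def J_def)
    then have "M.prob (A ks) = M.prob (\<Inter>k\<in>{..<J}. C k -` {ks ! k} \<inter> space M)" by simp
    also have "\<dots> = (\<Prod>k\<in>{..<J}. M.prob (C k -` {ks ! k} \<inter> space M))"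
      by (rule M.indep_varsD[OF ind]) (auto simp: J_def)
    also have "\<dots> = (\<Prod>k\<in>{..<J}. pois (l * \<delta>) (ks ! k))"
    proof (rule prod.cong)
      fix k
      have "C k -` {ks ! k} \<inter> space M = {\<omega> \<in> space M. C k \<omega> = ks ! k}" by auto
      then show "M.prob (C k -` {ks ! k} \<inter> space M) = pois (l * \<delta>) (ks ! k)" by (simp add: law)
    qed simp
    also have "\<dots> = (\<Prod>j\<leftarrow>ks. pois (l * \<delta>) j)"
      by (simp add: prod.list_conv_set_nth ks atLeast0LessThan)
    also have "\<dots> = cells_prob l \<delta> \<delta> ks" by (cases ks) auto
    finally show ?thesis
      using l \<delta> by (simp add: B_def emeasure_cells M.emeasure_eq_measure less_imp_le)
  qed
  define K where "K Q = {ks. length ks = J \<and> Q ks}" for Q :: "nat list \<Rightarrow> bool"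
  have eqQ: "emeasure M (\<Union>ks\<in>K Q. A ks) = emeasure ?S (\<Union>ks\<in>K Q. B ks)" for Q
  proof -
    have "emeasure M (\<Union>ks\<in>K Q. A ks) = (\<integral>\<^sup>+ks. emeasure M (A ks) \<partial>count_space (K Q))"
    proof (rule emeasure_UN_countable)
      show "disjoint_family_on A (K Q)"
        by (auto simp: disjoint_family_on_def A_def K_def list_eq_iff_nth_eq)
    qed auto
    also have "\<dots> = (\<integral>\<^sup>+ks. emeasure ?S (B ks) \<partial>count_space (K Q))"
      by (rule nn_integral_cong) (auto simp: K_def AB)
    also have "\<dots> = emeasure ?S (\<Union>ks\<in>K Q. B ks)"
    proof (rule emeasure_UN_countable[symmetric])
      show "disjoint_family_on B (K Q)"
        using cells_inject by (fastforce simp: disjoint_family_on_def B_def K_def)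
    qed auto
    finally show ?thesis .
  qed
  \<comment> \<open>Points are numbered from 0, so point \<open>i\<close> lies beyond the grid time
    \<open>a i * \<delta>\<close> exactly when at most \<open>i\<close> points lie up to it.\<close>
  define good where "good ks \<longleftrightarrow> (\<forall>i<n. sum_list (take (a i) ks) \<le> i)" for ks
  let ?EM = "{\<omega> \<in> space M. \<forall>i<n. real (a i) * \<delta> < E i \<omega>}"
  let ?ES = "{\<omega> \<in> space ?S. \<forall>i<n. real (a i) * \<delta> < psum i \<omega>}"
  have goodM: "AE \<omega> in M. (\<omega> \<in> ?EM \<longleftrightarrow> \<omega> \<in> (\<Union>ks\<in>K good. A ks)) \<and> (\<omega> \<notin> ?EM \<longleftrightarrow> \<omega> \<in> (\<Union>ks\<in>K (\<lambda>ks. \<not> good ks). A ks))"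
    using cnt AE_space
  proof eventually_elim
    case (elim \<omega>)
    define L where "L = map (\<lambda>k. C k \<omega>) [0..<J]"
    have AL: "\<omega> \<in> A ks \<longleftrightarrow> ks = L" if "length ks = J" for ks
      using that elim by (auto simp: A_def L_def list_eq_iff_nth_eq)
    have "\<omega> \<in> ?EM \<longleftrightarrow> good L"
    proof -
      have "sum_list (take (a i) L) = (\<Sum>k<a i. C k \<omega>)" if "i < n" for i
        using aJ[OF that] by (simp add: L_def take_map interv_sum_list_conv_sum_set_nat atLeast0LessThan)
      then have "good L \<longleftrightarrow> (\<forall>i<n. \<not> i < (\<Sum>k<a i. C k \<omega>))"
        by (auto simp: good_def)
      moreover have "real (a i) * \<delta> < E i \<omega> \<longleftrightarrow> \<not> i < (\<Sum>k<a i. C k \<omega>)" for i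
        using elim(1)[rule_format, of i "a i"] by linarith
      ultimately show ?thesis using elim(2) by simp
    qed
    moreover have "\<omega> \<in> (\<Union>ks\<in>K Q. A ks) \<longleftrightarrow> Q L" for Q
      using AL by (auto simp: K_def) (simp add: L_def)
    ultimately show ?case by simp
  qed
  have pos: "AE \<omega> in ?S. stream_all (\<lambda>x. 0 < x) \<omega>"
    by (rule X.AE_stream_all) (use AE_expo_pos in auto)
  have goodS: "(\<forall>i<n. real (a i) * \<delta> < psum i \<omega>) \<longleftrightarrow> good ks"
    if \<omega>: "stream_all (\<lambda>x. 0 < x) \<omega>" "\<omega> \<in> B ks" "length ks = J" for ks \<omega>
  proof -
    have p: "0 < \<omega> !! i" for i using \<omega>(1) by (simp add: stream_all_def)
    have "real (a i) * \<delta> < psum i \<omega> \<longleftrightarrow> sum_list (take (a i) ks) \<le> i" if i: "i < n" for i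
    proof (cases "a i")
      case 0
      then show ?thesis using p[of 0] psum_ge_shd[of \<omega> i] p by (simp add: less_imp_le less_le_trans)
    next
      case (Suc b)
      have "psum i \<omega> \<le> \<delta> + real b * \<delta> \<longleftrightarrow> i < sum_list (take (Suc b) ks)"
        using \<omega> p \<delta> aJ[OF i] Suc by (intro cells_psum) (auto simp: B_def less_imp_le)
      then show ?thesis unfolding Suc by (auto simp: algebra_simps not_le[symmetric])
    qed
    then show ?thesis by (auto simp: good_def)
  qed
  have ES [measurable]: "?ES \<in> sets ?S" and EM [measurable]: "?EM \<in> sets M"
    by measurable
  have "emeasure M ?EM = emeasure M (\<Union>ks\<in>K good. A ks)"
    by (rule emeasure_eq_AE) (use goodM in \<open>auto elim: eventually_mono\<close>)
  also have "\<dots> = emeasure ?S (\<Union>ks\<in>K good. B ks)" by (rule eqQ)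
  also have "\<dots> \<le> emeasure ?S ?ES"
  proof (rule emeasure_mono_AE)
    show "AE \<omega> in ?S. \<omega> \<in> (\<Union>ks\<in>K good. B ks) \<longrightarrow> \<omega> \<in> ?ES"
      using pos
    proof eventually_elim
      case (elim \<omega>)
      show ?case
      proof
        assume "\<omega> \<in> (\<Union>ks\<in>K good. B ks)"
        then obtain ks where ks: "length ks = J" "good ks" "\<omega> \<in> B ks" by (auto simp: K_def)
        moreover have "\<omega> \<in> space ?S" using ks(3) by (simp add: B_def)
        ultimately show "\<omega> \<in> ?ES" using goodS[OF elim ks(3) ks(1)] by simp
      qed
    qed
  qed measurable
  finally have 1: "emeasure M ?EM \<le> emeasure ?S ?ES" .
  have "emeasure M (space M - ?EM) = emeasure M (\<Union>ks\<in>K (\<lambda>ks. \<not> good ks). A ks)"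
    by (rule emeasure_eq_AE, use goodM AE_space in eventually_elim) auto
  also have "\<dots> = emeasure ?S (\<Union>ks\<in>K (\<lambda>ks. \<not> good ks). B ks)" by (rule eqQ)
  also have "\<dots> \<le> emeasure ?S (space ?S - ?ES)"
  proof (rule emeasure_mono_AE)
    show "AE \<omega> in ?S. \<omega> \<in> (\<Union>ks\<in>K (\<lambda>ks. \<not> good ks). B ks) \<longrightarrow> \<omega> \<in> space ?S - ?ES"
      using pos
    proof eventually_elim
      case (elim \<omega>)
      show ?case
      proof
        assume "\<omega> \<in> (\<Union>ks\<in>K (\<lambda>ks. \<not> good ks). B ks)"
        then obtain ks where ks: "length ks = J" "\<not> good ks" "\<omega> \<in> B ks" by (auto simp: K_def)
        moreover have "\<omega> \<in> space ?S" using ks(3) by (simp add: B_def)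
        ultimately show "\<omega> \<in> space ?S - ?ES" using goodS[OF elim ks(3) ks(1)] by simp
      qed
    qed
  qed measurable
  finally have "M.prob (space M - ?EM) \<le> SX.prob (space ?S - ?ES)"
    by (simp add: M.emeasure_eq_measure SX.emeasure_eq_measure)
  then have "SX.prob ?ES \<le> M.prob ?EM"
    using M.prob_compl[OF EM] SX.prob_compl[OF ES] by simp
  then show ?thesis using 1 by (simp add: M.emeasure_eq_measure SX.emeasure_eq_measure)
qed

text \<open>An upper approximation on the grid of width \<open>1 / 2 ^ m\<close>. The added 1 makes
  it strict, so that the events it defines can increase to the limit event; clipping at 0 is due to
  grid times being nonnegative.\<close>

definition dyadic_above :: "nat \<Rightarrow> real \<Rightarrow> nat" where
  "dyadic_above m x = nat (\<lfloor>max x 0 * 2 ^ m\<rfloor> + 1)"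

lemma dyadic_above_bounds:
  "max x 0 < real (dyadic_above m x) * (1 / 2 ^ m)"
  "real (dyadic_above m x) * (1 / 2 ^ m) \<le> max x 0 + 1 / 2 ^ m"
proof -
  define z where "z = max x 0"
  have "0 \<le> z" by (simp add: z_def)
  then have "0 \<le> \<lfloor>z * 2 ^ m\<rfloor>" by simp
  then have d: "real (dyadic_above m x) = of_int \<lfloor>z * 2 ^ m\<rfloor> + 1" by (simp add: dyadic_above_def z_def)
  have "z * 2 ^ m < real (dyadic_above m x)" "real (dyadic_above m x) \<le> z * 2 ^ m + 1"
    unfolding d by linarith+
  then show "max x 0 < real (dyadic_above m x) * (1 / 2 ^ m)"
    "real (dyadic_above m x) * (1 / 2 ^ m) \<le> max x 0 + 1 / 2 ^ m"
    unfolding z_def[symmetric] by (simp_all add: pos_less_divide_eq pos_divide_le_eq distrib_right)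
qed

lemma dyadic_above_decseq:
  "real (dyadic_above (Suc m) x) * (1 / 2 ^ Suc m) \<le> real (dyadic_above m x) * (1 / 2 ^ m)"
proof -
  let ?y = "max x 0 * 2 ^ m"
  have "\<lfloor>2 * y\<rfloor> + 1 \<le> 2 * (\<lfloor>y\<rfloor> + 1)" for y :: real
  proof -
    have "\<lfloor>2 * y\<rfloor> < 2 * \<lfloor>y\<rfloor> + 2" unfolding floor_less_iff of_int_add of_int_mult of_int_numeral
      using floor_correct[of y] by linarith
    then show ?thesis by simp
  qed
  from this[of ?y] have "\<lfloor>2 * ?y\<rfloor> + 1 \<le> 2 * (\<lfloor>?y\<rfloor> + 1)" .
  moreover have "2 * ?y = max x 0 * 2 ^ Suc m" by simp
  ultimately have "\<lfloor>max x 0 * 2 ^ Suc m\<rfloor> + 1 \<le> 2 * (\<lfloor>?y\<rfloor> + 1)" by metis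
  then have "nat (\<lfloor>max x 0 * 2 ^ Suc m\<rfloor> + 1) \<le> nat (2 * (\<lfloor>?y\<rfloor> + 1))" by (rule nat_mono)
  also have "\<dots> = 2 * nat (\<lfloor>?y\<rfloor> + 1)" by (simp add: nat_mult_distrib)
  finally have "dyadic_above (Suc m) x \<le> 2 * dyadic_above m x" by (simp only: dyadic_above_def)
  then have "real (dyadic_above (Suc m) x) \<le> 2 * real (dyadic_above m x)" by linarith
  then show ?thesis by (simp add: field_simps)
qed

lemma dyadic_above_tendsto:
  "(\<lambda>m. real (dyadic_above m x) * (1 / 2 ^ m)) \<longlonglongrightarrow> max x 0"
proof (rule tendsto_sandwich[OF _ _ tendsto_const])
  have "(\<lambda>m. (1 / 2) ^ m :: real) \<longlonglongrightarrow> 0" by (rule LIMSEQ_realpow_zero) auto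
  then show "(\<lambda>m. max x 0 + 1 / 2 ^ m) \<longlonglongrightarrow> max x 0"
    using tendsto_add[OF tendsto_const] by (fastforce simp: power_divide)
qed (use dyadic_above_bounds in \<open>auto intro!: always_eventually less_imp_le\<close>)

text \<open>The thresholds decrease to \<open>max (q i) 0\<close> without reaching it, so the events
  increase to the one for \<open>max (q i) 0\<close>; positivity of \<open>F\<close> makes the
  clipping invisible.\<close>

lemma emeasure_dyadic_approx:
  fixes F :: "nat \<Rightarrow> 'a \<Rightarrow> real"
  assumes F [measurable]: "\<And>i. F i \<in> borel_measurable N" and pos: "AE \<omega> in N. \<forall>i. 0 < F i \<omega>"
  shows "(\<lambda>m. emeasure N {\<omega> \<in> space N. \<forall>i<n. real (dyadic_above m (q i)) * (1 / 2 ^ m) < F i \<omega>})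
    \<longlonglongrightarrow> emeasure N {\<omega> \<in> space N. \<forall>i<n. q i < F i \<omega>}"
proof -
  define A where "A m = {\<omega> \<in> space N. \<forall>i<n. real (dyadic_above m (q i)) * (1 / 2 ^ m) < F i \<omega>}" for m
  have "incseq A"
    unfolding A_def by (rule incseq_SucI) (use dyadic_above_decseq le_less_trans in blast)
  moreover have "range A \<subseteq> sets N" unfolding A_def by (auto, measurable)
  ultimately have lim: "(\<lambda>m. emeasure N (A m)) \<longlonglongrightarrow> emeasure N (\<Union>m. A m)"
    by (rule Lim_emeasure_incseq[rotated])
  have "(\<Union>m. A m) = {\<omega> \<in> space N. \<forall>i<n. max (q i) 0 < F i \<omega>}"
  proof safe
    fix \<omega> assume \<omega>: "\<omega> \<in> space N" "\<forall>i<n. max (q i) 0 < F i \<omega>"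
    have "\<forall>\<^sub>F m in sequentially. \<forall>i\<in>{..<n}. real (dyadic_above m (q i)) * (1 / 2 ^ m) < F i \<omega>"
      using \<omega>(2) by (intro eventually_ball_finite ballI order_tendstoD(2)[OF dyadic_above_tendsto]) auto
    then obtain m where "\<forall>i\<in>{..<n}. real (dyadic_above m (q i)) * (1 / 2 ^ m) < F i \<omega>"
      using eventually_happens by fastforce
    then show "\<omega> \<in> (\<Union>m. A m)" using \<omega>(1) by (auto simp: A_def)
  qed (use dyadic_above_bounds(1) less_trans in \<open>auto simp: A_def simp del: max_less_iff_conj\<close>, blast)
  also have "emeasure N \<dots> = emeasure N {\<omega> \<in> space N. \<forall>i<n. q i < F i \<omega>}"
    by (rule emeasure_eq_AE, use pos in eventually_elim) auto
  finally show ?thesis using lim unfolding A_def by simp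
qed

lemma scylinder_greaterThan:
  "\<omega> \<in> scylinder UNIV (map greaterThan qs) \<longleftrightarrow> (\<forall>i<length qs. qs ! i < \<omega> !! i)"
  by (induction qs arbitrary: \<omega>) (auto simp: nth_Cons split: nat.splits)

text \<open>Right half-lines form an intersection-stable generator, so the cylinders built from them
  determine the law of a stream. For dyadic thresholds both laws agree by
  \<open>grid_event_eq\<close>, and the dyadic limit extends this to all thresholds.\<close>

lemma poisson_stream_law:
  fixes E :: "nat \<Rightarrow> 'a \<Rightarrow> real"
  assumes M: "prob_space M" and E [measurable]: "\<And>i. E i \<in> borel_measurable M"
    and l: "0 < l" and grid: "\<And>\<delta>. 0 < \<delta> \<Longrightarrow> \<exists>C. poisson_increments M l E \<delta> C"
  shows "distr M (stream_space borel) (\<lambda>\<omega>. to_stream (\<lambda>i. E i \<omega>))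
    = distr (stream_space (expo l)) (stream_space borel) (\<lambda>\<omega>. to_stream (\<lambda>i. psum i \<omega>))"
proof -
  interpret M: prob_space M by fact
  interpret X: prob_space "expo l" by (rule prob_space_exponential_density) (rule l)
  let ?S = "stream_space (expo l)"
  interpret SX: prob_space ?S by (rule X.prob_space_stream_space)
  have m [measurable_cong]: "sets ?S = sets (stream_space borel)"
    by (auto intro!: sets_stream_space_cong)
  have E_stream [measurable]: "(\<lambda>\<omega>. to_stream (\<lambda>i. E i \<omega>)) \<in> measurable M (stream_space borel)"
    by (rule measurable_stream_space2) (simp add: to_stream_def)
  have psum_stream [measurable]: "(\<lambda>\<omega>. to_stream (\<lambda>i. psum i \<omega>)) \<in> measurable ?S (stream_space borel)"
    by (rule measurable_stream_space2) (simp add: to_stream_def)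
  have posE: "AE \<omega> in M. \<forall>i. 0 < E i \<omega>"
  proof -
    obtain C where "poisson_increments M l E 1 C" using grid[of 1] by auto
    then have "AE \<omega> in M. \<forall>i j. E i \<omega> \<le> real j * 1 \<longleftrightarrow> i < (\<Sum>k<j. C k \<omega>)"
      by (auto simp: poisson_increments_def)
    then show ?thesis
    proof eventually_elim
      case (elim \<omega>)
      have "\<not> E i \<omega> \<le> 0" for i using elim[rule_format, of i 0] by simp
      then show ?case by (simp add: not_le)
    qed
  qed
  have "AE \<omega> in ?S. stream_all (\<lambda>x. 0 < x) \<omega>"
    by (rule X.AE_stream_all) (use AE_expo_pos in auto)
  then have posP: "AE \<omega> in ?S. \<forall>i. 0 < psum i \<omega>"
  proof eventually_elim
    case (elim \<omega>)
    then have "0 < shd \<omega>" "0 \<le> \<omega> !! i" for i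
      unfolding stream_all_def by (metis snth.simps(1), simp add: less_imp_le)
    then show ?case using psum_ge_shd[of \<omega>] less_le_trans by blast
  qed
  show ?thesis
  proof (rule stream_space_eq_scylinder[where S = borel and G = "range greaterThan" and C = "range (\<lambda>n. {- real n<..})"])
    show "prob_space (distr M (stream_space borel) (\<lambda>\<omega>. to_stream (\<lambda>i. E i \<omega>)))"
      by (rule M.prob_space_distr) measurable
    show "prob_space (distr ?S (stream_space borel) (\<lambda>\<omega>. to_stream (\<lambda>i. psum i \<omega>)))"
      by (rule SX.prob_space_distr) measurable
    show "Int_stable (range (greaterThan :: real \<Rightarrow> real set))"
    proof -
      have "{a<..} \<inter> {b<..} = {max a b<..}" for a b :: real by auto
      then show ?thesis by (auto simp: Int_stable_def)
    qed
    show "sets (borel :: real measure) = sets (sigma (space borel) (range greaterThan))"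
      by (simp add: borel_Ioi)
    show "\<Union>(range (\<lambda>n. {- real n<..})) = space borel"
    proof -
      have "\<exists>n. - real n < x" for x using reals_Archimedean2[of "- x"] by (auto simp: minus_less_iff)
      then show ?thesis by auto
    qed
  next
    fix As :: "real set list" assume "As \<in> lists (range greaterThan)"
    then obtain qs where As: "As = map greaterThan qs"
      by (metis (no_types, lifting) ex_map_conv in_listsD rangeE)
    let ?n = "length qs"
    let ?r = "\<lambda>m i. real (dyadic_above m (qs ! i)) * (1 / 2 ^ m)"
    have sc: "scylinder UNIV As \<in> sets (stream_space borel)"
      using sets_scylinder[of As borel] by (auto simp: As)
    have "emeasure M {\<omega> \<in> space M. \<forall>i<?n. ?r m i < E i \<omega>}
        = emeasure ?S {\<omega> \<in> space ?S. \<forall>i<?n. ?r m i < psum i \<omega>}" for m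
    proof -
      obtain C where "poisson_increments M l E (1 / 2 ^ m) C" using grid[of "1 / 2 ^ m"] by auto
      then show ?thesis by (intro grid_event_eq[OF M E l]) simp_all
    qed
    moreover have "(\<lambda>m. emeasure M {\<omega> \<in> space M. \<forall>i<?n. ?r m i < E i \<omega>})
        \<longlonglongrightarrow> emeasure M {\<omega> \<in> space M. \<forall>i<?n. qs ! i < E i \<omega>}"
      by (rule emeasure_dyadic_approx[OF E posE])
    moreover have "(\<lambda>m. emeasure ?S {\<omega> \<in> space ?S. \<forall>i<?n. ?r m i < psum i \<omega>})
        \<longlonglongrightarrow> emeasure ?S {\<omega> \<in> space ?S. \<forall>i<?n. qs ! i < psum i \<omega>}"
      by (rule emeasure_dyadic_approx[OF _ posP]) measurable
    ultimately have "emeasure M {\<omega> \<in> space M. \<forall>i<?n. qs ! i < E i \<omega>}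
        = emeasure ?S {\<omega> \<in> space ?S. \<forall>i<?n. qs ! i < psum i \<omega>}"
      by (simp only: LIMSEQ_unique)
    moreover have "(\<lambda>\<omega>. to_stream (\<lambda>i. E i \<omega>)) -` scylinder UNIV As \<inter> space M
        = {\<omega> \<in> space M. \<forall>i<?n. qs ! i < E i \<omega>}"
      unfolding As by (auto simp: scylinder_greaterThan to_stream_def)
    moreover have "(\<lambda>\<omega>. to_stream (\<lambda>i. psum i \<omega>)) -` scylinder UNIV As \<inter> space ?S
        = {\<omega> \<in> space ?S. \<forall>i<?n. qs ! i < psum i \<omega>}"
      unfolding As by (auto simp: scylinder_greaterThan to_stream_def)
    ultimately show "emeasure (distr M (stream_space borel) (\<lambda>\<omega>. to_stream (\<lambda>i. E i \<omega>))) (scylinder (space borel) As)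
      = emeasure (distr ?S (stream_space borel) (\<lambda>\<omega>. to_stream (\<lambda>i. psum i \<omega>))) (scylinder (space borel) As)"
      using sc by (simp add: emeasure_distr)
  qed auto
qed

definition gaps :: "(nat \<Rightarrow> real) \<Rightarrow> nat \<Rightarrow> real" where
  "gaps f i = (case i of 0 \<Rightarrow> f 0 | Suc j \<Rightarrow> f (Suc j) - f j)"

lemma gaps_psum: "to_stream (gaps (\<lambda>i. psum i \<omega>)) = \<omega>"
proof -
  have "gaps (\<lambda>i. psum i \<omega>) i = \<omega> !! i" for i
    by (cases i) (simp_all add: gaps_def psum_Suc del: psum.simps(2))
  then have "gaps (\<lambda>i. psum i \<omega>) = snth \<omega>" by auto
  then show ?thesis by (simp add: to_stream_def stream_smap_nats[symmetric])
qed

text \<open>Taking differences is measurable and inverts partial summation, so it carries the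
  equality of laws from the points over to the gaps.\<close>

lemma poisson_gaps_law:
  fixes E :: "nat \<Rightarrow> 'a \<Rightarrow> real"
  assumes M: "prob_space M" and E [measurable]: "\<And>i. E i \<in> borel_measurable M"
    and l: "0 < l" and grid: "\<And>\<delta>. 0 < \<delta> \<Longrightarrow> \<exists>C. poisson_increments M l E \<delta> C"
  shows "distr M (stream_space (expo l)) (\<lambda>\<omega>. to_stream (gaps (\<lambda>i. E i \<omega>))) = stream_space (expo l)"
proof -
  let ?S = "stream_space (expo l)" and ?B = "stream_space borel :: real stream measure"
  have m: "sets ?S = sets ?B" by (auto intro!: sets_stream_space_cong)
  note m [measurable_cong]
  let ?D = "\<lambda>y. to_stream (gaps (\<lambda>i. y !! i))"
  have D [measurable]: "?D \<in> measurable ?B ?B"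
  proof (rule measurable_stream_space2)
    show "(\<lambda>y. ?D y !! n) \<in> borel_measurable ?B" for n
      by (cases n) (simp_all add: to_stream_def gaps_def del: snth.simps(2))
  qed
  have E_stream [measurable]: "(\<lambda>\<omega>. to_stream (\<lambda>i. E i \<omega>)) \<in> measurable M ?B"
    by (rule measurable_stream_space2) (simp add: to_stream_def)
  have psum_stream [measurable]: "(\<lambda>\<omega>. to_stream (\<lambda>i. psum i \<omega>)) \<in> measurable ?S ?B"
    by (rule measurable_stream_space2) (simp add: to_stream_def)
  have snth: "(\<lambda>i. to_stream f !! i) = f" for f :: "nat \<Rightarrow> real" by (simp add: to_stream_def)
  have "distr M ?S (\<lambda>\<omega>. to_stream (gaps (\<lambda>i. E i \<omega>))) = distr M ?B (?D \<circ> (\<lambda>\<omega>. to_stream (\<lambda>i. E i \<omega>)))"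
    using m by (intro distr_cong) (simp_all only: o_def snth)
  also have "\<dots> = distr (distr M ?B (\<lambda>\<omega>. to_stream (\<lambda>i. E i \<omega>))) ?B ?D"
    by (rule distr_distr[symmetric]) measurable
  also have "\<dots> = distr (distr ?S ?B (\<lambda>\<omega>. to_stream (\<lambda>i. psum i \<omega>))) ?B ?D"
    by (simp only: poisson_stream_law[OF M E l grid])
  also have "\<dots> = distr ?S ?B (?D \<circ> (\<lambda>\<omega>. to_stream (\<lambda>i. psum i \<omega>)))"
    by (rule distr_distr) measurable
  also have "\<dots> = distr ?S ?S (\<lambda>\<omega>. \<omega>)"
    using m by (intro distr_cong) (simp_all only: o_def snth gaps_psum)
  finally show ?thesis by simp
qed

section \<open>Time change\<close>

lemma downset_iff_less_card:
  fixes S :: "nat set"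
  assumes "finite S" and down: "\<And>i j. j \<in> S \<Longrightarrow> i \<le> j \<Longrightarrow> i \<in> S"
  shows "i < card S \<longleftrightarrow> i \<in> S"
proof -
  obtain n where n: "n \<notin> S" using assms(1) ex_new_if_finite infinite_UNIV_nat by blast
  define m where "m = (LEAST n. n \<notin> S)"
  have "m \<notin> S" unfolding m_def using n by (rule LeastI)
  moreover have "i \<in> S" if "i < m" for i using that not_less_Least unfolding m_def by blast
  ultimately have "S = {..<m}" using down by (auto intro: leI)
  then show ?thesis by simp
qed

lemma poisson_arrivals_paths:
  assumes "poisson_arrivals M lam T" "\<omega> \<in> space M"
  shows "0 < T i \<omega>" "incseq (\<lambda>i. T i \<omega>)" "T i \<omega> \<noteq> \<infinity> \<Longrightarrow> T i \<omega> < T (Suc i) \<omega>"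
    and "finite {i. T i \<omega> \<le> ereal t}"
proof -
  show "incseq (\<lambda>i. T i \<omega>)"
  proof (rule incseq_SucI)
    fix i show "T i \<omega> \<le> T (Suc i) \<omega>"
      using assms unfolding poisson_arrivals_def by (cases "T i \<omega> = \<infinity>") (auto intro: less_imp_le)
  qed
qed (use assms in \<open>auto simp: poisson_arrivals_def\<close>)

text \<open>The arrival times increase, so the indices counted by \<open>arr_count\<close> form an
  initial segment of the naturals.\<close>

lemma less_arr_count_iff:
  assumes "poisson_arrivals M lam T" "\<omega> \<in> space M"
  shows "i < arr_count (\<lambda>i. T i \<omega>) t \<longleftrightarrow> T i \<omega> \<le> ereal t"
proof -
  let ?S = "{i. T i \<omega> \<le> ereal t}"
  have down: "i \<in> {i. T i \<omega> \<le> ereal t}" if "j \<in> {i. T i \<omega> \<le> ereal t}" "i \<le> j" for i j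
  proof -
    have "T i \<omega> \<le> T j \<omega>" using poisson_arrivals_paths(2)[OF assms] that(2) by (rule incseqD)
    then show ?thesis using that(1) by simp
  qed
  have "i < card ?S \<longleftrightarrow> i \<in> ?S"
    using poisson_arrivals_paths(4)[OF assms] down by (rule downset_iff_less_card)
  then show ?thesis by (simp add: arr_count_def)
qed

lemma arr_count_nonpos:
  assumes "poisson_arrivals M lam T" "\<omega> \<in> space M"
  shows "arr_count (\<lambda>i. T i \<omega>) 0 = 0"
proof -
  have "\<not> T 0 \<omega> \<le> ereal 0"
    using poisson_arrivals_paths(1)[OF assms, of 0] by (simp add: zero_ereal_def[symmetric] not_le)
  then show ?thesis using less_arr_count_iff[OF assms, of 0 0] by simp
qed

lemma poisson_arrivals_prob:
  assumes P: "poisson_arrivals M lam T" and t: "0 < t"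
  shows "measure M {\<omega> \<in> space M. arr_count (\<lambda>i. T i \<omega>) t = m} = pois (LBINT s=0..t. lam s) m"
proof -
  have *: "\<And>t :: nat \<Rightarrow> real. 0 \<le> t 0 \<and> (\<forall>k<1. t k < t (Suc k)) \<Longrightarrow>
        (\<forall>k<1. \<forall>m::nat.
           measure M {\<omega>\<in>space M. arr_count (\<lambda>i. T i \<omega>) (t (Suc k)) - arr_count (\<lambda>i. T i \<omega>) (t k) = m}
           = (LBINT s=t k..t (Suc k). lam s) ^ m / fact m * exp (- (LBINT s=t k..t (Suc k). lam s)))"
    using P unfolding poisson_arrivals_def by blast
  have "measure M {\<omega>\<in>space M. arr_count (\<lambda>i. T i \<omega>) t - arr_count (\<lambda>i. T i \<omega>) 0 = m}
           = (LBINT s=0..t. lam s) ^ m / fact m * exp (- (LBINT s=0..t. lam s))"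
    using *[of "\<lambda>k. if k = 0 then 0 else t"] t by (simp add: zero_ereal_def)
  moreover have "{\<omega>\<in>space M. arr_count (\<lambda>i. T i \<omega>) t - arr_count (\<lambda>i. T i \<omega>) 0 = m}
      = {\<omega> \<in> space M. arr_count (\<lambda>i. T i \<omega>) t = m}"
    using arr_count_nonpos[OF P] by auto
  ultimately show ?thesis by (simp add: pois_def)
qed

lemma arr_count_measurable:
  assumes P: "poisson_arrivals M lam T"
  shows "(\<lambda>\<omega>. arr_count (\<lambda>i. T i \<omega>) t) \<in> measurable M (count_space UNIV)"
proof -
  have [measurable]: "T i \<in> borel_measurable M" for i using P by (simp add: poisson_arrivals_def)
  have eq_iff: "a = m \<longleftrightarrow> (\<forall>i. i < m \<longleftrightarrow> i < a)" for a m :: nat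
    by (metis less_irrefl linorder_neqE_nat)
  have "(\<lambda>\<omega>. arr_count (\<lambda>i. T i \<omega>) t) -` {m} \<inter> space M =
      {\<omega> \<in> space M. \<forall>i. i < m \<longleftrightarrow> T i \<omega> \<le> ereal t}" for m
  proof -
    have "arr_count (\<lambda>i. T i \<omega>) t = m \<longleftrightarrow> (\<forall>i. i < m \<longleftrightarrow> T i \<omega> \<le> ereal t)" if "\<omega> \<in> space M" for \<omega>
      unfolding eq_iff[of "arr_count (\<lambda>i. T i \<omega>) t"] less_arr_count_iff[OF P that] ..
    then show ?thesis by auto
  qed
  moreover have "{\<omega> \<in> space M. \<forall>i. i < m \<longleftrightarrow> T i \<omega> \<le> ereal t} \<in> sets M" for m
    by measurable
  ultimately show ?thesis by (intro measurable_count_space_eq2_countable[THEN iffD2]) auto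
qed

text \<open>Zero mean makes the count 0 with probability 1. Applied to the stretch on which the
  clock still shows 0, and to rates whose integral vanishes altogether.\<close>

lemma poisson_arrivals_none:
  assumes M: "prob_space M" and P: "poisson_arrivals M lam T" and t: "0 \<le> t" and zero: "(LBINT s=0..t. lam s) = 0"
  shows "AE \<omega> in M. \<forall>i. ereal t < T i \<omega>"
proof (cases "t = 0")
  case True
  then show ?thesis
    using poisson_arrivals_paths(1)[OF P] by (auto simp: zero_ereal_def[symmetric] intro!: AE_I2)
next
  case False
  interpret prob_space M by fact
  have "prob {\<omega> \<in> space M. arr_count (\<lambda>i. T i \<omega>) t = 0} = 1"
    using False t by (subst poisson_arrivals_prob[OF P]) (simp_all add: zero pois_def)
  moreover have [measurable]: "(\<lambda>\<omega>. arr_count (\<lambda>i. T i \<omega>) t) \<in> measurable M (count_space UNIV)"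
    by (rule arr_count_measurable[OF P])
  have "{\<omega> \<in> space M. arr_count (\<lambda>i. T i \<omega>) t = 0} \<in> sets M" by measurable
  ultimately have "AE \<omega> in M. arr_count (\<lambda>i. T i \<omega>) t = 0"
    by (simp add: prob_Collect_eq_1)
  then show ?thesis using AE_space
  proof eventually_elim
    case (elim \<omega>)
    have "\<not> T i \<omega> \<le> ereal t" for i using elim(1) less_arr_count_iff[OF P elim(2), of i t] by simp
    then show ?case by (simp add: not_le)
  qed
qed

lemma pois_tendsto_0: "((\<lambda>r. pois r m) \<longlongrightarrow> 0) at_top"
proof -
  have "((\<lambda>r::real. (1 / fact m) * (r ^ m / exp r)) \<longlongrightarrow> (1 / fact m) * 0) at_top"
    by (intro tendsto_mult tendsto_const tendsto_power_div_exp_0)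
  moreover have "(1 / fact m) * (r ^ m / exp r) = pois r m" for r :: real
    by (simp add: pois_def exp_minus divide_inverse)
  ultimately show ?thesis by simp
qed

text \<open>A path with \<open>T i = \<infinity>\<close> has at most \<open>i\<close> arrivals up to
  any time, and the Poisson probability of this tends to 0 as the mean grows.\<close>

lemma poisson_arrivals_infinite:
  assumes M: "prob_space M" and P: "poisson_arrivals M lam T"
    and unb: "\<And>y. \<exists>t>0. y \<le> (LBINT s=0..ereal t. lam s)"
  shows "AE \<omega> in M. \<forall>i. T i \<omega> \<noteq> \<infinity>"
proof -
  interpret prob_space M by fact
  have [measurable]: "T i \<in> borel_measurable M" for i using P by (simp add: poisson_arrivals_def)
  have "AE \<omega> in M. T i \<omega> \<noteq> \<infinity>" for i
  proof -
    let ?A = "{\<omega> \<in> space M. T i \<omega> = \<infinity>}"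
    have A: "?A \<in> sets M" by measurable
    have bound: "prob ?A \<le> e" if e: "0 < e" for e
    proof -
      have "((\<lambda>r. \<Sum>m\<le>i. pois r m) \<longlongrightarrow> (\<Sum>m\<le>i. 0)) at_top"
        by (intro tendsto_sum pois_tendsto_0)
      then have "\<forall>\<^sub>F r in at_top. (\<Sum>m\<le>i. pois r m) < e"
        using e by (intro order_tendstoD(2)) auto
      then obtain y where y: "\<And>r. y \<le> r \<Longrightarrow> (\<Sum>m\<le>i. pois r m) < e"
        unfolding eventually_at_top_linorder by blast
      obtain t where t: "0 < t" "y \<le> (LBINT s=0..ereal t. lam s)" using unb by blast
      have [measurable]: "(\<lambda>\<omega>. arr_count (\<lambda>i. T i \<omega>) t) \<in> measurable M (count_space UNIV)"
        by (rule arr_count_measurable[OF P])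
      have "?A \<subseteq> (\<Union>m\<in>{..i}. {\<omega> \<in> space M. arr_count (\<lambda>i. T i \<omega>) t = m})"
      proof safe
        fix \<omega> assume "\<omega> \<in> space M" "T i \<omega> = \<infinity>"
        then show "\<omega> \<in> (\<Union>m\<in>{..i}. {\<omega> \<in> space M. arr_count (\<lambda>i. T i \<omega>) t = m})"
          using less_arr_count_iff[OF P, of \<omega> i t] by auto
      qed
      then have "prob ?A \<le> prob (\<Union>m\<in>{..i}. {\<omega> \<in> space M. arr_count (\<lambda>i. T i \<omega>) t = m})"
        by (rule finite_measure_mono) measurable
      also have "\<dots> \<le> (\<Sum>m\<in>{..i}. prob {\<omega> \<in> space M. arr_count (\<lambda>i. T i \<omega>) t = m})"
        by (rule finite_measure_subadditive_finite) (auto, measurable)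
      also have "\<dots> = (\<Sum>m\<le>i. pois (LBINT s=0..t. lam s) m)"
        by (simp add: poisson_arrivals_prob[OF P t(1)])
      also have "\<dots> < e" using t(2) by (rule y)
      finally show ?thesis by simp
    qed
    have "prob ?A \<le> 0" by (rule field_le_epsilon) (simp add: bound)
    then have "prob ?A = 0" using measure_nonneg[of M ?A] by linarith
    then show ?thesis using A by (simp add: prob_eq_0)
  qed
  then show ?thesis by (simp add: AE_all_countable)
qed

text \<open>\<open>A\<close> may be constant on intervals. Only the last time at which it shows
  \<open>y\<close>, the supremum of a closed bounded sublevel set, turns \<open>A t \<le> y\<close>
  into \<open>t \<le> r\<close>; the intermediate value theorem shows that the level is
  attained.\<close>

lemma continuous_time_change_inverse:
  fixes A :: "real \<Rightarrow> real"
  assumes cont: "continuous_on {0..} A" and A0: "A 0 = 0"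
    and mono: "\<And>s t. 0 \<le> s \<Longrightarrow> s \<le> t \<Longrightarrow> A s \<le> A t" and unb: "\<And>y. \<exists>t\<ge>0. y < A t" and y: "0 \<le> y"
  obtains r where "0 \<le> r" "A r = y" "\<And>t. 0 \<le> t \<Longrightarrow> A t \<le> y \<longleftrightarrow> t \<le> r"
proof -
  obtain b where b: "0 \<le> b" "y < A b" using unb by blast
  define S where "S = {t \<in> {0..}. A t \<le> y}"
  have bS: "t \<le> b" if "t \<in> S" for t
  proof (rule ccontr)
    assume "\<not> t \<le> b"
    then have "A b \<le> A t" using b by (intro mono) auto
    then show False using that b by (simp add: S_def)
  qed
  have "closed S"
    unfolding S_def using cont by (intro closed_Collect_le continuous_on_closed_Collect_le) auto
  moreover have "S \<noteq> {}" using A0 y by (auto simp: S_def intro!: exI[of _ 0])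
  moreover have bdd: "bdd_above S" using bS by (auto simp: bdd_above_def)
  ultimately have S: "Sup S \<in> S" by (intro closed_contains_Sup)
  let ?r = "Sup S"
  have r0: "0 \<le> ?r" and ry: "A ?r \<le> y" using S by (auto simp: S_def)
  have "\<exists>t\<ge>?r. t \<le> b \<and> A t = y"
    using ry b bS[OF S] r0 by (intro IVT' continuous_on_subset[OF cont]) auto
  then obtain t where t: "?r \<le> t" "A t = y" by blast
  then have "t \<in> S" using r0 by (auto simp: S_def)
  then have "t \<le> ?r" using bdd by (rule cSup_upper)
  then have Ar: "A ?r = y" using t by simp
  have "A t \<le> y \<longleftrightarrow> t \<le> ?r" if "0 \<le> t" for t
    using that mono[of t ?r] Ar cSup_upper[OF _ bdd, of t] by (auto simp: S_def)
  then show thesis using that[OF r0 Ar] by blast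
qed

section \<open>The clock of a bounded rate\<close>

locale bounded_rate =
  fixes lam :: "real \<Rightarrow> real" and l :: real
  assumes lam_borel [measurable]: "lam \<in> borel_measurable borel"
    and lam_nonneg: "\<And>t. 0 \<le> lam t" and lam_le: "\<And>t. lam t \<le> l" and l_pos: "0 < l"
begin

definition clock :: "real \<Rightarrow> real" where
  "clock t = (LBINT s=0..ereal t. lam s) / l"

lemma set_integrable_lam: "set_integrable lborel {a..b} lam"
  unfolding set_integrable_def using lam_nonneg lam_le
  by (intro integrableI_bounded_set_indicator[where B = l]) (auto simp: emeasure_lborel_Icc_eq)

lemma lam_integral_diff:
  assumes "0 \<le> s" "s \<le> t"
  shows "(LBINT x=ereal s..ereal t. lam x) = l * (clock t - clock s)"
proof -
  have "interval_lebesgue_integrable lborel (ereal a) (ereal b) lam" if "a \<le> b" for a b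
  proof -
    have "set_integrable lborel {a<..<b} lam"
      by (rule set_integrable_subset[OF set_integrable_lam[of a b]]) auto
    then show ?thesis using that by (simp add: interval_lebesgue_integrable_def einterval_eq)
  qed
  then have "(LBINT x=ereal 0..ereal s. lam x) + (LBINT x=ereal s..ereal t. lam x) = (LBINT x=ereal 0..ereal t. lam x)"
    using assms by (intro interval_integral_sum) (simp add: min_def max_def)
  then show ?thesis using l_pos by (simp add: clock_def zero_ereal_def right_diff_distrib)
qed

lemma lam_integral_bounds:
  assumes "s \<le> t"
  shows "0 \<le> (LBINT x=ereal s..ereal t. lam x)" "(LBINT x=ereal s..ereal t. lam x) \<le> l * (t - s)"
proof -
  have eq: "(LBINT x=ereal s..ereal t. lam x) = (LBINT x:{s..t}. lam x)"
    using assms by (rule interval_integral_Icc)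
  show "0 \<le> (LBINT x=ereal s..ereal t. lam x)"
    unfolding eq using lam_nonneg by (simp add: set_lebesgue_integral_def)
  have "(LBINT x:{s..t}. lam x) \<le> (LBINT x:{s..t}. l)"
    using lam_le by (intro set_integral_mono set_integrable_lam borel_integrable_atLeastAtMost') auto
  also have "\<dots> = l * (t - s)" using assms by (simp add: set_lebesgue_integral_def)
  finally show "(LBINT x=ereal s..ereal t. lam x) \<le> l * (t - s)" unfolding eq .
qed

lemma clock_0: "clock 0 = 0" by (simp add: clock_def zero_ereal_def[symmetric])

lemma clock_mono: "0 \<le> s \<Longrightarrow> s \<le> t \<Longrightarrow> clock s \<le> clock t"
  using lam_integral_bounds(1)[of s t] lam_integral_diff[of s t] l_pos by (simp add: zero_le_mult_iff)

lemma clock_diff_le: "0 \<le> s \<Longrightarrow> s \<le> t \<Longrightarrow> clock t - clock s \<le> t - s"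
  using lam_integral_bounds(2)[of s t] lam_integral_diff[of s t] l_pos by simp

lemma clock_nonneg: "0 \<le> t \<Longrightarrow> 0 \<le> clock t"
  using clock_mono[of 0 t] clock_0 by simp

lemma clock_continuous: "continuous_on {0..} clock"
proof (rule lipschitz_on_continuous_on)
  show "1-lipschitz_on {0..} clock"
  proof (rule lipschitz_onI)
    fix s t :: real assume "s \<in> {0..}" "t \<in> {0..}"
    then show "dist (clock s) (clock t) \<le> 1 * dist s t"
      using clock_mono[of s t] clock_mono[of t s] clock_diff_le[of s t] clock_diff_le[of t s]
      by (cases "s \<le> t") (auto simp: dist_real_def)
  qed simp
qed

lemma clock_measurable:
  assumes [measurable]: "f \<in> borel_measurable N" and nonneg: "\<And>\<omega>. \<omega> \<in> space N \<Longrightarrow> 0 \<le> f \<omega>"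
  shows "(\<lambda>\<omega>. clock (f \<omega>)) \<in> borel_measurable N"
proof -
  have "continuous_on UNIV (\<lambda>t. clock (max 0 t))"
    by (rule continuous_on_compose2[OF clock_continuous]) (auto intro!: continuous_intros)
  then have [measurable]: "(\<lambda>t. clock (max 0 t)) \<in> borel_measurable borel"
    by (rule borel_measurable_continuous_onI)
  have "(\<lambda>\<omega>. clock (max 0 (f \<omega>))) \<in> borel_measurable N" by measurable
  then show ?thesis using nonneg by (simp cong: measurable_cong)
qed

lemma clock_time_measurable:
  assumes P: "poisson_arrivals M lam' T"
  shows "(\<lambda>\<omega>. clock (real_of_ereal (T i \<omega>))) \<in> borel_measurable M"
proof (rule clock_measurable)
  have [measurable]: "T i \<in> borel_measurable M" using P by (simp add: poisson_arrivals_def)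
  show "(\<lambda>\<omega>. real_of_ereal (T i \<omega>)) \<in> borel_measurable M" by measurable
  show "0 \<le> real_of_ereal (T i \<omega>)" if "\<omega> \<in> space M" for \<omega>
    using poisson_arrivals_paths(1)[OF P that, of i] by (simp add: real_of_ereal_pos less_imp_le)
qed

lemma arrivals_finite:
  assumes M: "prob_space M" and P: "poisson_arrivals M lam T"
    and unb: "\<And>y. \<exists>t\<ge>0. y < clock t"
  shows "AE \<omega> in M. \<forall>i. T i \<omega> \<noteq> \<infinity>"
proof (rule poisson_arrivals_infinite[OF M P])
  fix y
  obtain t where t: "0 \<le> t" "max (y / l) 0 < clock t" using unb by blast
  then have "t \<noteq> 0" using clock_0 by auto
  moreover have "y \<le> (LBINT s=0..ereal t. lam s)"
    using t(2) l_pos by (simp add: clock_def divide_less_cancel)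
  ultimately show "\<exists>t>0. y \<le> (LBINT s=0..ereal t. lam s)" using t(1) by (intro exI[of _ t]) simp
qed

text \<open>The grid is pulled back to times at which the clock shows multiples of
  \<open>\<delta>\<close>. The mean count of a pulled-back cell is \<open>l\<close> times the clock
  increment, hence \<open>l * \<delta>\<close> whatever the rate.\<close>

lemma poisson_increments_clock:
  assumes M: "prob_space M" and P: "poisson_arrivals M lam T"
    and unb: "\<And>y. \<exists>t\<ge>0. y < clock t" and \<delta>: "0 < \<delta>"
  shows "\<exists>C. poisson_increments M l (\<lambda>i \<omega>. clock (real_of_ereal (T i \<omega>))) \<delta> C"
proof -
  interpret prob_space M by fact
  have "\<exists>r. 0 \<le> r \<and> clock r = y \<and> (\<forall>t\<ge>0. clock t \<le> y \<longleftrightarrow> t \<le> r)" if "0 \<le> y" for y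
    using continuous_time_change_inverse[OF clock_continuous clock_0 clock_mono unb that] by metis
  then obtain inv where inv: "\<And>y. 0 \<le> y \<Longrightarrow> 0 \<le> inv y" "\<And>y. 0 \<le> y \<Longrightarrow> clock (inv y) = y"
    "\<And>y t. 0 \<le> y \<Longrightarrow> 0 \<le> t \<Longrightarrow> clock t \<le> y \<longleftrightarrow> t \<le> inv y"
    by metis
  \<comment> \<open>Starting at 0 instead of \<open>inv 0\<close> lets the counts sum to
    \<open>arr_count\<close> on every path.\<close>
  define \<tau> where "\<tau> k = (if k = 0 then 0 else inv (real k * \<delta>))" for k :: nat
  have \<tau>0: "0 \<le> \<tau> k" for k using inv(1) \<delta> by (simp add: \<tau>_def)
  have clock_\<tau>: "clock (\<tau> k) = real k * \<delta>" for k using inv(2) \<delta> clock_0 by (simp add: \<tau>_def)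
  have \<tau>_less: "\<tau> k < \<tau> (Suc k)" for k
  proof (rule ccontr)
    assume "\<not> \<tau> k < \<tau> (Suc k)"
    then have "clock (\<tau> (Suc k)) \<le> clock (\<tau> k)" using \<tau>0 by (intro clock_mono) auto
    then show False using \<delta> by (simp add: clock_\<tau> algebra_simps)
  qed
  define C where "C = (\<lambda>k \<omega>. arr_count (\<lambda>i. T i \<omega>) (\<tau> (Suc k)) - arr_count (\<lambda>i. T i \<omega>) (\<tau> k))"
  have "0 \<le> \<tau> 0 \<and> (\<forall>k<n. \<tau> k < \<tau> (Suc k)) \<longrightarrow> indep_vars (\<lambda>_. count_space UNIV) C {..<n} \<and>
      (\<forall>k<n. \<forall>m. prob {\<omega>\<in>space M. C k \<omega> = m} = (LBINT s=\<tau> k..\<tau> (Suc k). lam s) ^ m / fact m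
         * exp (- (LBINT s=\<tau> k..\<tau> (Suc k). lam s)))"
    for n
    using P[unfolded poisson_arrivals_def, THEN conjunct2, THEN conjunct2, THEN spec[of _ n], THEN spec[of _ \<tau>]]
    unfolding C_def .
  then have fdd: "indep_vars (\<lambda>_. count_space UNIV) C {..<n} \<and>
      (\<forall>k<n. \<forall>m. prob {\<omega>\<in>space M. C k \<omega> = m} = (LBINT s=\<tau> k..\<tau> (Suc k). lam s) ^ m / fact m
         * exp (- (LBINT s=\<tau> k..\<tau> (Suc k). lam s)))" for n
    using \<tau>0 \<tau>_less by simp
  have C_sum: "(\<Sum>k<j. C k \<omega>) = arr_count (\<lambda>i. T i \<omega>) (\<tau> j)" if \<omega>: "\<omega> \<in> space M" for j \<omega>
  proof (induction j)
    case 0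
    then show ?case using arr_count_nonpos[OF P \<omega>] by (simp add: \<tau>_def)
  next
    case (Suc j)
    have "arr_count (\<lambda>i. T i \<omega>) (\<tau> j) \<le> arr_count (\<lambda>i. T i \<omega>) (\<tau> (Suc j))"
      unfolding arr_count_def using \<tau>_less[of j] poisson_arrivals_paths(4)[OF P \<omega>]
      by (intro card_mono) (auto intro: order_trans)
    then show ?case using Suc by (simp add: C_def)
  qed
  have fin: "AE \<omega> in M. \<forall>i. T i \<omega> \<noteq> \<infinity>" by (rule arrivals_finite[OF M P unb])
  \<comment> \<open>Level \<open>j = 0\<close> asks for a positive clock at every arrival, but the
    clock is 0 up to \<open>inv 0\<close>; arrivals in that stretch have probability 0.\<close>
  have none: "AE \<omega> in M. \<forall>i. ereal (inv 0) < T i \<omega>"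
  proof (rule poisson_arrivals_none[OF M P])
    show "(LBINT s=0..ereal (inv 0). lam s) = 0" using inv(2)[of 0] l_pos by (simp add: clock_def)
  qed (use inv(1) in simp)
  have "poisson_increments M l (\<lambda>i \<omega>. clock (real_of_ereal (T i \<omega>))) \<delta> C"
    unfolding poisson_increments_def
  proof (intro conjI allI)
    show "indep_vars (\<lambda>_. count_space UNIV) C {..<J}" for J using fdd by blast
    show "prob {\<omega> \<in> space M. C k \<omega> = m} = pois (l * \<delta>) m" for k m
    proof -
      have "(LBINT s=\<tau> k..\<tau> (Suc k). lam s) = l * \<delta>"
        using \<tau>_less[of k] \<tau>0[of k] by (simp add: lam_integral_diff clock_\<tau> algebra_simps)
      then show ?thesis using fdd[of "Suc k"] by (simp add: pois_def)
    qed
    show "AE \<omega> in M. \<forall>i j. clock (real_of_ereal (T i \<omega>)) \<le> real j * \<delta> \<longleftrightarrow> i < (\<Sum>k<j. C k \<omega>)"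
      using fin none AE_space
    proof eventually_elim
      case (elim \<omega>)
      show ?case
      proof (intro allI)
        fix i j
        obtain t where t: "T i \<omega> = ereal t" "0 < t" "inv 0 < t"
        proof -
          have "0 < T i \<omega>" using poisson_arrivals_paths(1)[OF P elim(3)] .
          then show thesis using that elim(1,2) by (cases "T i \<omega>") (auto dest: spec[of _ i])
        qed
        show "clock (real_of_ereal (T i \<omega>)) \<le> real j * \<delta> \<longleftrightarrow> i < (\<Sum>k<j. C k \<omega>)"
        proof (cases "j = 0")
          case True
          then show ?thesis using inv(3)[of 0 t] t by simp
        next
          case False
          then show ?thesis
            using t inv(3)[of "real j * \<delta>" t] \<delta>
            by (simp add: C_sum[OF elim(3)] less_arr_count_iff[OF P elim(3)] \<tau>_def)
        qed
      qed
    qed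
  qed
  then show ?thesis by blast
qed

lemma clock_gaps_law:
  assumes M: "prob_space M" and P: "poisson_arrivals M lam T"
    and unb: "\<And>y. \<exists>t\<ge>0. y < clock t"
  shows "distr M (stream_space (expo l)) (\<lambda>\<omega>. to_stream (gaps (\<lambda>i. clock (real_of_ereal (T i \<omega>)))))
    = stream_space (expo l)"
  by (rule poisson_gaps_law[OF M clock_time_measurable[OF P] l_pos poisson_increments_clock[OF M P unb]])

end

text \<open>Every period contributes the same integral, so on nonnegative times the clock is either
  unbounded or constantly 0; these are the two cases of \<open>eta_star_tail_le\<close>.\<close>

lemma (in bounded_rate) clock_periodic:
  assumes k: "0 < \<kappa>" and per: "\<And>t. lam (t + \<kappa>) = lam t"
  shows "clock (real n * \<kappa>) = real n * clock \<kappa>"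
proof (induction n)
  case (Suc n)
  have shift: "lam (x + real n * \<kappa>) = lam x" for x
  proof (induction n)
    case (Suc n)
    have "lam (x + real (Suc n) * \<kappa>) = lam ((x + real n * \<kappa>) + \<kappa>)" by (simp add: algebra_simps)
    then show ?case using Suc per by simp
  qed simp
  have "(LBINT x:{real n * \<kappa>..real (Suc n) * \<kappa>}. lam x) = (\<integral>x. indicator {real n * \<kappa>..real (Suc n) * \<kappa>} (real n * \<kappa> + 1 * x) * lam (real n * \<kappa> + 1 * x) \<partial>lborel)"
    unfolding set_lebesgue_integral_def
    by (subst lborel_integral_real_affine[of 1 _ "real n * \<kappa>"]) simp_all
  also have "\<dots> = (LBINT x:{0..\<kappa>}. lam x)"
    unfolding set_lebesgue_integral_def
    using shift by (intro Bochner_Integration.integral_cong) (auto simp: indicator_def algebra_simps)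
  finally have "l * (clock (real (Suc n) * \<kappa>) - clock (real n * \<kappa>)) = l * (clock \<kappa> - clock 0)"
    using k by (simp only: lam_integral_diff[symmetric] interval_integral_Icc) (simp add: lam_integral_diff[symmetric] interval_integral_Icc mult_right_mono)
  then have "clock (real (Suc n) * \<kappa>) - clock (real n * \<kappa>) = clock \<kappa> - clock 0"
    using l_pos by simp
  then show ?case using Suc clock_0 by (simp add: algebra_simps)
qed (simp add: clock_0)

section \<open>Pathwise comparison\<close>

primrec lindley :: "real stream \<Rightarrow> real stream \<Rightarrow> nat \<Rightarrow> real" where
  "lindley x s 0 = 0"
| "lindley x s (Suc i) = max 0 (lindley x s i + s !! i - x !! Suc i)"

text \<open>Unrolls \<open>surv\<close> into one inequality per gap along the path of
  \<open>lindley\<close>; the offset \<open>i\<close> is general because each unrolling shifts both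
  streams.\<close>

lemma surv_sdrop:
  "surv \<kappa> k (lindley x s i + s !! i) (sdrop (Suc i) x) (sdrop (Suc i) s)
     \<longleftrightarrow> (\<forall>n<k. x !! Suc (i + n) < lindley x s (i + n) + s !! (i + n) + \<kappa>)"
proof (induction k arbitrary: i)
  case (Suc k)
  have shd: "shd (sdrop (Suc i) y) = y !! Suc i" and stl: "stl (sdrop (Suc i) y) = sdrop (Suc (Suc i)) y"
    for y :: "real stream" by (rule sdrop_simps)+
  have "surv \<kappa> (Suc k) (lindley x s i + s !! i) (sdrop (Suc i) x) (sdrop (Suc i) s)
    \<longleftrightarrow> x !! Suc i < lindley x s i + s !! i + \<kappa> \<and>
      surv \<kappa> k (lindley x s (Suc i) + s !! Suc i) (sdrop (Suc (Suc i)) x) (sdrop (Suc (Suc i)) s)"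
    unfolding surv.simps shd stl by simp
  also have "\<dots> \<longleftrightarrow> x !! Suc i < lindley x s i + s !! i + \<kappa> \<and>
     (\<forall>n<k. x !! Suc (Suc i + n) < lindley x s (Suc i + n) + s !! (Suc i + n) + \<kappa>)"
    unfolding Suc.IH ..
  also have "\<dots> \<longleftrightarrow> (\<forall>n<Suc k. x !! Suc (i + n) < lindley x s (i + n) + s !! (i + n) + \<kappa>)"
    by (auto simp: All_less_Suc2)
  finally show ?case .
qed simp

lemma surv_stl:
  "surv \<kappa> k (shd s) (stl x) (stl s) \<longleftrightarrow> (\<forall>n<k. x !! Suc n < lindley x s n + s !! n + \<kappa>)"
  using surv_sdrop[of \<kappa> k x s 0] by simp

lemma busy_count_greater_iff:
  "busy_count T S Y > ereal u \<longleftrightarrow>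
    (\<forall>n\<ge>1. real n \<le> u \<longrightarrow> T n = \<infinity> \<or> wl_before T S Y n \<noteq> 0)"
proof (cases "\<exists>n::nat. 1 \<le> n \<and> T n \<noteq> \<infinity> \<and> wl_before T S Y n = 0")
  case True
  let ?P = "\<lambda>n::nat. 1 \<le> n \<and> T n \<noteq> \<infinity> \<and> wl_before T S Y n = 0"
  have L: "?P (LEAST n. ?P n)" using True by (rule LeastI_ex)
  have "u < real (LEAST n. ?P n) \<longleftrightarrow> (\<forall>n. ?P n \<longrightarrow> u < real n)"
  proof
    assume "u < real (LEAST n. ?P n)"
    then show "\<forall>n. ?P n \<longrightarrow> u < real n"
      using Least_le[of ?P] by (meson less_le_trans of_nat_le_iff)
  qed (use L in blast)
  also have "\<dots> \<longleftrightarrow> (\<forall>n\<ge>1. real n \<le> u \<longrightarrow> T n = \<infinity> \<or> wl_before T S Y n \<noteq> 0)"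
    by (metis leD not_less)
  finally show ?thesis using True unfolding busy_count_def by simp
next
  case False
  then show ?thesis unfolding busy_count_def by auto
qed

text \<open>Infinite \<open>Y\<close> means that nobody balks, so \<open>wl_before\<close> is
  Lindley's recursion; for \<open>\<kappa> = 0\<close> a gap shorter than the work present means
  that the next customer finds the server busy.\<close>

lemma busy_count_surv_iff:
  assumes T: "\<And>i. T i = ereal (\<tau> i)" and Y: "\<And>i. Y i = \<infinity>"
    and x: "\<And>i. x !! Suc i = \<tau> (Suc i) - \<tau> i" and s: "\<And>i. s !! i = S i"
  shows "busy_count T S Y > ereal u \<longleftrightarrow> surv 0 (nat \<lfloor>u\<rfloor>) (shd s) (stl x) (stl s)"
proof -
  have W: "wl_before T S Y n = lindley x s n" for n
    by (induction n) (simp_all add: T Y x s del: snth.simps(2))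
  have "busy_count T S Y > ereal u \<longleftrightarrow> (\<forall>n\<ge>1. real n \<le> u \<longrightarrow> lindley x s n \<noteq> 0)"
    unfolding busy_count_greater_iff W by (simp add: T)
  also have "\<dots> \<longleftrightarrow> (\<forall>n<nat \<lfloor>u\<rfloor>. lindley x s (Suc n) \<noteq> 0)"
  proof -
    have "real (Suc n) \<le> u \<longleftrightarrow> n < nat \<lfloor>u\<rfloor>" for n by linarith
    then show ?thesis by (metis One_nat_def Suc_le_D Suc_le_eq zero_less_Suc)
  qed
  also have "\<dots> \<longleftrightarrow> (\<forall>n<nat \<lfloor>u\<rfloor>. x !! Suc n < lindley x s n + s !! n + 0)"
  proof -
    have "lindley x s (Suc n) \<noteq> 0 \<longleftrightarrow> x !! Suc n < lindley x s n + s !! n + 0" for n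
      by (auto simp: max_def simp del: snth.simps(2))
    then show ?thesis by (simp only:)
  qed
  finally show ?thesis unfolding surv_stl .
qed

text \<open>Lindley's recursion is monotone in the previous workload; balking only drops a
  nonnegative service, and the gaps \<open>x\<close> are at most the real ones.\<close>

lemma wl_before_le_lindley:
  assumes T: "\<And>i. T i = ereal (\<tau> i)" and S: "\<And>i. 0 \<le> S i"
    and x: "\<And>i. x !! Suc i \<le> \<tau> (Suc i) - \<tau> i" and s: "\<And>i. s !! i = S i"
  shows "wl_before T S Y n \<le> lindley x s n"
proof (induction n)
  case (Suc n)
  then show ?case using S[of n] x[of n] by (auto simp: T s max_def simp del: snth.simps(2))
qed simp

lemma xi_le:
  assumes "1 \<le> n" "workload T S Y (kappa * real n) = 0" "0 < kappa"
  shows "xi kappa T S Y \<le> ereal (kappa * real n)"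
proof -
  have "(LEAST n. 1 \<le> n \<and> workload T S Y (kappa * real n) = 0) \<le> n"
    by (rule Least_le) (use assms in simp)
  then show ?thesis using assms unfolding xi_def by auto
qed

text \<open>The joiners up to \<open>xi\<close> are bounded by all arrivals up to \<open>xi\<close>,
  which have indices below \<open>n\<close>.\<close>

lemma eta_star_le:
  assumes "xi kappa T S Y < T n" "incseq T"
  shows "eta_star kappa T S Y \<le> ereal (real n)"
proof -
  let ?A = "{i. T i \<noteq> \<infinity> \<and> T i \<le> xi kappa T S Y \<and> joins T S Y i}"
  have A: "?A \<subseteq> {..<n}"
  proof
    fix i assume "i \<in> ?A"
    then have "T i < T n" using assms(1) by auto
    then show "i \<in> {..<n}" using incseqD[OF assms(2), of n i] by (cases "n \<le> i") auto
  qed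
  then have "finite ?A" "card ?A \<le> n"
    using finite_subset card_mono[OF finite_lessThan A] by auto
  then show ?thesis by (simp add: eta_star_def)
qed

text \<open>Every half-open interval of length \<open>kappa\<close> contains a multiple of \<open>kappa\<close>, so an idle period of that
  length ends only after \<open>xi\<close>.\<close>

lemma xi_less_of_long_idle:
  assumes T: "\<And>i. T i = ereal (\<tau> i)" and mono: "strict_mono \<tau>" and pos: "0 < \<tau> 0"
    and S: "\<And>i. 0 \<le> S i" and kappa: "0 < kappa"
    and idle: "wl_before T S Y n + S n + kappa \<le> \<tau> (Suc n) - \<tau> n"
  shows "xi kappa T S Y < T (Suc n)"
proof -
  \<comment> \<open>\<open>e\<close> is the time at which the work left by customer \<open>n\<close>
    runs out, and \<open>kappa * m\<close> is the first multiple not before it. As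
    \<open>e > 0\<close>, it has \<open>m \<ge> 1\<close>, and it precedes the next arrival.\<close>
  define e where "e = \<tau> n + wl_before T S Y n + (if joins T S Y n then S n else 0)"
  define m where "m = nat \<lceil>e / kappa\<rceil>"
  have W: "0 \<le> wl_before T S Y n" by (cases n) auto
  have "0 < \<tau> n" using pos strict_mono_mono[OF mono] by (meson less_le_trans monoD zero_le)
  then have e: "0 < e" "\<tau> n \<le> e" using W S[of n] by (auto simp: e_def)
  have "0 < e / kappa" using e kappa by simp
  then have m: "1 \<le> m" "e / kappa \<le> real m" "real m < e / kappa + 1"
    unfolding m_def by linarith+
  have em: "e \<le> kappa * real m" "kappa * real m < e + kappa"
    using m(2,3) kappa by (simp_all add: field_simps)
  have le: "e + kappa \<le> \<tau> (Suc n)" using idle S[of n] by (auto simp: e_def)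
  have G: "(GREATEST i. T i \<le> ereal (kappa * real m)) = n"
  proof (rule Greatest_equality)
    show "T n \<le> ereal (kappa * real m)" using em e by (simp add: T)
    fix i assume "T i \<le> ereal (kappa * real m)"
    then have "\<tau> i < \<tau> (Suc n)" using em le by (simp add: T)
    then show "i \<le> n" using strict_mono_less[OF mono] by simp
  qed
  have "\<exists>i. T i \<le> ereal (kappa * real m)" using em e by (auto simp: T intro!: exI[of _ n])
  then have "workload T S Y (kappa * real m)
      = max 0 (wl_before T S Y n + (if joins T S Y n then S n else 0) - (kappa * real m - \<tau> n))"
    unfolding workload_def Let_def G by (simp add: T)
  also have "\<dots> = 0" using em(1) by (simp add: e_def)
  finally have "xi kappa T S Y \<le> ereal (kappa * real m)" using xi_le m(1) kappa by blast
  also have "\<dots> < T (Suc n)" using em le by (simp add: T)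
  finally show ?thesis .
qed

text \<open>By contraposition: a violated inequality exhibits an idle period of length at least
  \<open>kappa\<close> in the dominating queue, hence in the given one, which has less work and
  longer gaps. Then \<open>xi\<close> precedes an arrival with index at most \<open>u\<close>, which
  caps \<open>eta_star\<close> at \<open>u\<close>.\<close>

lemma eta_star_imp_surv:
  assumes T: "\<And>i. T i = ereal (\<tau> i)" and mono: "strict_mono \<tau>" and pos: "0 < \<tau> 0"
    and S: "\<And>i. 0 \<le> S i" and kappa: "0 < kappa"
    and x0: "0 \<le> x !! 0" "x !! 0 \<le> \<tau> 0" "x !! 0 \<noteq> kappa"
    and x: "\<And>i. x !! Suc i \<le> \<tau> (Suc i) - \<tau> i" and s: "\<And>i. s !! i = S i"
    and u: "0 \<le> u" and eta: "eta_star kappa T S Y > ereal u"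
  shows "surv kappa (Suc (nat \<lfloor>u\<rfloor>)) 0 x s"
proof -
  have incT: "incseq T" using strict_mono_mono[OF mono] by (auto simp: incseq_def mono_def T)
  have contra: False if "xi kappa T S Y < T n" "real n \<le> u" for n
    using eta_star_le[OF that(1) incT] that(2) eta by (meson ereal_less_eq(3) leD order_trans)
  \<comment> \<open>The initial idle period starts at 0, which is no candidate for
    \<open>xi\<close>; the first candidate \<open>kappa\<close> must lie strictly before the first
    arrival. Hence the value \<open>kappa\<close> is excluded for the first gap.\<close>
  have "x !! 0 < kappa"
  proof (rule ccontr)
    assume "\<not> x !! 0 < kappa"
    then have k: "kappa < \<tau> 0" using x0 by simp
    have "\<not> T i \<le> ereal kappa" for i
      using k strict_mono_mono[OF mono] monoD[of \<tau> 0 i] by (simp add: T)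
    then have "workload T S Y (kappa * real 1) = 0" by (simp add: workload_def)
    then have "xi kappa T S Y \<le> ereal (kappa * real 1)" by (intro xi_le kappa) auto
    also have "\<dots> < T 0" using k by (simp add: T)
    finally show False using contra[of 0] u by simp
  qed
  moreover have "x !! Suc n < lindley x s n + s !! n + kappa" if n: "n < nat \<lfloor>u\<rfloor>" for n
  proof (rule ccontr)
    assume "\<not> x !! Suc n < lindley x s n + s !! n + kappa"
    then have "wl_before T S Y n + S n + kappa \<le> \<tau> (Suc n) - \<tau> n"
      using wl_before_le_lindley[OF T S x s, of Y n] x[of n] s[of n] by linarith
    then have "xi kappa T S Y < T (Suc n)"
      by (rule xi_less_of_long_idle[OF T mono pos S kappa])
    moreover have "real (Suc n) \<le> u" using n by linarith
    ultimately show False by (rule contra)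
  qed
  ultimately show ?thesis using x0(1) by (simp add: surv_stl)
qed

section \<open>Tail comparison\<close>

lemma queue_input_service:
  assumes Q: "queue_input M lam Psi T S Y"
  shows "S i \<in> borel_measurable M" "Y i \<in> borel_measurable M"
    and "prob_space.indep_vars M (\<lambda>_. borel) S UNIV"
    and "cdf (distr M borel (S i)) = (\<lambda>s. Psi s \<infinity>)"
proof -
  interpret prob_space M using Q by (simp add: queue_input_def)
  have ind: "indep_vars (\<lambda>_. borel) (\<lambda>i \<omega>. (S i \<omega>, Y i \<omega>)) UNIV" using Q by (simp add: queue_input_def)
  then have p [measurable]: "(\<lambda>\<omega>. (S i \<omega>, Y i \<omega>)) \<in> borel_measurable M" for i
    by (simp add: indep_vars_def)
  have fst: "(fst :: real \<times> ereal \<Rightarrow> real) \<in> borel_measurable borel"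
    and snd: "(snd :: real \<times> ereal \<Rightarrow> ereal) \<in> borel_measurable borel"
    by (auto intro!: borel_measurable_continuous_onI continuous_intros)
  show S [measurable]: "S i \<in> borel_measurable M" for i
    using measurable_compose[OF p fst] by simp
  show "Y i \<in> borel_measurable M"
    using measurable_compose[OF p snd] by simp
  show "indep_vars (\<lambda>_. borel) S UNIV"
    using indep_vars_compose2[OF ind, of "\<lambda>_. fst" "\<lambda>_. borel"] fst by simp
  show "cdf (distr M borel (S i)) = (\<lambda>s. Psi s \<infinity>)"
  proof
    fix s
    have "measure M {\<omega>\<in>space M. S i \<omega> \<le> s \<and> Y i \<omega> \<le> \<infinity>} = Psi s \<infinity>"
      using Q unfolding queue_input_def by blast
    moreover have "S i -` {..s} \<inter> space M = {\<omega>\<in>space M. S i \<omega> \<le> s \<and> Y i \<omega> \<le> \<infinity>}" by auto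
    ultimately show "cdf (distr M borel (S i)) s = Psi s \<infinity>" by (simp add: cdf_def measure_distr)
  qed
qed

lemma queue_input_service_distr:
  assumes Q: "queue_input M lam Psi T S Y" and D: "real_distribution D" "cdf D = (\<lambda>s. Psi s \<infinity>)"
  shows "distr M borel (S i) = D"
proof (rule cdf_unique)
  interpret prob_space M using Q by (simp add: queue_input_def)
  show "real_distribution (distr M borel (S i))"
    using queue_input_service(1)[OF Q] by (rule real_distribution_distr)
qed (use queue_input_service(4)[OF Q] D in auto)

text \<open>The clock gaps are functions of the arrival times and the services are functions of the
  marks, so the two streams are measurable for the independent sigma-algebras of the model and their
  joint law is the product of the marginals.\<close>

lemma (in bounded_rate) queue_input_law:
  assumes Q: "queue_input M lam Psi T S Y" and D: "real_distribution D" "cdf D = (\<lambda>s. Psi s \<infinity>)"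
    and unb: "\<And>y. \<exists>t\<ge>0. y < clock t"
  defines "F \<equiv> (\<lambda>\<omega>. (to_stream (gaps (\<lambda>i. clock (real_of_ereal (T i \<omega>)))), to_stream (\<lambda>i. S i \<omega>)))"
  shows "F \<in> measurable M (stream_space (expo l) \<Otimes>\<^sub>M stream_space D)"
    and "distr M (stream_space (expo l) \<Otimes>\<^sub>M stream_space D) F = stream_space (expo l) \<Otimes>\<^sub>M stream_space D"
proof -
  interpret prob_space M using Q by (simp add: queue_input_def)
  interpret D: real_distribution D by fact
  have P: "poisson_arrivals M lam T" using Q by (simp add: queue_input_def)
  let ?X = "\<lambda>\<omega>. to_stream (gaps (\<lambda>i. clock (real_of_ereal (T i \<omega>))))" and ?S = "\<lambda>\<omega>. to_stream (\<lambda>i. S i \<omega>)"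
  have sX: "sets (stream_space (expo l)) = sets (stream_space borel)"
    and sD: "sets (stream_space D) = sets (stream_space borel)"
    by (auto intro!: sets_stream_space_cong)
  define GT where "GT = {T i -` A \<inter> space M | i A. A \<in> sets borel}"
  define GS where "GS = {(\<lambda>\<omega>. (S i \<omega>, Y i \<omega>)) -` A \<inter> space M | i A. A \<in> sets borel}"
  have ind: "indep_set (sigma_sets (space M) GT) (sigma_sets (space M) GS)"
    using Q by (simp add: queue_input_def GT_def GS_def)
  have GT: "GT \<subseteq> Pow (space M)" and GS: "GS \<subseteq> Pow (space M)" by (auto simp: GT_def GS_def)
  let ?NT = "sigma (space M) GT" and ?NS = "sigma (space M) GS"
  have T_NT [measurable]: "T i \<in> borel_measurable ?NT" for i
  proof (rule measurableI)
    fix A :: "ereal set" assume "A \<in> sets borel"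
    then have "T i -` A \<inter> space M \<in> GT" by (auto simp: GT_def)
    then show "T i -` A \<inter> space ?NT \<in> sets ?NT"
      using GT by (auto simp: space_measure_of intro!: in_measure_of)
  qed simp
  have X_NT: "?X \<in> measurable ?NT (stream_space borel)"
  proof (rule measurable_stream_space2)
    have [measurable]: "(\<lambda>\<omega>. clock (real_of_ereal (T i \<omega>))) \<in> borel_measurable ?NT" for i
    proof (rule clock_measurable)
      show "(\<lambda>\<omega>. real_of_ereal (T i \<omega>)) \<in> borel_measurable ?NT" by measurable
      show "0 \<le> real_of_ereal (T i \<omega>)" if "\<omega> \<in> space ?NT" for \<omega>
        using poisson_arrivals_paths(1)[OF P, of \<omega> i] that GT
        by (simp add: space_measure_of real_of_ereal_pos less_imp_le)
    qed
    show "(\<lambda>\<omega>. ?X \<omega> !! n) \<in> borel_measurable ?NT" for n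
      by (cases n) (simp_all add: to_stream_def gaps_def del: snth.simps(2))
  qed
  have S_NS: "?S \<in> measurable ?NS (stream_space borel)"
  proof (rule measurable_stream_space2)
    fix n
    have "(\<lambda>\<omega>. (S n \<omega>, Y n \<omega>)) \<in> borel_measurable ?NS"
    proof (rule measurableI)
      fix A :: "(real \<times> ereal) set" assume "A \<in> sets borel"
      then have "(\<lambda>\<omega>. (S n \<omega>, Y n \<omega>)) -` A \<inter> space M \<in> GS" by (auto simp: GS_def)
      then show "(\<lambda>\<omega>. (S n \<omega>, Y n \<omega>)) -` A \<inter> space ?NS \<in> sets ?NS"
        using GS by (auto simp: space_measure_of intro!: in_measure_of)
    qed simp
    moreover have "(fst :: real \<times> ereal \<Rightarrow> real) \<in> borel_measurable borel"
      by (auto intro!: borel_measurable_continuous_onI continuous_intros)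
    ultimately have "(\<lambda>\<omega>. fst (S n \<omega>, Y n \<omega>)) \<in> borel_measurable ?NS" by (rule measurable_compose)
    then show "(\<lambda>\<omega>. ?S \<omega> !! n) \<in> borel_measurable ?NS" by (simp add: to_stream_def)
  qed
  have X_meas: "?X \<in> measurable M (stream_space (expo l))"
  proof -
    have [measurable]: "(\<lambda>\<omega>. clock (real_of_ereal (T i \<omega>))) \<in> borel_measurable M" for i
      by (rule clock_time_measurable[OF P])
    have "(\<lambda>\<omega>. ?X \<omega> !! n) \<in> borel_measurable M" for n
      by (cases n) (simp_all add: to_stream_def gaps_def del: snth.simps(2))
    then have "?X \<in> measurable M (stream_space borel)" by (rule measurable_stream_space2)
    then show ?thesis using sX by (simp cong: measurable_cong_sets)
  qed
  have S_meas: "?S \<in> measurable M (stream_space D)"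
  proof -
    have "?S \<in> measurable M (stream_space borel)"
      by (rule measurable_stream_space2) (simp add: to_stream_def queue_input_service(1)[OF Q])
    then show ?thesis using sD by (simp cong: measurable_cong_sets)
  qed
  have "indep_var (stream_space (expo l)) ?X (stream_space D) ?S"
    unfolding indep_var_eq
  proof (intro conjI X_meas S_meas)
    have "{?X -` A \<inter> space M | A. A \<in> sets (stream_space (expo l))} \<subseteq> sets ?NT"
      using measurable_sets[OF X_NT] GT by (auto simp: sX space_measure_of)
    then have 1: "sigma_sets (space M) {?X -` A \<inter> space M | A. A \<in> sets (stream_space (expo l))} \<subseteq> sigma_sets (space M) GT"
      using sets.sigma_sets_subset[of _ ?NT] GT by (simp add: space_measure_of sets_measure_of)
    have "{?S -` A \<inter> space M | A. A \<in> sets (stream_space D)} \<subseteq> sets ?NS"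
      using measurable_sets[OF S_NS] GS by (auto simp: sD space_measure_of)
    then have 2: "sigma_sets (space M) {?S -` A \<inter> space M | A. A \<in> sets (stream_space D)} \<subseteq> sigma_sets (space M) GS"
      using sets.sigma_sets_subset[of _ ?NS] GS by (simp add: space_measure_of sets_measure_of)
    show "indep_set (sigma_sets (space M) {?X -` A \<inter> space M | A. A \<in> sets (stream_space (expo l))})
        (sigma_sets (space M) {?S -` A \<inter> space M | A. A \<in> sets (stream_space D)})"
      using ind unfolding indep_set_def
      by (rule indep_sets_mono_sets) (use 1 2 in \<open>auto split: bool.split\<close>)
  qed
  then have "distr M (stream_space (expo l)) ?X \<Otimes>\<^sub>M distr M (stream_space D) ?S
      = distr M (stream_space (expo l) \<Otimes>\<^sub>M stream_space D) F"
    unfolding indep_var_distribution_eq F_def by blast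
  moreover have "distr M (stream_space (expo l)) ?X = stream_space (expo l)"
    by (rule clock_gaps_law[OF prob_space_axioms P unb])
  moreover have "distr M (stream_space D) ?S = stream_space D"
  proof -
    have Sm: "(\<lambda>\<omega>. \<lambda>i\<in>UNIV. S i \<omega>) \<in> measurable M (PiM UNIV (\<lambda>_. D))"
      by (rule measurable_restrict) (use queue_input_service(1)[OF Q] in simp)
    have "distr M (PiM UNIV (\<lambda>_. borel)) (\<lambda>\<omega>. \<lambda>i\<in>UNIV. S i \<omega>) = PiM UNIV (\<lambda>i. distr M borel (S i))"
      using queue_input_service(1,3)[OF Q] by (subst indep_vars_iff_distr_eq_PiM[symmetric]) auto
    moreover have "distr M (PiM UNIV (\<lambda>_. D)) (\<lambda>\<omega>. \<lambda>i\<in>UNIV. S i \<omega>)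
        = distr M (PiM UNIV (\<lambda>_. borel)) (\<lambda>\<omega>. \<lambda>i\<in>UNIV. S i \<omega>)"
      by (intro distr_cong sets_PiM_cong) auto
    ultimately have "distr M (PiM UNIV (\<lambda>_. D)) (\<lambda>\<omega>. \<lambda>i\<in>UNIV. S i \<omega>) = PiM UNIV (\<lambda>_. D)"
      unfolding queue_input_service_distr[OF Q D] by (simp only:)
    then have "stream_space D = distr (distr M (PiM UNIV (\<lambda>_. D)) (\<lambda>\<omega>. \<lambda>i\<in>UNIV. S i \<omega>)) (stream_space D) to_stream"
      using stream_space_eq_distr[of D] by simp
    also have "\<dots> = distr M (stream_space D) (to_stream \<circ> (\<lambda>\<omega>. \<lambda>i\<in>UNIV. S i \<omega>))"
      using Sm by (intro distr_distr) auto
    finally show ?thesis unfolding o_def restrict_UNIV by (rule sym)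
  qed
  ultimately show "distr M (stream_space (expo l) \<Otimes>\<^sub>M stream_space D) F = stream_space (expo l) \<Otimes>\<^sub>M stream_space D"
    by simp
  show "F \<in> measurable M (stream_space (expo l) \<Otimes>\<^sub>M stream_space D)"
    unfolding F_def using X_meas S_meas by (rule measurable_Pair)
qed

lemma measurable_wl_before:
  assumes [measurable]: "\<And>i. T i \<in> borel_measurable M" "\<And>i. S i \<in> borel_measurable M" "\<And>i. Y i \<in> borel_measurable M"
  shows "(\<lambda>\<omega>. wl_before (\<lambda>i. T i \<omega>) (\<lambda>i. S i \<omega>) (\<lambda>i. Y i \<omega>) n) \<in> borel_measurable M"
  by (induction n) simp_all

lemma measurable_busy_count_event:
  assumes [measurable]: "\<And>i. T i \<in> borel_measurable M" "\<And>i. S i \<in> borel_measurable M" "\<And>i. Y i \<in> borel_measurable M"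
  shows "{\<omega> \<in> space M. busy_count (\<lambda>i. T i \<omega>) (\<lambda>i. S i \<omega>) (\<lambda>i. Y i \<omega>) > ereal u} \<in> sets M"
proof -
  have [measurable]: "(\<lambda>\<omega>. wl_before (\<lambda>i. T i \<omega>) (\<lambda>i. S i \<omega>) (\<lambda>i. Y i \<omega>) n) \<in> borel_measurable M" for n
    by (rule measurable_wl_before) measurable
  show ?thesis unfolding busy_count_greater_iff by measurable
qed

text \<open>The cdf of the marks gives mass 0 to each box \<open>S \<le> m\<close>,
  \<open>Y \<le> n\<close>, and countably many such boxes cover the event that some \<open>Y\<close>
  is finite.\<close>

lemma queue_input_no_balking:
  assumes Q: "queue_input M lam (\<lambda>s y. if y = \<infinity> then G s else 0) T S Y"
  shows "AE \<omega> in M. \<forall>i. Y i \<omega> = \<infinity>"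
proof -
  interpret prob_space M using Q by (simp add: queue_input_def)
  note [measurable] = queue_input_service(1,2)[OF Q]
  have "AE \<omega> in M. \<not> (S i \<omega> \<le> real m \<and> Y i \<omega> \<le> ereal (real n))" for i m n
  proof -
    have "prob {\<omega>\<in>space M. S i \<omega> \<le> real m \<and> Y i \<omega> \<le> ereal (real n)} = (if ereal (real n) = \<infinity> then G (real m) else 0)"
      using Q unfolding queue_input_def by blast
    then have "prob {\<omega>\<in>space M. S i \<omega> \<le> real m \<and> Y i \<omega> \<le> ereal (real n)} = 0" by simp
    moreover have "{\<omega>\<in>space M. S i \<omega> \<le> real m \<and> Y i \<omega> \<le> ereal (real n)} \<in> events" by measurable
    ultimately show ?thesis by (simp only: prob_Collect_eq_0)
  qed
  then have "AE \<omega> in M. \<forall>i m n. \<not> (S i \<omega> \<le> real m \<and> Y i \<omega> \<le> ereal (real n))"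
    by (simp only: AE_all_countable) blast
  then show ?thesis
  proof eventually_elim
    case (elim \<omega>)
    have "Y i \<omega> = \<infinity>" for i
    proof (rule ccontr)
      assume "Y i \<omega> \<noteq> \<infinity>"
      then obtain r where r: "Y i \<omega> \<le> ereal r" by (cases "Y i \<omega>") auto
      obtain n where "r \<le> real n" using real_arch_simple by blast
      then have "Y i \<omega> \<le> ereal (real n)" using r by (meson ereal_less_eq(3) order_trans)
      moreover obtain m where "S i \<omega> \<le> real m" using real_arch_simple by blast
      ultimately show False using elim by blast
    qed
    then show ?case by blast
  qed
qed

text \<open>At constant rate the clock is the identity, so the clock gaps are the true ones and the
  pathwise event is matched exactly. This is how the assumed tail of \<open>\<eta>\<close> reaches
  \<open>busy_tail\<close>.\<close>

lemma mg1_busy_count_tail: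
  assumes Q: "queue_input M (\<lambda>_. l) (\<lambda>s y. if y = \<infinity> then G s else 0) T S Y"
    and D: "real_distribution D" "cdf D = G" and W: "mg_walk l D"
  shows "measure M {\<omega> \<in> space M. busy_count (\<lambda>i. T i \<omega>) (\<lambda>i. S i \<omega>) (\<lambda>i. Y i \<omega>) > ereal u}
    = mg_walk.busy_tail l D (nat \<lfloor>u\<rfloor>)"
proof -
  interpret mg_walk l D by fact
  interpret bounded_rate "\<lambda>_. l" l using l_pos by unfold_locales auto
  interpret prob_space M using Q by (simp add: queue_input_def)
  have P: "poisson_arrivals M (\<lambda>_. l) T" using Q by (simp add: queue_input_def)
  have clock: "clock t = t" if "0 \<le> t" for t
  proof -
    have "(LBINT s=ereal 0..ereal t. l) = (LBINT s:{0..t}. l)" using that by (rule interval_integral_Icc)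
    also have "\<dots> = l * t" using that by (simp add: set_lebesgue_integral_def)
    finally show ?thesis using l_pos by (simp add: clock_def zero_ereal_def)
  qed
  have unb: "\<exists>t\<ge>0. y < clock t" for y
    using clock[of "\<bar>y\<bar> + 1"] by (intro exI[of _ "\<bar>y\<bar> + 1"]) simp
  have D': "cdf D = (\<lambda>s. if (\<infinity>::ereal) = \<infinity> then G s else 0)" using D(2) by simp
  let ?F = "\<lambda>\<omega>. (to_stream (gaps (\<lambda>i. clock (real_of_ereal (T i \<omega>)))), to_stream (\<lambda>i. S i \<omega>))"
  let ?P = "stream_space (expo l) \<Otimes>\<^sub>M stream_space D"
  let ?B = "{w \<in> space ?P. surv 0 (nat \<lfloor>u\<rfloor>) (shd (snd w)) (stl (fst w)) (stl (snd w))}"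
  note F = queue_input_law[OF Q D(1) D' unb]
  have B: "?B \<in> sets ?P" by measurable
  have T_meas: "T i \<in> borel_measurable M" for i using P by (simp add: poisson_arrivals_def)
  have "prob {\<omega> \<in> space M. busy_count (\<lambda>i. T i \<omega>) (\<lambda>i. S i \<omega>) (\<lambda>i. Y i \<omega>) > ereal u} = prob (?F -` ?B \<inter> space M)"
  proof (rule finite_measure_eq_AE)
    show "AE \<omega> in M. \<omega> \<in> {\<omega> \<in> space M. busy_count (\<lambda>i. T i \<omega>) (\<lambda>i. S i \<omega>) (\<lambda>i. Y i \<omega>) > ereal u}
        \<longleftrightarrow> \<omega> \<in> ?F -` ?B \<inter> space M"
      using arrivals_finite[OF prob_space_axioms P unb] queue_input_no_balking[OF Q] AE_space
    proof eventually_elim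
      case (elim \<omega>)
      have nn: "0 \<le> real_of_ereal (T i \<omega>)" for i
        using poisson_arrivals_paths(1)[OF P elim(3), of i] by (simp add: real_of_ereal_pos less_imp_le)
      have fin: "T i \<omega> = ereal (real_of_ereal (T i \<omega>))" for i
        using poisson_arrivals_paths(1)[OF P elim(3), of i] elim(1) by (cases "T i \<omega>") auto
      have "busy_count (\<lambda>i. T i \<omega>) (\<lambda>i. S i \<omega>) (\<lambda>i. Y i \<omega>) > ereal u
        \<longleftrightarrow> surv 0 (nat \<lfloor>u\<rfloor>) (shd (snd (?F \<omega>))) (stl (fst (?F \<omega>))) (stl (snd (?F \<omega>)))"
      proof (rule busy_count_surv_iff)
        show "T i \<omega> = ereal (real_of_ereal (T i \<omega>))" for i by (rule fin)
        show "Y i \<omega> = \<infinity>" for i using elim(2) by simp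
        show "fst (?F \<omega>) !! Suc i = real_of_ereal (T (Suc i) \<omega>) - real_of_ereal (T i \<omega>)" for i
          using nn by (simp add: to_stream_def gaps_def clock del: snth.simps(2))
        show "snd (?F \<omega>) !! i = S i \<omega>" for i by (simp add: to_stream_def)
      qed
      then show ?case using elim(3) measurable_space[OF F(1)] by blast
    qed
    show "{\<omega> \<in> space M. busy_count (\<lambda>i. T i \<omega>) (\<lambda>i. S i \<omega>) (\<lambda>i. Y i \<omega>) > ereal u} \<in> events"
      using T_meas queue_input_service(1,2)[OF Q] by (rule measurable_busy_count_event)
    show "?F -` ?B \<inter> space M \<in> events" using F(1) B by (rule measurable_sets)
  qed
  also have "\<dots> = measure (distr M ?P ?F) ?B" by (rule measure_distr[OF F(1) B, symmetric])
  also have "\<dots> = measure ?P ?B" by (simp only: F(2))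
  also have "\<dots> = busy_tail (nat \<lfloor>u\<rfloor>)" by (simp add: measure_def emeasure_surv_shd busy_tail_def)
  finally show ?thesis .
qed

text \<open>Up to null sets the event is contained in the \<open>surv\<close> event of the clock
  gaps, which has probability \<open>total_tail\<close> because these gaps are iid exponential and
  independent of the services.\<close>

lemma (in bounded_rate) eta_star_tail_le_unbounded:
  assumes Q: "queue_input M lam Psi T S Y"
    and D: "real_distribution D" "cdf D = (\<lambda>s. Psi s \<infinity>)" and W: "mg_walk l D"
    and kappa: "0 < kappa" and u: "0 \<le> u" and unb: "\<And>y. \<exists>t\<ge>0. y < clock t"
  shows "measure M {\<omega> \<in> space M. eta_star kappa (\<lambda>i. T i \<omega>) (\<lambda>i. S i \<omega>) (\<lambda>i. Y i \<omega>) > ereal u}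
    \<le> mg_walk.total_tail l D kappa (nat \<lfloor>u\<rfloor>)" (is "measure M ?A \<le> _")
proof -
  interpret mg_walk l D by fact
  interpret prob_space M using Q by (simp add: queue_input_def)
  have P: "poisson_arrivals M lam T" using Q by (simp add: queue_input_def)
  let ?X = "\<lambda>\<omega>. to_stream (gaps (\<lambda>i. clock (real_of_ereal (T i \<omega>))))"
  let ?F = "\<lambda>\<omega>. (?X \<omega>, to_stream (\<lambda>i. S i \<omega>))"
  let ?P = "stream_space (expo l) \<Otimes>\<^sub>M stream_space D"
  let ?B = "{w \<in> space ?P. surv kappa (Suc (nat \<lfloor>u\<rfloor>)) 0 (fst w) (snd w)}"
  note F = queue_input_law[OF Q D unb]
  have B: "?B \<in> sets ?P" by measurable
  have S_pos: "AE \<omega> in M. \<forall>i. 0 < S i \<omega>"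
  proof -
    have "AE \<omega> in M. 0 < S i \<omega>" for i
      using D_pos unfolding queue_input_service_distr[OF Q D, of i, symmetric]
      by (rule AE_distrD[OF queue_input_service(1)[OF Q]])
    then show ?thesis by (simp add: AE_all_countable)
  qed
  \<comment> \<open>The excluded value of the first gap is a null event, as the exponential law has
    a density.\<close>
  have X_kappa: "AE \<omega> in M. shd (?X \<omega>) \<noteq> kappa"
  proof -
    have "AE x in expo l. x \<noteq> kappa"
      using AE_lborel_singleton[of kappa] by (subst AE_density) (auto elim: eventually_mono)
    then have "AE xs in stream_space (expo l). shd xs \<noteq> kappa"
      by (subst X.AE_stream_space) (auto elim: eventually_mono)
    then have "AE xs in distr M (stream_space (expo l)) ?X. shd xs \<noteq> kappa"
      by (simp only: clock_gaps_law[OF prob_space_axioms P unb])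
    moreover have "?X \<in> measurable M (stream_space (expo l))"
      using measurable_compose[OF F(1) measurable_fst] by simp
    ultimately show ?thesis by (rule AE_distrD[rotated])
  qed
  have imp: "AE \<omega> in M. \<omega> \<in> ?A \<longrightarrow> \<omega> \<in> ?F -` ?B \<inter> space M"
    using arrivals_finite[OF prob_space_axioms P unb] S_pos X_kappa AE_space
  proof eventually_elim
    case (elim \<omega>)
    let ?\<tau> = "\<lambda>i. real_of_ereal (T i \<omega>)"
    have pos: "0 < T i \<omega>" for i by (rule poisson_arrivals_paths(1)[OF P elim(4)])
    have fin: "T i \<omega> = ereal (?\<tau> i)" for i
      using pos[of i] elim(1) by (cases "T i \<omega>") auto
    have \<tau>_less: "?\<tau> i < ?\<tau> (Suc i)" for i
    proof -
      have "T i \<omega> < T (Suc i) \<omega>" using poisson_arrivals_paths(3)[OF P elim(4)] elim(1) by blast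
      then show ?thesis using fin[of i] fin[of "Suc i"] by (metis ereal_less(1) less_ereal.simps(1))
    qed
    have \<tau>0: "0 < ?\<tau> i" for i using pos[of i] fin[of i] by (metis ereal_less(2))
    show ?case
    proof
      assume A: "\<omega> \<in> ?A"
      have "surv kappa (Suc (nat \<lfloor>u\<rfloor>)) 0 (fst (?F \<omega>)) (snd (?F \<omega>))"
      proof (rule eta_star_imp_surv)
        show "T i \<omega> = ereal (?\<tau> i)" for i by (rule fin)
        show "strict_mono ?\<tau>" using \<tau>_less by (rule strict_mono_Suc_iff[THEN iffD2, rule_format])
        show "0 < ?\<tau> 0" by (rule \<tau>0)
        show "0 \<le> S i \<omega>" for i using elim(2) by (simp add: less_imp_le)
        show "0 \<le> fst (?F \<omega>) !! 0" using \<tau>0[of 0]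
          by (simp add: to_stream_def gaps_def clock_nonneg less_imp_le)
        show "fst (?F \<omega>) !! 0 \<le> ?\<tau> 0" using clock_diff_le[of 0 "?\<tau> 0"] \<tau>0[of 0] clock_0
          by (simp add: to_stream_def gaps_def)
        show "fst (?F \<omega>) !! 0 \<noteq> kappa" using elim(3) by simp
        show "fst (?F \<omega>) !! Suc i \<le> ?\<tau> (Suc i) - ?\<tau> i" for i
          using clock_diff_le[of "?\<tau> i" "?\<tau> (Suc i)"] \<tau>0[of i] \<tau>_less[of i]
          by (simp add: to_stream_def gaps_def del: snth.simps(2))
        show "snd (?F \<omega>) !! i = S i \<omega>" for i by (simp add: to_stream_def)
        show "ereal u < eta_star kappa (\<lambda>i. T i \<omega>) (\<lambda>i. S i \<omega>) (\<lambda>i. Y i \<omega>)" using A by simp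
      qed (use kappa u in auto)
      then show "\<omega> \<in> ?F -` ?B \<inter> space M" using elim(4) measurable_space[OF F(1)] by blast
    qed
  qed
  have "prob ?A \<le> prob (?F -` ?B \<inter> space M)"
    using imp measurable_sets[OF F(1) B] by (rule finite_measure_mono_AE)
  also have "\<dots> = measure (distr M ?P ?F) ?B" by (rule measure_distr[OF F(1) B, symmetric])
  also have "\<dots> = measure ?P ?B" by (simp only: F(2))
  also have "\<dots> = total_tail kappa (nat \<lfloor>u\<rfloor>)"
    unfolding measure_def emeasure_surv total_tail_def ..
  finally show ?thesis .
qed

text \<open>The time change requires a clock that reaches every level. If it does not move over one
  period it never moves, there are almost surely no arrivals, and \<open>eta_star\<close> is 0;
  otherwise periodicity makes it unbounded.\<close>

lemma (in bounded_rate) eta_star_tail_le: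
  assumes Q: "queue_input M lam Psi T S Y"
    and D: "real_distribution D" "cdf D = (\<lambda>s. Psi s \<infinity>)" and W: "mg_walk l D"
    and kappa: "0 < kappa" and per: "\<And>t. lam (t + kappa) = lam t" and u: "0 \<le> u"
  shows "measure M {\<omega> \<in> space M. eta_star kappa (\<lambda>i. T i \<omega>) (\<lambda>i. S i \<omega>) (\<lambda>i. Y i \<omega>) > ereal u}
    \<le> mg_walk.total_tail l D kappa (nat \<lfloor>u\<rfloor>)" (is "measure M ?A \<le> _")
proof (cases "clock kappa = 0")
  case True
  interpret prob_space M using Q by (simp add: queue_input_def)
  have P: "poisson_arrivals M lam T" using Q by (simp add: queue_input_def)
  have "AE \<omega> in M. \<forall>i. ereal (real n * kappa) < T i \<omega>" for n
  proof (rule poisson_arrivals_none[OF prob_space_axioms P])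
    show "(LBINT s=0..ereal (real n * kappa). lam s) = 0"
      using clock_periodic[OF kappa per, of n] True l_pos by (simp add: clock_def)
  qed (use kappa in simp)
  then have "AE \<omega> in M. \<forall>n i. ereal (real n * kappa) < T i \<omega>" by (simp add: AE_all_countable)
  then have none: "AE \<omega> in M. \<omega> \<in> ?A \<longrightarrow> \<omega> \<in> {}"
  proof eventually_elim
    case (elim \<omega>)
    have "T i \<omega> = \<infinity>" for i
    proof (rule ccontr)
      assume "T i \<omega> \<noteq> \<infinity>"
      then obtain r where r: "T i \<omega> \<le> ereal r" by (cases "T i \<omega>") auto
      obtain n where "r \<le> real n * kappa" using ex_less_of_nat_mult[OF kappa, of r] less_imp_le by blast
      then have "T i \<omega> \<le> ereal (real n * kappa)" using r by (meson ereal_less_eq(3) order_trans)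
      then show False using elim by (simp add: not_le[THEN iffD2] leD)
    qed
    then show ?case using u by (simp add: eta_star_def)
  qed
  have "prob ?A \<le> prob {}" using none by (rule finite_measure_mono_AE) simp
  then show ?thesis using mg_walk.total_tail_nonneg[OF W, of kappa "nat \<lfloor>u\<rfloor>"] by simp
next
  case False
  then have pos: "0 < clock kappa" using clock_nonneg[of kappa] kappa by simp
  have "\<exists>t\<ge>0. y < clock t" for y
  proof -
    obtain n where "y < real n * clock kappa" using ex_less_of_nat_mult[OF pos, of y] by blast
    then have "y < clock (real n * kappa)" by (simp only: clock_periodic[OF kappa per])
    then show ?thesis using kappa by (intro exI[of _ "real n * kappa"]) simp
  qed
  then show ?thesis by (rule eta_star_tail_le_unbounded[OF Q D W kappa u])
qed

section \<open>Assembly of the asymptotic bound\<close>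

theorem theorem5:
  fixes Psi :: "real \<Rightarrow> ereal \<Rightarrow> real"
    and lam :: "real \<Rightarrow> real" and kappa lam_h rho_h :: real
    and M :: "'a measure" and T :: "nat \<Rightarrow> 'a \<Rightarrow> ereal"
    and S :: "nat \<Rightarrow> 'a \<Rightarrow> real" and Y :: "nat \<Rightarrow> 'a \<Rightarrow> ereal"
    and M' :: "'b measure" and T' :: "nat \<Rightarrow> 'b \<Rightarrow> ereal"
    and S' :: "nat \<Rightarrow> 'b \<Rightarrow> real" and Y' :: "nat \<Rightarrow> 'b \<Rightarrow> ereal"
  defines "G \<equiv> (\<lambda>s. Psi s \<infinity>)"
  assumes L: "in_L Psi"
    and lam_borel: "lam \<in> borel_measurable borel"
    and kappa_pos: "0 < kappa"
    and periodic: "\<forall>t. lam (t + kappa) = lam t"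
    and lam_bounds: "\<forall>t. 0 \<le> lam t \<and> lam t \<le> lam_h"
    and lam_h_pos: "0 < lam_h"
    and mean_fin: "(\<integral>\<^sup>+ y\<in>{0..}. ennreal y \<partial>interval_measure G) < \<infinity>"
    and rho_def: "rho_h = lam_h * enn2real (\<integral>\<^sup>+ y\<in>{0..}. ennreal y \<partial>interval_measure G)"
    and rho_lt1: "rho_h < 1"
    and model: "queue_input M lam Psi T S Y"
    and mg1: "queue_input M' (\<lambda>_. lam_h) (\<lambda>s y. if y = \<infinity> then G s else 0) T' S' Y'"
    and subexp: "subexponential G"
    and eta_tail: "((\<lambda>u. measure M' {\<omega>\<in>space M'. busy_count (\<lambda>i. T' i \<omega>) (\<lambda>i. S' i \<omega>) (\<lambda>i. Y' i \<omega>) > ereal u}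
                     / (1 - G (u * (1 - rho_h) / lam_h))) \<longlongrightarrow> 1 / (1 - rho_h)) at_top"
  shows "Limsup at_top (\<lambda>u. ereal (measure M {\<omega>\<in>space M. eta_star kappa (\<lambda>i. T i \<omega>) (\<lambda>i. S i \<omega>) (\<lambda>i. Y i \<omega>) > ereal u}
                     / (1 - G ((u - max kappa 1) * (1 - rho_h) / lam_h))))
         \<le> ereal ((1 - exp (- kappa * lam_h)) / ((1 - rho_h) * exp (- kappa * lam_h)))"
proof -
  interpret R: bounded_rate lam lam_h
    using lam_borel lam_bounds lam_h_pos by unfold_locales auto
  define D where "D = distr M borel (S 0)"
  interpret P: prob_space M using model by (simp add: queue_input_def)
  interpret D: real_distribution D
    unfolding D_def using queue_input_service(1)[OF model] by (rule P.real_distribution_distr)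
  have cdf_D: "cdf D = G" using queue_input_service(4)[OF model, of 0] by (simp add: D_def G_def)
  have cdf_D': "cdf D = (\<lambda>s. Psi s \<infinity>)" using cdf_D by (simp add: G_def)
  \<comment> \<open>\<open>mu\<close> is concentrated on the open positive quadrant, so the
    half-plane of nonpositive services is null.\<close>
  have G0: "cdf D 0 = 0"
  proof -
    obtain mu :: "(real \<times> ereal) measure" where mu: "prob_space mu" "sets mu = sets borel"
      "measure mu ({0<..} \<times> {0<..}) = 1" "\<And>s y. Psi s y = measure mu ({..s} \<times> {..y})"
      using L unfolding in_L_def by blast
    interpret mu: prob_space mu by fact
    have ms: "{..0} \<times> {..\<infinity>} \<in> sets mu" "{0<..} \<times> {0<..} \<in> sets mu"
      unfolding mu(2) by (simp_all add: borel_prod[symmetric])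
    have "mu.prob ({..0} \<times> {..\<infinity>}) + mu.prob ({0<..} \<times> {0<..}) = mu.prob ({..0} \<times> {..\<infinity>} \<union> {0<..} \<times> {0<..})"
      by (rule mu.finite_measure_Union[symmetric, OF ms]) auto
    also have "\<dots> \<le> 1" by (rule mu.prob_le_1)
    finally have "mu.prob ({..0} \<times> {..\<infinity>}) = 0" using mu(3) measure_nonneg[of mu] by (simp add: antisym)
    then show ?thesis by (simp add: cdf_D' mu(4))
  qed
  have D_pos: "AE s in D. 0 < s" using G0 by (rule D.AE_pos)
  interpret mg_walk lam_h D
    using lam_h_pos D_pos D.prob_space_axioms by unfold_locales auto
  have W: "mg_walk lam_h D" by unfold_locales
  have sub: "subexponential (cdf D)" using subexp by (simp add: cdf_D)
  \<comment> \<open>The scale of a single big jump: a large service \<open>x\<close> causes a busy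
    period of about \<open>x / (1 - rho_h)\<close>, hence about \<open>x / a\<close>
    customers.\<close>
  define a where "a = (1 - rho_h) / lam_h"
  have a: "0 < a" using rho_lt1 lam_h_pos by (simp add: a_def)
  define h where "h k = 1 - cdf D (a * real k)" for k
  define q where "q = 1 - exp (- lam_h * kappa)"
  have q: "0 \<le> q" "q < 1" using kappa_pos lam_h_pos by (simp_all add: q_def)
  have h: "0 < h k" for k using sub by (simp add: h_def subexponential_def)
  have lim: "((\<lambda>u. busy_tail (nat \<lfloor>u\<rfloor>) / (1 - cdf D (u * a))) \<longlongrightarrow> 1 / (1 - rho_h)) at_top"
    using eta_tail unfolding mg1_busy_count_tail[OF mg1 D.real_distribution_axioms cdf_D W]
    by (simp add: cdf_D a_def)
  have lim_nat: "(\<lambda>k. busy_tail k / h k) \<longlonglongrightarrow> 1 / (1 - rho_h)"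
    using filterlim_compose[OF lim filterlim_real_sequentially] by (simp add: h_def mult.commute)
  \<comment> \<open>Moving the index by \<open>j\<close> moves the argument of \<open>G\<close> by
    the constant \<open>a * j\<close>; truncated subtraction makes this valid from
    \<open>k = j\<close> on.\<close>
  have long: "(\<lambda>k. h (k - j) / h k) \<longlonglongrightarrow> 1" for j
  proof -
    have "filterlim (\<lambda>k. a * real k) at_top sequentially"
      using a by (intro filterlim_tendsto_pos_mult_at_top[OF tendsto_const] filterlim_real_sequentially)
    then have "(\<lambda>k. (1 - cdf D (a * real k - a * real j)) / (1 - cdf D (a * real k))) \<longlonglongrightarrow> 1"
      using a by (intro filterlim_compose[OF D.subexponential_long_tailed[OF sub G0]]) simp_all
    moreover have "\<forall>\<^sub>F k in sequentially. (1 - cdf D (a * real k - a * real j)) / (1 - cdf D (a * real k)) = h (k - j) / h k"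
      using eventually_ge_at_top[of j]
      by eventually_elim (simp add: h_def of_nat_diff right_diff_distrib)
    ultimately show ?thesis by (rule Lim_transform_eventually)
  qed
  have conv: "\<forall>\<^sub>F k in sequentially.
      (\<Sum>n<k. (busy_tail n - busy_tail (Suc n)) * h (k - Suc n)) \<le> (1 + e) * h k" if "0 < e" for e
    unfolding h_def
    using D.lattice_convolution_tail[OF sub G0 a busy_tail_nonneg busy_tail_le_1 lim that] .
  have bound: "\<forall>\<^sub>F k in sequentially. total_tail kappa k \<le> (q * (1 / (1 - rho_h)) / (1 - q) + e) * h k"
    if "0 < e" for e
  proof (rule defective_renewal_tail[OF h q _ total_tail_nonneg total_tail_le_1 busy_tail_Suc_le lim_nat long conv that])
    show "total_tail kappa k = q * (busy_tail k + (\<Sum>n<k. (busy_tail n - busy_tail (Suc n)) * total_tail kappa (k - Suc n)))" for k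
      unfolding q_def using kappa_pos by (intro total_tail_renewal) simp
  qed
  define B where "B = (1 - exp (- kappa * lam_h)) / ((1 - rho_h) * exp (- kappa * lam_h))"
  have qB: "q * (1 / (1 - rho_h)) / (1 - q) = B" by (simp add: q_def B_def mult.commute)
  have B0: "0 \<le> B" unfolding qB[symmetric] using q rho_lt1 by simp
  let ?f = "\<lambda>u. measure M {\<omega>\<in>space M. eta_star kappa (\<lambda>i. T i \<omega>) (\<lambda>i. S i \<omega>) (\<lambda>i. Y i \<omega>) > ereal u}
      / (1 - G ((u - max kappa 1) * (1 - rho_h) / lam_h))"
  have main: "\<forall>\<^sub>F u in at_top. ?f u \<le> B + e" if e: "0 < e" for e
  proof -
    have "filterlim (\<lambda>u::real. nat \<lfloor>u\<rfloor>) at_top at_top"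
      by (rule filterlim_compose[OF filterlim_nat_sequentially filterlim_floor_sequentially])
    then have "\<forall>\<^sub>F u::real in at_top. total_tail kappa (nat \<lfloor>u\<rfloor>) \<le> (B + e) * h (nat \<lfloor>u\<rfloor>)"
      using bound[OF e] unfolding qB by (rule eventually_compose_filterlim[rotated])
    with eventually_ge_at_top[of 0] show ?thesis
    proof eventually_elim
      case (elim u)
      let ?d = "1 - G ((u - max kappa 1) * (1 - rho_h) / lam_h)"
      have "(u - max kappa 1) * a \<le> real (nat \<lfloor>u\<rfloor>) * a"
        using a elim(1) by (intro mult_right_mono) linarith+
      then have hd: "h (nat \<lfloor>u\<rfloor>) \<le> ?d"
        using D.cdf_nondecreasing[of "(u - max kappa 1) * a" "a * real (nat \<lfloor>u\<rfloor>)"]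
        by (simp add: h_def cdf_D a_def mult.commute)
      have "measure M {\<omega>\<in>space M. eta_star kappa (\<lambda>i. T i \<omega>) (\<lambda>i. S i \<omega>) (\<lambda>i. Y i \<omega>) > ereal u}
          \<le> total_tail kappa (nat \<lfloor>u\<rfloor>)"
        by (rule R.eta_star_tail_le[OF model D.real_distribution_axioms cdf_D' W kappa_pos _ elim(1)])
           (use periodic in simp)
      also have "\<dots> \<le> (B + e) * h (nat \<lfloor>u\<rfloor>)" by (rule elim(2))
      also have "\<dots> \<le> (B + e) * ?d" using hd B0 e by (intro mult_left_mono) auto
      finally show ?case using hd h[of "nat \<lfloor>u\<rfloor>"] by (simp add: pos_divide_le_eq)
    qed
  qed
  have "Limsup at_top (\<lambda>u. ereal (?f u)) \<le> ereal B"
  proof (rule ereal_le_epsilon2)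
    fix e :: real assume "0 < e"
    then show "Limsup at_top (\<lambda>u. ereal (?f u)) \<le> ereal B + ereal e"
      using main by (intro Limsup_bounded) simp
  qed
  then show ?thesis by (simp only: B_def)
qed

end
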